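(* For every $a\in B_{\frac12}=\{a\in\mathbb C:|a|<\frac12\}$ the total gluing map $$\boxdot_a=(\oplus_a,\ominus_a):E\to G^a$$ is a linear sc-isomorphism. In particular, $$E=(\ker\oplus_a)\oplus(\ker\ominus_a),$$ and for $a\ne0$ the map $\oplus_a:\ker\ominus_a\to H^3(Z_a)$ is a linear sc-isomorphism. If $a=0$, the map $\oplus_0$ is the identity map.
   Context: An sc-structure on a Banach space $E$ is a nested sequence $E=E_0\supset E_1\supset\cdots$ of Banach spaces with compact inclusions $E_{m+1}\to E_m$ and $\bigcap_mE_m$ dense in every $E_m$. A linear sc-isomorphism is a linear bijection restricting to a topological isomorphism $E_m\to F_m$ for every $m$. $S^1=\mathbb R/\mathbb Z$, $\mathbb R^+=[0,\infty)$, $\mathbb R^-=(-\infty,0]$. $H^{k,\delta}$ denotes maps whose weak derivatives up to order $k$, multiplied by $e^{\delta|s|}$, lie in $L^2$. Fix a strictly increasing sequence $(\delta_m)_{m\ge0}$ with $\delta_0>0$. $E$ is the space of pairs $(u^+,u^-)$, $u^\pm:\mathbb R^\pm\times S^1\to\mathbb R^N$, for which there is a common constant $c\in\mathbb R^N$ with $r^\pm:=u^\pm-c\in H^{3,\delta_0}(\mathbb R^\pm\times S^1,\mathbb R^N)$; $E_m$ consists of pairs with $r^\pm\in H^{3+m,\delta_m}$, with norm $|(u^+,u^-)|_{E_m}^2=|c|^2+|r^+|^2_{H^{3+m,\delta_m}}+|r^-|^2_{H^{3+m,\delta_m}}$. Gluing profile $\varphi(r)=e^{1/r}-e$, $r\in(0,1]$.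 For $a=|a|e^{-2\pi i\vartheta}$, $0<|a|<\frac12$, put $R=\varphi(|a|)$. $C_a$ is obtained from $\mathbb R^+\times S^1\sqcup\mathbb R^-\times S^1$ by identifying $(s,t)\in[0,R]\times S^1$ with $(s',t')\in[-R,0]\times S^1$ when $s=s'+R$, $t=t'+\vartheta$; it has global coordinates $[s,t]$, $(s,t)\in\mathbb R\times S^1$. $Z_a\subset C_a$ is the finite cylinder $0\le s\le R$. Maps on $Z_a,C_a$ take values in $\mathbb R^N$. Fix a smooth $\beta:\mathbb R\to[0,1]$ with $\beta(s)+\beta(-s)=1$, $\beta(s)=1$ for $s\le-1$, $\beta'(s)<0$ on $(-1,1)$; $\beta_a(s)=\beta(s-\frac R2)$. $H^{3+m,\delta_m}_c(C_a)$ is the space of $u\in H^{3+m}_{\mathrm{loc}}(C_a)$ for which there is $c\in\mathbb R^N$ with $u-(1-2\beta_a)c\in H^{3+m,\delta_m}(C_a)$ (so $u\to c$ as $s\to+\infty$ and $u\to-c$ as $s\to-\infty$), with its natural norm. $G^0=E\oplus\{0\}$, and for $a\ne0$, $G^a=H^3(Z_a)\oplus H^{3,\delta_0}_c(C_a)$ with levels $H^{3+m}(Z_a)\oplus H^{3+m,\delta_m}_c(C_a)$. $\oplus_0(u^+,u^-)=(u^+,u^-)$, $\ominus_0(u^+,u^-)=0$. For $a\ne0$, $\oplus_a(u^+,u^-)([s,t])=\beta_a(s)u^+(s,t)+(1-\beta_a(s))u^-(s-R,t-\vartheta)$ for $0\le s\le R$, and for $s\in\mathbb R$ $$\ominus_a(u^+,u^-)([s,t])=-(1-\beta_a(s))[u^+(s,t)-\mathrm{av}_a]+\beta_a(s)[u^-(s-R,t-\vartheta)-\mathrm{av}_a],$$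 where $\mathrm{av}_a=\mathrm{av}_a(u^+,u^-)=\frac12\int_{S^1}[u^+(\frac R2,t)+u^-(-\frac R2,t)]\,dt$ (terms with vanishing coefficient are read as $0$). *)

theory Defs
  imports "HOL-Analysis.Analysis" "HOL-Library.Function_Algebras"
begin

text \<open>Pointwise scalar multiplication makes maps into \<open>\<real>\<^sup>N\<close> a real vector space
  (addition is taken from \<open>Function_Algebras\<close>).\<close>

instantiation "fun" :: (type, scaleR) scaleR
begin
definition scaleR_fun_def: "c *\<^sub>R f = (\<lambda>x. c *\<^sub>R f x)"
instance ..
end

instance "fun" :: (type, real_vector) real_vector
  by standard (auto simp: scaleR_fun_def plus_fun_def fun_eq_iff scaleR_add_right scaleR_add_left)


subsection \<open>Scales of normed spaces and sc-isomorphisms\<close>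

record 'v sc_space =
  Level :: "nat \<Rightarrow> 'v set"
  LNorm :: "nat \<Rightarrow> 'v \<Rightarrow> real"

definition linear_on :: "'v::real_vector set \<Rightarrow> ('v \<Rightarrow> 'w::real_vector) \<Rightarrow> bool" where
  "linear_on V f \<longleftrightarrow>
     (\<forall>x\<in>V. \<forall>y\<in>V. f (x + y) = f x + f y) \<and> (\<forall>c. \<forall>x\<in>V. f (c *\<^sub>R x) = c *\<^sub>R f x)"

text \<open>On every level, a topological isomorphism of normed spaces is a linear bijection which is
  bounded and has a bounded inverse.\<close>

definition sc_isomorphism ::
    "'v::real_vector sc_space \<Rightarrow> 'w::real_vector sc_space \<Rightarrow> ('v \<Rightarrow> 'w) \<Rightarrow> bool" where
  "sc_isomorphism X Y f \<longleftrightarrow>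
     linear_on (Level X 0) f \<and> bij_betw f (Level X 0) (Level Y 0) \<and>
     (\<forall>m. bij_betw f (Level X m) (Level Y m) \<and>
          (\<exists>C. \<forall>x\<in>Level X m. LNorm Y m (f x) \<le> C * LNorm X m x) \<and>
          (\<exists>C. \<forall>x\<in>Level X m. LNorm X m x \<le> C * LNorm Y m (f x)))"

definition sc_prod :: "'v sc_space \<Rightarrow> 'w sc_space \<Rightarrow> ('v \<times> 'w) sc_space" where
  "sc_prod X Y =
     \<lparr> Level = (\<lambda>m. Level X m \<times> Level Y m),
       LNorm = (\<lambda>m (x, y). sqrt ((LNorm X m x)\<^sup>2 + (LNorm Y m y)\<^sup>2)) \<rparr>"

definition sc_zero :: "'v::real_vector sc_space" where
  "sc_zero = \<lparr> Level = (\<lambda>m. {0}), LNorm = (\<lambda>m x. 0) \<rparr>"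

definition sc_subspace :: "'v sc_space \<Rightarrow> 'v set \<Rightarrow> 'v sc_space" where
  "sc_subspace X A = \<lparr> Level = (\<lambda>m. Level X m \<inter> A), LNorm = LNorm X \<rparr>"

definition sc_kernel ::
    "'v::real_vector sc_space \<Rightarrow> ('v \<Rightarrow> 'w::real_vector) \<Rightarrow> 'v set" where
  "sc_kernel X f = {x \<in> Level X 0. f x = 0}"

text \<open>\<open>X = A \<oplus> B\<close> as an algebraic direct sum of linear subspaces which, on every level, restricts
  to a topological direct sum (the projections preserve the levels and are bounded).\<close>

definition sc_direct_sum :: "'v::real_vector sc_space \<Rightarrow> 'v set \<Rightarrow> 'v set \<Rightarrow> bool" where
  "sc_direct_sum X A B \<longleftrightarrow>
     subspace A \<and> subspace B \<and> A \<subseteq> Level X 0 \<and> B \<subseteq> Level X 0 \<and> A \<inter> B = {0} \<and>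
     (\<forall>m. \<exists>C. \<forall>x\<in>Level X m. \<exists>y\<in>A \<inter> Level X m. \<exists>z\<in>B \<inter> Level X m.
        x = y + z \<and> LNorm X m y \<le> C * LNorm X m x \<and> LNorm X m z \<le> C * LNorm X m x)"


subsection \<open>Weighted Sobolev spaces on cylinders\<close>

text \<open>A map on \<open>I \<times> S\<^sup>1\<close>, with \<open>I\<close> an interval and \<open>S\<^sup>1 = \<real>/\<int>\<close>, is encoded as a map of
  \<open>(s, t) \<in> \<real> \<times> \<real>\<close> that has period 1 in \<open>t\<close> and that (so that equality of maps on \<open>I \<times> S\<^sup>1\<close> is
  equality in HOL) vanishes for \<open>s \<notin> I\<close>. Integrals over \<open>I \<times> S\<^sup>1\<close> are integrals over
  \<open>I \<times> [0,1]\<close>.\<close>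

type_synonym 'n cyl_map = "real \<times> real \<Rightarrow> real ^ 'n"

definition periodic :: "(real \<times> real \<Rightarrow> 'b) \<Rightarrow> bool" where
  "periodic u \<longleftrightarrow> (\<forall>s t. u (s, t + 1) = u (s, t))"

definition cyl_maps :: "real set \<Rightarrow> ('n::finite) cyl_map set" where
  "cyl_maps I = {u. periodic u \<and> (\<forall>s t. s \<notin> I \<longrightarrow> u (s, t) = 0)}"

definition partial_s :: "(real \<times> real \<Rightarrow> real) \<Rightarrow> real \<times> real \<Rightarrow> real" where
  "partial_s f = (\<lambda>(s, t). deriv (\<lambda>x. f (x, t)) s)"

definition partial_t :: "(real \<times> real \<Rightarrow> real) \<Rightarrow> real \<times> real \<Rightarrow> real" where
  "partial_t f = (\<lambda>(s, t). deriv (\<lambda>y. f (s, y)) t)"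

primrec C_diff :: "nat \<Rightarrow> (real \<times> real \<Rightarrow> real) \<Rightarrow> bool" where
  "C_diff 0 f \<longleftrightarrow> continuous_on UNIV f"
| "C_diff (Suc k) f \<longleftrightarrow>
     f differentiable_on UNIV \<and> C_diff k (partial_s f) \<and> C_diff k (partial_t f)"

text \<open>Smooth functions with compact support in the open cylinder \<open>interior I \<times> S\<^sup>1\<close>.\<close>

definition test_fun :: "real set \<Rightarrow> (real \<times> real \<Rightarrow> real) \<Rightarrow> bool" where
  "test_fun I \<phi> \<longleftrightarrow> (\<forall>k. C_diff k \<phi>) \<and> periodic \<phi> \<and>
     (\<exists>K. compact K \<and> K \<subseteq> interior I \<and> (\<forall>s t. s \<notin> K \<longrightarrow> \<phi> (s, t) = 0))"

definition loc_integrable :: "real set \<Rightarrow> ('n::finite) cyl_map \<Rightarrow> bool" where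
  "loc_integrable I u \<longleftrightarrow>
     (\<forall>K. compact K \<and> K \<subseteq> interior I \<longrightarrow> set_integrable lborel (K \<times> {0..1}) u)"

text \<open>\<open>v\<close> is a weak derivative \<open>\<partial>\<^sub>s\<^sup>i \<partial>\<^sub>t\<^sup>j u\<close> on \<open>I \<times> S\<^sup>1\<close>.\<close>

definition weak_deriv ::
    "real set \<Rightarrow> nat \<Rightarrow> nat \<Rightarrow> ('n::finite) cyl_map \<Rightarrow> 'n cyl_map \<Rightarrow> bool" where
  "weak_deriv I i j u v \<longleftrightarrow>
     periodic v \<and> set_borel_measurable borel (I \<times> UNIV) v \<and>
     loc_integrable I u \<and> loc_integrable I v \<and>
     (\<forall>\<phi>. test_fun I \<phi> \<longrightarrow>
        (LINT p:I \<times> {0..1}|lborel. (partial_s ^^ i) ((partial_t ^^ j) \<phi>) p *\<^sub>R u p) =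
        (-1) ^ (i + j) *\<^sub>R (LINT p:I \<times> {0..1}|lborel. \<phi> p *\<^sub>R v p))"

definition wd :: "real set \<Rightarrow> nat \<Rightarrow> nat \<Rightarrow> ('n::finite) cyl_map \<Rightarrow> 'n cyl_map" where
  "wd I i j u = (SOME v. weak_deriv I i j u v)"

text \<open>\<open>H\<^bsup>k,\<delta>\<^esup>(I \<times> S\<^sup>1, \<real>\<^sup>N)\<close> for an interval \<open>I\<close> with nonempty interior. Only \<open>k \<ge> 3\<close> occurs,
  where by the Sobolev embedding (in dimension 2) every class modulo equality almost everywhere
  has a unique representative that is continuous up to the boundary; as usual, and as the
  evaluation on circles in the average below requires, elements are identified with this
  representative. The predicate ignores the values of \<open>u\<close> outside \<open>I \<times> \<real>\<close>.\<close>

definition sobolev :: "real set \<Rightarrow> nat \<Rightarrow> real \<Rightarrow> ('n::finite) cyl_map \<Rightarrow> bool" where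
  "sobolev I k d u \<longleftrightarrow>
     periodic u \<and> continuous_on (I \<times> UNIV) u \<and>
     (\<forall>i j. i + j \<le> k \<longrightarrow> (\<exists>v. weak_deriv I i j u v \<and>
        set_integrable lborel (I \<times> {0..1}) (\<lambda>p. (exp (d * \<bar>fst p\<bar>) * norm (v p))\<^sup>2)))"

definition sobolev_norm :: "real set \<Rightarrow> nat \<Rightarrow> real \<Rightarrow> ('n::finite) cyl_map \<Rightarrow> real" where
  "sobolev_norm I k d u =
     sqrt (\<Sum>(i, j)\<in>{(i, j). i + j \<le> k}.
       LINT p:I \<times> {0..1}|lborel. (exp (d * \<bar>fst p\<bar>) * norm (wd I i j u p))\<^sup>2)"

text \<open>\<open>H\<^sup>k\<^sub>l\<^sub>o\<^sub>c(\<real> \<times> S\<^sup>1, \<real>\<^sup>N)\<close>, with the same convention.\<close>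

definition sobolev_loc :: "nat \<Rightarrow> ('n::finite) cyl_map \<Rightarrow> bool" where
  "sobolev_loc k u \<longleftrightarrow>
     periodic u \<and> continuous_on UNIV u \<and>
     (\<forall>i j. i + j \<le> k \<longrightarrow> (\<exists>v. weak_deriv UNIV i j u v \<and>
        (\<forall>K. compact K \<longrightarrow> set_integrable lborel (K \<times> {0..1}) (\<lambda>p. (norm (v p))\<^sup>2))))"


subsection \<open>The space \<open>E\<close> of pairs of maps on half-cylinders\<close>

definition asymptotic ::
    "nat \<Rightarrow> real \<Rightarrow> ('n::finite) cyl_map \<times> 'n cyl_map \<Rightarrow> real ^ 'n \<Rightarrow> bool" where
  "asymptotic k d u c \<longleftrightarrow>
     sobolev {0..} k d (\<lambda>p. fst u p - c) \<and> sobolev {..0} k d (\<lambda>p. snd u p - c)"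

definition E_set :: "(nat \<Rightarrow> real) \<Rightarrow> (('n::finite) cyl_map \<times> 'n cyl_map) set" where
  "E_set \<delta> = {u. fst u \<in> cyl_maps {0..} \<and> snd u \<in> cyl_maps {..0} \<and>
     (\<exists>c. asymptotic 3 (\<delta> 0) u c)}"

definition asym_const ::
    "(nat \<Rightarrow> real) \<Rightarrow> ('n::finite) cyl_map \<times> 'n cyl_map \<Rightarrow> real ^ 'n" where
  "asym_const \<delta> u = (THE c. asymptotic 3 (\<delta> 0) u c)"

definition E_space :: "(nat \<Rightarrow> real) \<Rightarrow> (('n::finite) cyl_map \<times> 'n cyl_map) sc_space" where
  "E_space \<delta> =
     \<lparr> Level = (\<lambda>m. {u \<in> E_set \<delta>. asymptotic (3 + m) (\<delta> m) u (asym_const \<delta> u)}),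
       LNorm = (\<lambda>m u. let c = asym_const \<delta> u in
         sqrt ((norm c)\<^sup>2
           + (sobolev_norm {0..} (3 + m) (\<delta> m) (\<lambda>p. fst u p - c))\<^sup>2
           + (sobolev_norm {..0} (3 + m) (\<delta> m) (\<lambda>p. snd u p - c))\<^sup>2)) \<rparr>"


subsection \<open>Gluing parameters and the spaces \<open>G\<^sup>a\<close>\<close>

definition cutoff :: "(real \<Rightarrow> real) \<Rightarrow> bool" where
  "cutoff \<beta> \<longleftrightarrow>
     (\<forall>k. (deriv ^^ k) \<beta> differentiable_on UNIV) \<and> (\<forall>s. 0 \<le> \<beta> s \<and> \<beta> s \<le> 1) \<and>
     (\<forall>s. \<beta> s + \<beta> (- s) = 1) \<and> (\<forall>s\<le>-1. \<beta> s = 1) \<and> (\<forall>s. -1 < s \<and> s < 1 \<longrightarrow> deriv \<beta> s < 0)"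

definition gluing_profile :: "real \<Rightarrow> real" where
  "gluing_profile r = exp (1 / r) - exp 1"

definition gl_length :: "complex \<Rightarrow> real" where
  "gl_length a = gluing_profile (cmod a)"

text \<open>A representative of \<open>\<vartheta> \<in> \<real>/\<int>\<close> in \<open>a = \<bar>a\<bar> exp (- 2 \<pi> i \<vartheta>)\<close>.\<close>

definition gl_angle :: "complex \<Rightarrow> real" where
  "gl_angle a = - Arg a / (2 * pi)"

definition beta_gl :: "(real \<Rightarrow> real) \<Rightarrow> complex \<Rightarrow> real \<Rightarrow> real" where
  "beta_gl \<beta> a s = \<beta> (s - gl_length a / 2)"

text \<open>For \<open>a \<noteq> 0\<close>, maps on \<open>C\<^sub>a\<close> and \<open>Z\<^sub>a\<close> are written in the global coordinates \<open>[s, t]\<close>, which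
  identify \<open>C\<^sub>a\<close> with \<open>\<real> \<times> S\<^sup>1\<close> and \<open>Z\<^sub>a\<close> with \<open>[0, R] \<times> S\<^sup>1\<close>; the point \<open>(s', t')\<close> of
  \<open>\<real>\<^sup>- \<times> S\<^sup>1\<close> is \<open>[s' + R, t' + \<vartheta>]\<close>.\<close>

definition Z_space :: "complex \<Rightarrow> ('n::finite) cyl_map sc_space" where
  "Z_space a = (let I = {0..gl_length a} in
     \<lparr> Level = (\<lambda>m. {u \<in> cyl_maps I. sobolev I (3 + m) 0 u}),
       LNorm = (\<lambda>m. sobolev_norm I (3 + m) 0) \<rparr>)"

definition C_remainder ::
    "(real \<Rightarrow> real) \<Rightarrow> complex \<Rightarrow> ('n::finite) cyl_map \<Rightarrow> real ^ 'n \<Rightarrow> 'n cyl_map" where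
  "C_remainder \<beta> a u c = (\<lambda>(s, t). u (s, t) - (1 - 2 * beta_gl \<beta> a s) *\<^sub>R c)"

definition C_space ::
    "(nat \<Rightarrow> real) \<Rightarrow> (real \<Rightarrow> real) \<Rightarrow> complex \<Rightarrow> ('n::finite) cyl_map sc_space" where
  "C_space \<delta> \<beta> a =
     \<lparr> Level = (\<lambda>m. {u. sobolev_loc (3 + m) u \<and>
         (\<exists>c. sobolev UNIV (3 + m) (\<delta> m) (C_remainder \<beta> a u c))}),
       LNorm = (\<lambda>m u.
         let c = (THE c. sobolev UNIV (3 + m) (\<delta> m) (C_remainder \<beta> a u c)) in
         sqrt ((norm c)\<^sup>2 + (sobolev_norm UNIV (3 + m) (\<delta> m) (C_remainder \<beta> a u c))\<^sup>2)) \<rparr>"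

text \<open>The target of the total gluing map is \<open>G\<^sup>0 = E \<oplus> {0}\<close> for \<open>a = 0\<close>, and \<open>G\<^sup>a\<close> for \<open>a \<noteq> 0\<close>;
  as they consist of different kinds of objects, they get different HOL types. The
  summand \<open>{0}\<close> is realised as the zero space of maps on \<open>\<real> \<times> S\<^sup>1\<close>.\<close>

definition G0_space ::
    "(nat \<Rightarrow> real) \<Rightarrow> ((('n::finite) cyl_map \<times> 'n cyl_map) \<times> 'n cyl_map) sc_space" where
  "G0_space \<delta> = sc_prod (E_space \<delta>) sc_zero"

definition G_space ::
    "(nat \<Rightarrow> real) \<Rightarrow> (real \<Rightarrow> real) \<Rightarrow> complex \<Rightarrow> (('n::finite) cyl_map \<times> 'n cyl_map) sc_space" where
  "G_space \<delta> \<beta> a = sc_prod (Z_space a) (C_space \<delta> \<beta> a)"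


subsection \<open>Gluing and anti-gluing\<close>

definition oplus0 :: "('n::finite) cyl_map \<times> 'n cyl_map \<Rightarrow> 'n cyl_map \<times> 'n cyl_map" where
  "oplus0 u = u"

definition ominus0 :: "('n::finite) cyl_map \<times> 'n cyl_map \<Rightarrow> 'n cyl_map" where
  "ominus0 u = 0"

definition boxdot0 ::
    "('n::finite) cyl_map \<times> 'n cyl_map \<Rightarrow> ('n cyl_map \<times> 'n cyl_map) \<times> 'n cyl_map" where
  "boxdot0 u = (oplus0 u, ominus0 u)"

text \<open>The formulas for \<open>a \<noteq> 0\<close>. Since \<open>R > 2\<close>, wherever \<open>u\<^sup>+\<close> or \<open>u\<^sup>-\<close> is evaluated outside its
  domain below, its coefficient vanishes.\<close>

definition oplus ::
    "(real \<Rightarrow> real) \<Rightarrow> complex \<Rightarrow> ('n::finite) cyl_map \<times> 'n cyl_map \<Rightarrow> 'n cyl_map" where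
  "oplus \<beta> a u = (\<lambda>(s, t).
     if s \<in> {0..gl_length a}
     then beta_gl \<beta> a s *\<^sub>R fst u (s, t)
        + (1 - beta_gl \<beta> a s) *\<^sub>R snd u (s - gl_length a, t - gl_angle a)
     else 0)"

definition av :: "complex \<Rightarrow> ('n::finite) cyl_map \<times> 'n cyl_map \<Rightarrow> real ^ 'n" where
  "av a u = (1 / 2) *\<^sub>R
     (LINT t:{0..1}|lborel. fst u (gl_length a / 2, t) + snd u (- (gl_length a / 2), t))"

definition ominus ::
    "(real \<Rightarrow> real) \<Rightarrow> complex \<Rightarrow> ('n::finite) cyl_map \<times> 'n cyl_map \<Rightarrow> 'n cyl_map" where
  "ominus \<beta> a u = (\<lambda>(s, t).
     - ((1 - beta_gl \<beta> a s) *\<^sub>R (fst u (s, t) - av a u))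
     + beta_gl \<beta> a s *\<^sub>R (snd u (s - gl_length a, t - gl_angle a) - av a u))"

definition boxdot ::
    "(real \<Rightarrow> real) \<Rightarrow> complex \<Rightarrow> ('n::finite) cyl_map \<times> 'n cyl_map \<Rightarrow> 'n cyl_map \<times> 'n cyl_map" where
  "boxdot \<beta> a u = (oplus \<beta> a u, ominus \<beta> a u)"

end

theory Submission
  imports Defs
begin

text \<open>For \<open>a = 0\<close> the total gluing map is the identity. Let \<open>a \<noteq> 0\<close>, write \<open>R\<close> and \<open>\<theta>\<close> for the length
  and the angle, \<open>b\<close> for the translated cutoff, \<open>U = u\<^sup>+\<close> and \<open>V (s, t) = u\<^sup>- (s - R, t - \<theta>)\<close>, and let \<open>m\<close>
  be the average \<open>av\<close>. At every point the pair \<open>(\<oplus>u - m, \<ominus>u)\<close> arises from \<open>(U - m, V - m)\<close> by the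
  matrix with rows \<open>(b, 1 - b)\<close> and \<open>(- (1 - b), b)\<close>. Its determinant \<open>b\<^sup>2 + (1 - b)\<^sup>2\<close> is positive, so
  \<open>U\<close> and \<open>V\<close> can be computed from \<open>v = \<oplus>u\<close> and \<open>w = \<ominus>u\<close> as soon as \<open>m\<close> is known. On the middle circle
  \<open>s = R/2\<close> both weights are \<open>1/2\<close>, hence \<open>m\<close> is the average of \<open>v\<close> over that circle. This is the
  inverse map \<open>unglue\<close>; the lemmas \<open>unglue_boxdot\<close> and \<open>boxdot_unglue\<close> are this linear algebra.

  What remains is that both maps preserve the levels and are bounded there. Subtract the
  constants: let \<open>c\<close> be the asymptotic constant of \<open>u\<close>, let \<open>r\<^sup>+ = U - c\<close> and \<open>r\<^sup>- = V - c\<close>, let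
  \<open>q = m - c\<close>, and let \<open>\<rho> = w - (1 - 2b) q\<close>. Then
  \<open>v = c + b r\<^sup>+ + (1 - b) r\<^sup>-\<close> and \<open>\<rho> = - (1 - b) r\<^sup>+ + b r\<^sup>-\<close>, and \<open>q\<close> is an average of \<open>r\<^sup>+\<close> and \<open>r\<^sup>-\<close>
  over circles. Conversely \<open>c = m - q\<close>, and \<open>r\<^sup>+\<close>, \<open>r\<^sup>-\<close> are obtained from \<open>v - c\<close> and \<open>\<rho>\<close> by the inverse
  matrix. So only three operations have to be bounded between weighted Sobolev spaces:
  multiplication by a smooth function of \<open>s\<close> with bounded derivatives (\<open>sobolev_mult\<close>), translation
  with a twist (\<open>sobolev_shift\<close>), and the average over a circle (\<open>trace_bounded\<close>). The multiplication
  lemma includes restriction to a smaller cylinder and extension by zero to a larger one. The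
  extensions are harmless because \<open>R > 2\<close>: the coefficients \<open>b\<close> and \<open>1 - b\<close> vanish near the
  end at which a map stops being defined. On the finite cylinder all weights are comparable. The
  constants \<open>c\<close> and \<open>q\<close> are determined by \<open>u\<close> and \<open>w\<close>, because a map that is a nonzero constant on a
  half-cylinder does not have finite weighted norm (\<open>sobolev_eventually_const\<close>).

  The Sobolev norm is defined through weak derivatives that are merely chosen, so every estimate
  rests on their uniqueness almost everywhere (\<open>fundamental_lemma\<close>). The test functions and the
  mollifiers that this and the trace estimate need are made from the cutoff \<open>\<beta>\<close> itself.

  The splitting of \<open>E\<close> into the two kernels, and the isomorphism of \<open>ker \<ominus>\<close> with the space over the
  finite cylinder, hold for every sc-isomorphism onto a product
  (\<open>sc_isomorphism_onto_product\<close>).\<close>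

section \<open>Smooth functions of two variables\<close>

definition smooth :: "(real \<times> real \<Rightarrow> real) \<Rightarrow> bool" where
  "smooth f \<longleftrightarrow> (\<forall>k. C_diff k f)"

lemma C_diff_SucD: "C_diff (Suc k) f \<Longrightarrow> C_diff k f"
proof (induction k arbitrary: f)
  case 0
  then show ?case by (simp add: differentiable_imp_continuous_on)
next
  case (Suc k)
  show ?case using Suc.prems Suc.IH[of "partial_s f"] Suc.IH[of "partial_t f"]
    unfolding C_diff.simps(2) by blast
qed

lemma has_partial_s:
  assumes "f differentiable_on UNIV"
  shows "((\<lambda>x. f (x, t)) has_real_derivative partial_s f (s, t)) (at s)"
proof -
  have "f differentiable at (s, t)" using assms by (auto simp: differentiable_on_def)
  then have "(f \<circ> (\<lambda>x. (x, t))) differentiable at s"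
    by (intro differentiable_chain_at
        differentiableI[OF has_derivative_Pair[OF has_derivative_ident has_derivative_const]])
  then show ?thesis
    unfolding partial_s_def o_def prod.case by (simp only: DERIV_deriv_iff_real_differentiable)
qed

lemma has_partial_t:
  assumes "f differentiable_on UNIV"
  shows "((\<lambda>y. f (s, y)) has_real_derivative partial_t f (s, t)) (at t)"
proof -
  have "f differentiable at (s, t)" using assms by (auto simp: differentiable_on_def)
  then have "(f \<circ> (\<lambda>y. (s, y))) differentiable at t"
    by (intro differentiable_chain_at
        differentiableI[OF has_derivative_Pair[OF has_derivative_const has_derivative_ident]])
  then show ?thesis
    unfolding partial_t_def o_def prod.case by (simp only: DERIV_deriv_iff_real_differentiable)
qed

lemma partial_s_eqI:
  "(\<And>s t. ((\<lambda>x. f (x, t)) has_real_derivative g (s, t)) (at s)) \<Longrightarrow> partial_s f = g"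
  by (auto simp: partial_s_def fun_eq_iff intro!: DERIV_imp_deriv)

lemma partial_t_eqI:
  "(\<And>s t. ((\<lambda>y. f (s, y)) has_real_derivative g (s, t)) (at t)) \<Longrightarrow> partial_t f = g"
  by (auto simp: partial_t_def fun_eq_iff intro!: DERIV_imp_deriv)

lemma partial_add:
  assumes "f differentiable_on UNIV" "g differentiable_on UNIV"
  shows "partial_s (\<lambda>p. f p + g p) = (\<lambda>p. partial_s f p + partial_s g p)"
    and "partial_t (\<lambda>p. f p + g p) = (\<lambda>p. partial_t f p + partial_t g p)"
  by (intro partial_s_eqI partial_t_eqI DERIV_add has_partial_s has_partial_t assms)+

lemma partial_mult:
  assumes d: "f differentiable_on UNIV" "g differentiable_on UNIV"
  shows "partial_s (\<lambda>p. f p * g p) = (\<lambda>p. partial_s f p * g p + f p * partial_s g p)"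
    and "partial_t (\<lambda>p. f p * g p) = (\<lambda>p. partial_t f p * g p + f p * partial_t g p)"
  by (intro partial_s_eqI DERIV_cong[OF DERIV_mult'[OF has_partial_s[OF d(1)] has_partial_s[OF d(2)]]]
      add.commute)
    (intro partial_t_eqI DERIV_cong[OF DERIV_mult'[OF has_partial_t[OF d(1)] has_partial_t[OF d(2)]]]
      add.commute)

lemma C_diff_add: "C_diff k f \<Longrightarrow> C_diff k g \<Longrightarrow> C_diff k (\<lambda>p. f p + g p)"
proof (induction k arbitrary: f g)
  case 0
  then show ?case by (simp add: continuous_on_add)
next
  case (Suc k)
  then have d: "f differentiable_on UNIV" "g differentiable_on UNIV" by auto
  show ?case using Suc.prems Suc.IH d by (simp add: partial_add[OF d] differentiable_on_add)
qed

lemma C_diff_mult: "C_diff k f \<Longrightarrow> C_diff k g \<Longrightarrow> C_diff k (\<lambda>p. f p * g p)"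
proof (induction k arbitrary: f g)
  case 0
  then show ?case by (simp add: continuous_on_mult)
next
  case (Suc k)
  then have d: "f differentiable_on UNIV" "g differentiable_on UNIV" by auto
  have c: "C_diff k f" "C_diff k g" using Suc.prems C_diff_SucD by blast+
  have "(\<lambda>p. f p * g p) differentiable_on UNIV"
    using d by (simp add: differentiable_on_def differentiable_mult)
  moreover have "C_diff k (partial_s (\<lambda>p. f p * g p))" "C_diff k (partial_t (\<lambda>p. f p * g p))"
    unfolding partial_mult[OF d] using Suc.prems c by (intro C_diff_add Suc.IH; simp)+
  ultimately show ?case by simp
qed

lemma partial_const:
  "partial_s (\<lambda>p. c) = (\<lambda>p. 0)" "partial_t (\<lambda>p. c) = (\<lambda>p. 0)"
  by (auto intro!: partial_s_eqI partial_t_eqI)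

lemma C_diff_const: "C_diff k (\<lambda>p. c)"
  by (induction k arbitrary: c) (auto simp: partial_const)

lemma C_diff_fst: "C_diff k fst"
proof (cases k)
  case (Suc n)
  have "partial_s fst = (\<lambda>p. 1)" "partial_t fst = (\<lambda>p. 0)"
    by (auto intro!: partial_s_eqI partial_t_eqI)
  moreover have "fst differentiable_on UNIV"
    by (auto simp: differentiable_on_def
        intro!: differentiableI[OF has_derivative_fst[OF has_derivative_ident]])
  ultimately show ?thesis using Suc by (auto simp: C_diff_const)
qed (simp add: continuous_on_fst[OF continuous_on_id, simplified])

lemma C_diff_snd: "C_diff k snd"
proof (cases k)
  case (Suc n)
  have "partial_s snd = (\<lambda>p. 0)" "partial_t snd = (\<lambda>p. 1)"
    by (auto intro!: partial_s_eqI partial_t_eqI)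
  moreover have "snd differentiable_on UNIV"
    by (auto simp: differentiable_on_def
        intro!: differentiableI[OF has_derivative_snd[OF has_derivative_ident]])
  ultimately show ?thesis using Suc by (auto simp: C_diff_const)
qed (simp add: continuous_on_snd[OF continuous_on_id, simplified])

text \<open>The smoothness clause of \<open>cutoff\<close>.\<close>

definition smooth_real :: "(real \<Rightarrow> real) \<Rightarrow> bool" where
  "smooth_real h \<longleftrightarrow> (\<forall>k. (deriv ^^ k) h differentiable_on UNIV)"

lemma smooth_real_deriv: "smooth_real h \<Longrightarrow> smooth_real (deriv h)"
  unfolding smooth_real_def
proof
  fix k
  assume "\<forall>k. (deriv ^^ k) h differentiable_on UNIV"
  then have "(deriv ^^ Suc k) h differentiable_on UNIV" by blast
  then show "(deriv ^^ k) (deriv h) differentiable_on UNIV" by (simp add: funpow_swap1)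
qed

lemma smooth_real_diff: "smooth_real h \<Longrightarrow> h differentiable_on UNIV"
  unfolding smooth_real_def by (drule spec[of _ 0]) simp

lemma smooth_real_has_deriv: "smooth_real h \<Longrightarrow> (h has_real_derivative deriv h x) (at x)"
  using smooth_real_diff[of h]
  by (simp add: DERIV_deriv_iff_real_differentiable differentiable_on_def)

text \<open>The induction runs over all outer functions at once, since the chain rule replaces
  \<open>h\<close> by its derivative.\<close>

lemma C_diff_compose: "smooth_real h \<Longrightarrow> C_diff k f \<Longrightarrow> C_diff k (\<lambda>p. h (f p))"
proof (induction k arbitrary: f h)
  case 0
  have "h differentiable_on UNIV"
    by (rule smooth_real_diff[OF 0(1)])
  then have "continuous_on UNIV h" by (rule differentiable_imp_continuous_on)
  from this 0(2) show ?case unfolding C_diff.simps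
    by (rule continuous_on_compose2) simp_all
next
  case (Suc k)
  then have d: "f differentiable_on UNIV" by auto
  have hd: "h differentiable_on UNIV"
    by (rule smooth_real_diff[OF Suc.prems(1)])
  have c: "C_diff k f" using Suc.prems C_diff_SucD by blast
  have "(\<lambda>p. h (f p)) differentiable_on UNIV"
    by (rule differentiable_on_compose[OF d differentiable_on_subset[OF hd subset_UNIV]])
  moreover have "partial_s (\<lambda>p. h (f p)) = (\<lambda>p. deriv h (f p) * partial_s f p)"
    by (intro partial_s_eqI)
      (rule DERIV_chain2[OF smooth_real_has_deriv[OF Suc.prems(1)] has_partial_s[OF d]])
  moreover have "partial_t (\<lambda>p. h (f p)) = (\<lambda>p. deriv h (f p) * partial_t f p)"
    by (intro partial_t_eqI)
      (rule DERIV_chain2[OF smooth_real_has_deriv[OF Suc.prems(1)] has_partial_t[OF d]])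
  moreover have "C_diff k (\<lambda>p. deriv h (f p) * g p)" if "C_diff k g" for g
    by (rule C_diff_mult[OF Suc.IH[OF smooth_real_deriv[OF Suc.prems(1)] c] that])
  ultimately show ?case using Suc.prems by simp
qed

text \<open>The derivative of \<open>1 / f\<close> is a product of \<open>f'\<close> with two copies of
  \<open>1 / f\<close>, which are covered by the induction hypothesis.\<close>

lemma C_diff_inverse:
  assumes "\<And>p. f p \<noteq> 0"
  shows "C_diff k f \<Longrightarrow> C_diff k (\<lambda>p. inverse (f p))"
proof (induction k)
  case 0
  then show ?case using assms by (simp add: continuous_on_inverse)
next
  case (Suc k)
  then have d: "f differentiable_on UNIV" by auto
  have c: "C_diff k (\<lambda>p. inverse (f p))" using Suc C_diff_SucD by blast
  have "(\<lambda>p. inverse (f p)) differentiable_on UNIV"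
    using d assms by (auto simp: differentiable_on_def intro!: differentiable_inverse)
  moreover have "partial_s (\<lambda>p. inverse (f p))
      = (\<lambda>p. (-1) * (inverse (f p) * partial_s f p * inverse (f p)))"
    by (intro partial_s_eqI DERIV_cong[OF DERIV_inverse'[OF has_partial_s[OF d] assms]]) simp
  moreover have "partial_t (\<lambda>p. inverse (f p))
      = (\<lambda>p. (-1) * (inverse (f p) * partial_t f p * inverse (f p)))"
    by (intro partial_t_eqI DERIV_cong[OF DERIV_inverse'[OF has_partial_t[OF d] assms]]) simp
  moreover have "C_diff k (\<lambda>p. (-1) * (inverse (f p) * g p * inverse (f p)))"
    if "C_diff k g" for g
    by (intro C_diff_mult C_diff_const c that)
  ultimately show ?case using Suc.prems by simp
qed

lemma deriv_shift_arg: "deriv (\<lambda>x. g (x + a)) s = deriv g (s + a)" for g :: "real \<Rightarrow> real"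
  unfolding deriv_def by (rule arg_cong[where f = Eps]) (rule ext, rule DERIV_shift[symmetric])

lemma partial_shift:
  "partial_s (\<lambda>(s, t). f (s + a, t + b)) = (\<lambda>(s, t). partial_s f (s + a, t + b))"
  "partial_t (\<lambda>(s, t). f (s + a, t + b)) = (\<lambda>(s, t). partial_t f (s + a, t + b))"
  unfolding partial_s_def partial_t_def prod.case
  using deriv_shift_arg[of "\<lambda>x. f (x, _)"] deriv_shift_arg[of "\<lambda>y. f (_, y)"]
  by (simp_all add: fun_eq_iff)

lemma C_diff_shift: "C_diff k f \<Longrightarrow> C_diff k (\<lambda>(s, t). f (s + a, t + b))"
proof (induction k arbitrary: f)
  case 0
  then show ?case
    unfolding case_prod_unfold C_diff.simps
    by (rule continuous_on_compose2) (intro continuous_intros, simp)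
next
  case (Suc k)
  have "(\<lambda>p. f (p + (a, b))) differentiable_on UNIV"
    using Suc.prems differentiable_on_compose[of "\<lambda>p. p + (a, b)" UNIV f]
    by (simp add: differentiable_on_def)
  then have "(\<lambda>(s, t). f (s + a, t + b)) differentiable_on UNIV"
    by (simp add: case_prod_unfold plus_prod_def)
  then show ?case using Suc by (simp add: partial_shift)
qed

lemma smooth_cont: "smooth f \<Longrightarrow> continuous_on UNIV f"
  unfolding smooth_def using C_diff.simps(1) by blast

lemma smooth_diff: "smooth f \<Longrightarrow> f differentiable_on UNIV"
  unfolding smooth_def using C_diff.simps(2) by blast

lemma smooth_add: "smooth f \<Longrightarrow> smooth g \<Longrightarrow> smooth (\<lambda>p. f p + g p)"
  by (simp add: smooth_def C_diff_add)

lemma smooth_mult: "smooth f \<Longrightarrow> smooth g \<Longrightarrow> smooth (\<lambda>p. f p * g p)"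
  by (simp add: smooth_def C_diff_mult)

lemma smooth_const: "smooth (\<lambda>p. c)"
  by (simp add: smooth_def C_diff_const)

lemma smooth_cmult: "smooth f \<Longrightarrow> smooth (\<lambda>p. c * f p)"
  by (intro smooth_mult smooth_const)

lemma smooth_diffs: "smooth f \<Longrightarrow> smooth g \<Longrightarrow> smooth (\<lambda>p. f p - g p)"
  using smooth_add[OF _ smooth_cmult[of g "-1"], of f] by simp

lemma smooth_fst: "smooth fst" and smooth_snd: "smooth snd"
  by (simp_all add: smooth_def C_diff_fst C_diff_snd)

lemma smooth_compose: "smooth_real h \<Longrightarrow> smooth f \<Longrightarrow> smooth (\<lambda>p. h (f p))"
  by (simp add: smooth_def C_diff_compose)

lemma smooth_divide:
  "smooth f \<Longrightarrow> smooth g \<Longrightarrow> (\<And>p. g p \<noteq> 0) \<Longrightarrow> smooth (\<lambda>p. f p / g p)"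
  by (simp add: smooth_def divide_inverse C_diff_mult C_diff_inverse)

lemma smooth_shift: "smooth f \<Longrightarrow> smooth (\<lambda>(s, t). f (s + a, t + b))"
  unfolding smooth_def using C_diff_shift by blast

lemma smooth_partial: "smooth f \<Longrightarrow> smooth (partial_s f)" "smooth f \<Longrightarrow> smooth (partial_t f)"
  unfolding smooth_def using C_diff.simps(2) by blast+

lemma smooth_partials: "smooth f \<Longrightarrow> smooth ((partial_s ^^ i) f)"
  "smooth f \<Longrightarrow> smooth ((partial_t ^^ i) f)"
  by (induction i) (simp_all add: smooth_partial)

lemma smooth_real_cos: "smooth_real cos"
proof -
  have d: "deriv (\<lambda>x. a * cos x + b * sin x) = (\<lambda>x. b * cos x + (- a) * sin x)" for a b :: real
    by (rule ext, rule DERIV_imp_deriv) (auto intro!: derivative_eq_intros)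
  have "\<exists>a b. (deriv ^^ k) cos = (\<lambda>x::real. a * cos x + b * sin x)" for k
  proof (induction k)
    case 0
    then show ?case by (intro exI[of _ 1] exI[of _ 0]) auto
  next
    case (Suc k)
    then obtain a b where "(deriv ^^ k) cos = (\<lambda>x::real. a * cos x + b * sin x)" by blast
    then have "(deriv ^^ Suc k) cos = (\<lambda>x::real. b * cos x + (- a) * sin x)"
      using d[of a b] by simp
    then show ?case by blast
  qed
  moreover have "(\<lambda>x::real. a * cos x + b * sin x) differentiable_on UNIV" for a b
    unfolding differentiable_on_def
  proof
    fix x :: real
    have "((\<lambda>x. a * cos x + b * sin x) has_real_derivative (b * cos x - a * sin x)) (at x)"
      by (auto intro!: derivative_eq_intros)
    then show "(\<lambda>x. a * cos x + b * sin x) differentiable at x"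
      unfolding real_differentiable_def by blast
  qed
  ultimately show ?thesis unfolding smooth_real_def by metis
qed

lemma partials_add:
  assumes "smooth f" "smooth g"
  shows "(partial_s ^^ i) (\<lambda>p. f p + g p) = (\<lambda>p. (partial_s ^^ i) f p + (partial_s ^^ i) g p)"
  using assms
  by (induction i) (simp_all add: partial_add smooth_diff smooth_partials)

lemma partials_cmult:
  assumes "smooth f"
  shows "(partial_s ^^ i) (\<lambda>p. c * f p) = (\<lambda>p. c * (partial_s ^^ i) f p)"
  using assms
proof (induction i)
  case (Suc i)
  have "partial_s (\<lambda>p. c * (partial_s ^^ i) f p) = (\<lambda>p. c * partial_s ((partial_s ^^ i) f) p)"
    using partial_mult(1)[of "\<lambda>p. c" "(partial_s ^^ i) f"]
    by (simp add: partial_const smooth_diff smooth_partials Suc.prems smooth_const)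
  with Suc show ?case by simp
qed auto

lemma partials_diff:
  assumes "smooth f" "smooth g"
  shows "(partial_s ^^ i) (\<lambda>p. f p - g p) = (\<lambda>p. (partial_s ^^ i) f p - (partial_s ^^ i) g p)"
  using partials_add[OF assms(1) smooth_cmult[OF assms(2), of "-1"], of i]
    partials_cmult[OF assms(2), of i "-1"] by simp

text \<open>The Leibniz rule read from right to left: iterating \<open>G \<partial>f = \<partial>(G f) -
  (\<partial>G) f\<close> and collecting terms by Pascal's rule leaves only derivatives of
  products. In this form a multiplier can be moved from a map onto the test function, where
  \<open>(\<partial>\<^sup>l G) f\<close> is again a test function.\<close>

lemma leibniz_adjoint:
  assumes G: "smooth G" and f: "smooth f"
  shows "G p * (partial_s ^^ i) f p =
     (\<Sum>l\<le>i. (-1) ^ l * real (i choose l)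
        * (partial_s ^^ (i - l)) (\<lambda>q. (partial_s ^^ l) G q * f q) p)"
  using f
proof (induction i arbitrary: f)
  case (Suc i)
  let ?G = "\<lambda>l. (partial_s ^^ l) G"
  let ?D = "\<lambda>j l. (partial_s ^^ j) (\<lambda>q. ?G l q * f q) p"
  have sG: "smooth (?G l)" for l using G by (rule smooth_partials)
  have f': "smooth (partial_s f)" using Suc.prems smooth_partial by blast
  have pw: "(partial_s ^^ Suc j) h = (partial_s ^^ j) (partial_s h)" for j h
    by (simp add: funpow_swap1)
  have step: "(partial_s ^^ j) (\<lambda>q. ?G l q * partial_s f q) p = ?D (Suc j) l - ?D j (Suc l)"
    for j l
  proof -
    have "(\<lambda>q. ?G l q * partial_s f q)
        = (\<lambda>q. partial_s (\<lambda>q. ?G l q * f q) q - ?G (Suc l) q * f q)"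
      using partial_mult(1)[OF smooth_diff[OF sG[of l]] smooth_diff[OF Suc.prems]] by simp
    moreover have "(partial_s ^^ j) \<dots> = (\<lambda>q. (partial_s ^^ j) (partial_s (\<lambda>q. ?G l q * f q)) q
        - (partial_s ^^ j) (\<lambda>q. ?G (Suc l) q * f q) q)"
      by (intro partials_diff smooth_partial smooth_mult sG Suc.prems)
    ultimately show ?thesis unfolding pw by simp
  qed
  define a where "a = (\<lambda>l. (-1) ^ l * real (i choose l) * ?D (Suc i - l) l)"
  define b where "b = (\<lambda>l. (-1) ^ l * real (i choose l) * ?D (i - l) (Suc l))"
  have "G p * (partial_s ^^ Suc i) f p = G p * (partial_s ^^ i) (partial_s f) p"
    unfolding pw ..
  also have "\<dots> = (\<Sum>l\<le>i. (-1) ^ l * real (i choose l)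
        * (?D (Suc (i - l)) l - ?D (i - l) (Suc l)))"
    using Suc.IH[OF f'] step by simp
  also have "\<dots> = (\<Sum>l\<le>i. a l) - (\<Sum>l\<le>i. b l)"
    unfolding a_def b_def sum_subtractf[symmetric]
    by (rule sum.cong) (auto simp: Suc_diff_le algebra_simps)
  also have "(\<Sum>l\<le>i. a l) = (\<Sum>l\<le>Suc i. a l)" by (simp add: a_def)
  also have "\<dots> = a 0 + (\<Sum>l\<le>i. a (Suc l))" by (rule sum.atMost_Suc_shift)
  also have "a 0 + (\<Sum>l\<le>i. a (Suc l)) - (\<Sum>l\<le>i. b l)
     = a 0 + (\<Sum>l\<le>i. (-1) ^ Suc l * real (Suc i choose Suc l) * ?D (Suc i - Suc l) (Suc l))"
    unfolding add_diff_eq[symmetric] sum_subtractf[symmetric]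
    by (intro arg_cong2[where f = "(+)"] sum.cong refl)
      (simp add: a_def b_def algebra_simps)
  also have "\<dots> = (\<Sum>l\<le>Suc i. (-1) ^ l * real (Suc i choose l) * ?D (Suc i - l) l)"
    by (subst sum.atMost_Suc_shift) (simp add: a_def)
  finally show ?case .
qed auto

section \<open>Test functions\<close>

lemma test_smooth: "test_fun I \<phi> \<Longrightarrow> smooth \<phi>"
  by (simp add: test_fun_def smooth_def)

lemma partial_s_off:
  assumes "closed S" "\<And>s t. s \<notin> S \<Longrightarrow> f (s, t) = c" "s \<notin> S"
  shows "partial_s f (s, t) = 0"
proof -
  have o: "open (- S)" using assms(1) by (simp add: open_Compl)
  have "((\<lambda>x. f (x, t)) has_real_derivative 0) (at s)"
    by (rule has_field_derivative_transform_within_open[of "\<lambda>x. c", OF _ o])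
      (use assms in auto)
  then show ?thesis by (simp add: partial_s_def DERIV_imp_deriv)
qed

lemma partials_s_off:
  assumes "closed S" "\<And>s t. s \<notin> S \<Longrightarrow> f (s, t) = 0" "s \<notin> S"
  shows "(partial_s ^^ i) f (s, t) = 0"
  using assms(3)
proof (induction i arbitrary: s t)
  case (Suc i)
  show ?case
    using partial_s_off[OF assms(1), of "(partial_s ^^ i) f" 0 s t] Suc by simp
qed (use assms in auto)

lemma partial_t_off:
  assumes "\<And>t. f (s, t) = 0"
  shows "partial_t f (s, t) = 0"
  using assms by (simp add: partial_t_def)

lemma test_partial_s: "test_fun I \<phi> \<Longrightarrow> test_fun I (partial_s \<phi>)"
  unfolding test_fun_def
proof (elim conjE exE, intro conjI exI)
  fix K assume K: "compact K" "K \<subseteq> interior I" "\<forall>s t. s \<notin> K \<longrightarrow> \<phi> (s, t) = 0"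
  show "compact K" "K \<subseteq> interior I" by fact+
  show "\<forall>s t. s \<notin> K \<longrightarrow> partial_s \<phi> (s, t) = 0"
    using partial_s_off[OF compact_imp_closed[OF K(1)]] K(3) by blast
  assume c: "\<forall>k. C_diff k \<phi>" and p: "periodic \<phi>"
  show "\<forall>k. C_diff k (partial_s \<phi>)" using c C_diff.simps(2) by blast
  show "periodic (partial_s \<phi>)" using p by (simp add: periodic_def partial_s_def)
qed

lemma test_partial_t: "test_fun I \<phi> \<Longrightarrow> test_fun I (partial_t \<phi>)"
  unfolding test_fun_def
proof (elim conjE exE, intro conjI exI)
  fix K assume K: "compact K" "K \<subseteq> interior I" "\<forall>s t. s \<notin> K \<longrightarrow> \<phi> (s, t) = 0"
  show "compact K" "K \<subseteq> interior I" by fact+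
  show "\<forall>s t. s \<notin> K \<longrightarrow> partial_t \<phi> (s, t) = 0"
    using partial_t_off K(3) by blast
  assume c: "\<forall>k. C_diff k \<phi>" and p: "periodic \<phi>"
  show "\<forall>k. C_diff k (partial_t \<phi>)" using c C_diff.simps(2) by blast
  show "periodic (partial_t \<phi>)"
    unfolding periodic_def
  proof (intro allI)
    fix s t
    have "partial_t \<phi> (s, t + 1) = deriv (\<lambda>x. \<phi> (s, x + 1)) t"
      using deriv_shift_arg[of "\<lambda>y. \<phi> (s, y)" 1 t] by (simp add: partial_t_def)
    then show "partial_t \<phi> (s, t + 1) = partial_t \<phi> (s, t)"
      using p by (simp add: periodic_def partial_t_def)
  qed
qed

lemma test_partials:
  "test_fun I \<phi> \<Longrightarrow> test_fun I ((partial_s ^^ i) \<phi>)"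
  "test_fun I \<phi> \<Longrightarrow> test_fun I ((partial_t ^^ i) \<phi>)"
  by (induction i) (simp_all add: test_partial_s test_partial_t)

text \<open>Functions of \<open>s\<close> alone, kept as functions on the plane so that one calculus serves
  them and the test functions.\<close>

definition t_invariant :: "(real \<times> real \<Rightarrow> real) \<Rightarrow> bool" where
  "t_invariant G \<longleftrightarrow> (\<forall>s t. G (s, t) = G (s, 0))"

lemma t_invariant_partial_s: "t_invariant G \<Longrightarrow> t_invariant ((partial_s ^^ l) G)"
proof (induction l)
  case (Suc l)
  then have "(\<lambda>x. (partial_s ^^ l) G (x, t)) = (\<lambda>x. (partial_s ^^ l) G (x, 0))" for t
    unfolding t_invariant_def by blast
  then have "partial_s ((partial_s ^^ l) G) (s, t) = partial_s ((partial_s ^^ l) G) (s, 0)" for s t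
    unfolding partial_s_def[of "(partial_s ^^ l) G"] prod.case by (rule arg_cong)
  then show ?case by (simp add: t_invariant_def)
qed simp

lemma partials_t_mult:
  assumes "smooth G" "t_invariant G" "smooth f"
  shows "(partial_t ^^ j) (\<lambda>q. G q * f q) = (\<lambda>q. G q * (partial_t ^^ j) f q)"
proof (induction j)
  case (Suc j)
  have "(\<lambda>y. G (s, y)) = (\<lambda>y. G (s, 0))" for s
    using assms(2) unfolding t_invariant_def by blast
  then have "partial_t G (s, t) = deriv (\<lambda>y. G (s, 0)) t" for s t
    unfolding partial_t_def prod.case by (rule arg_cong)
  then have "partial_t G = (\<lambda>p. 0)"
    by (simp add: fun_eq_iff)
  then have "partial_t (\<lambda>q. G q * (partial_t ^^ j) f q)
      = (\<lambda>q. G q * partial_t ((partial_t ^^ j) f) q)"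
    using partial_mult(2)[OF smooth_diff[OF assms(1)]
        smooth_diff[OF smooth_partials(2)[OF assms(3), of j]]] by simp
  then show ?case using Suc by simp
qed simp

text \<open>If \<open>G\<close> lives on \<open>S\<close>, the product is supported in \<open>K \<inter>
  S\<close>. So it is a test function on \<open>I\<close> even where \<open>J\<close> is larger
  than \<open>I\<close>; this is what makes extension by zero compatible with weak derivatives.\<close>

lemma test_mult:
  assumes "test_fun J \<phi>" "smooth G" "t_invariant G" "closed S"
    and "\<And>s t. s \<notin> S \<Longrightarrow> G (s, t) = 0" and "interior J \<inter> S \<subseteq> interior I"
  shows "test_fun I (\<lambda>q. G q * \<phi> q)"
proof -
  obtain K where K: "compact K" "K \<subseteq> interior J" "\<forall>s t. s \<notin> K \<longrightarrow> \<phi> (s, t) = 0"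
    using assms(1) unfolding test_fun_def by blast
  have s: "smooth (\<lambda>q. G q * \<phi> q)" by (rule smooth_mult[OF assms(2) test_smooth[OF assms(1)]])
  show ?thesis
    unfolding test_fun_def
  proof (intro conjI exI)
    show "\<forall>k. C_diff k (\<lambda>q. G q * \<phi> q)" using s by (simp add: smooth_def)
    have "periodic \<phi>" using assms(1) by (simp add: test_fun_def)
    then show "periodic (\<lambda>q. G q * \<phi> q)"
      using assms(3) unfolding periodic_def t_invariant_def by metis
    show "compact (K \<inter> S)" using K(1) assms(4) by (rule compact_Int_closed)
    show "K \<inter> S \<subseteq> interior I" using K(2) assms(6) by blast
    show "\<forall>s t. s \<notin> K \<inter> S \<longrightarrow> G (s, t) * \<phi> (s, t) = 0" using K(3) assms(5) by auto
  qed
qed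

lemma partials_shift:
  "(partial_s ^^ i) (\<lambda>(s, t). f (s + a, t + b)) = (\<lambda>(s, t). (partial_s ^^ i) f (s + a, t + b))"
  "(partial_t ^^ i) (\<lambda>(s, t). f (s + a, t + b)) = (\<lambda>(s, t). (partial_t ^^ i) f (s + a, t + b))"
  by (induction i) (simp_all add: partial_shift)

lemma test_shift:
  assumes "test_fun ((+) a ` I) \<phi>"
  shows "test_fun I (\<lambda>(s, t). \<phi> (s + a, t + b))"
proof -
  obtain K where K: "compact K" "K \<subseteq> interior ((+) a ` I)" "\<forall>s t. s \<notin> K \<longrightarrow> \<phi> (s, t) = 0"
    using assms(1) unfolding test_fun_def by blast
  show ?thesis
    unfolding test_fun_def
  proof (intro conjI exI)
    show "\<forall>k. C_diff k (\<lambda>(s, t). \<phi> (s + a, t + b))"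
      using smooth_shift[OF test_smooth[OF assms]] by (simp add: smooth_def)
    have "periodic \<phi>" using assms(1) by (simp add: test_fun_def)
    then have "\<phi> (s + a, t + b + 1) = \<phi> (s + a, t + b)" for s t unfolding periodic_def by blast
    then show "periodic (\<lambda>(s, t). \<phi> (s + a, t + b))"
      unfolding periodic_def by (simp add: add.assoc add.commute[of b 1])
    show "compact ((+) (-a) ` K)" using K(1) by (rule compact_translation)
    show "(+) (-a) ` K \<subseteq> interior I" using K(2) unfolding interior_translation by auto
    show "\<forall>s t. s \<notin> (+) (-a) ` K \<longrightarrow> (\<lambda>(s, t). \<phi> (s + a, t + b)) (s, t) = 0"
    proof (intro allI impI)
      fix s t assume *: "s \<notin> (+) (-a) ` K"
      have "s + a \<notin> K"
      proof
        assume "s + a \<in> K"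
        then have "- a + (s + a) \<in> (+) (-a) ` K" by blast
        with * show False by simp
      qed
      with K(3) show "(\<lambda>(s, t). \<phi> (s + a, t + b)) (s, t) = 0" by simp
    qed
  qed
qed

section \<open>Integration over a cylinder\<close>

lemma cyl_integral_cong_supp:
  fixes f :: "real \<times> real \<Rightarrow> 'b::{banach, second_countable_topology}"
  assumes "\<And>s t. s \<in> I \<Longrightarrow> s \<notin> J \<Longrightarrow> f (s, t) = 0" "\<And>s t. s \<in> J \<Longrightarrow> s \<notin> I \<Longrightarrow> f (s, t) = 0"
  shows "(LINT p:I \<times> {0..1::real}|lborel. f p) = (LINT p:J \<times> {0..1}|lborel. f p)"
    and "set_integrable lborel (I \<times> {0..1::real}) f \<longleftrightarrow> set_integrable lborel (J \<times> {0..1}) f"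
proof -
  have "(\<lambda>p. indicat_real (I \<times> {0..1}) p *\<^sub>R f p) = (\<lambda>p. indicat_real (J \<times> {0..1}) p *\<^sub>R f p)"
    using assms by (auto simp: fun_eq_iff indicator_def)
  then show "(LINT p:I \<times> {0..1::real}|lborel. f p) = (LINT p:J \<times> {0..1}|lborel. f p)"
    and "set_integrable lborel (I \<times> {0..1::real}) f \<longleftrightarrow> set_integrable lborel (J \<times> {0..1}) f"
    by (simp_all add: set_lebesgue_integral_def set_integrable_def)
qed

lemma set_integrable_bounded_mult:
  fixes u :: "'a::euclidean_space \<Rightarrow> 'b::{banach, second_countable_topology}"
  assumes "set_integrable lborel A u" "g \<in> borel_measurable borel" "\<And>p. p \<in> A \<Longrightarrow> \<bar>g p\<bar> \<le> B"
  shows "set_integrable lborel A (\<lambda>p. g p *\<^sub>R u p)"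
proof -
  have m: "(\<lambda>p. indicator A p *\<^sub>R u p) \<in> borel_measurable borel"
    using borel_measurable_integrable[OF assms(1)[unfolded set_integrable_def]] by simp
  have eq: "(\<lambda>p. indicator A p *\<^sub>R (g p *\<^sub>R u p)) = (\<lambda>p. g p *\<^sub>R (indicator A p *\<^sub>R u p))"
    by (simp add: fun_eq_iff)
  have "integrable lborel (\<lambda>p. B *\<^sub>R (indicator A p *\<^sub>R u p))"
    using assms(1) unfolding set_integrable_def by (rule integrable_scaleR_right)
  then have "integrable lborel (\<lambda>p. g p *\<^sub>R (indicator A p *\<^sub>R u p))"
  proof (rule Bochner_Integration.integrable_bound)
    show "(\<lambda>p. g p *\<^sub>R (indicator A p *\<^sub>R u p)) \<in> borel_measurable lborel"
      using borel_measurable_scaleR[OF assms(2) m] by (simp only: measurable_lborel2)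
    show "AE p in lborel. norm (g p *\<^sub>R (indicator A p *\<^sub>R u p))
        \<le> norm (B *\<^sub>R (indicator A p *\<^sub>R u p))"
    proof (rule AE_I2)
      fix p
      show "norm (g p *\<^sub>R (indicator A p *\<^sub>R u p)) \<le> norm (B *\<^sub>R (indicator A p *\<^sub>R u p))"
      proof (cases "p \<in> A")
        case True
        then have "\<bar>g p\<bar> \<le> \<bar>B\<bar>" using assms(3)[of p] by linarith
        then show ?thesis using True by (simp add: mult_right_mono)
      qed simp
    qed
  qed
  then show ?thesis unfolding set_integrable_def eq .
qed

lemma loc_integrable_mult_integrable:
  fixes u :: "('n::finite) cyl_map"
  assumes "loc_integrable I u" "continuous_on UNIV g" "compact K" "K \<subseteq> interior I"
    and "\<And>s t. s \<notin> K \<Longrightarrow> g (s, t) = 0"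
  shows "set_integrable lborel (I \<times> {0..1}) (\<lambda>p. g p *\<^sub>R u p)"
proof -
  have "compact (g ` (K \<times> {0..1}))"
    by (rule compact_continuous_image[OF continuous_on_subset[OF assms(2)]])
      (use assms(3) in \<open>auto intro: compact_Times\<close>)
  then have "bounded (g ` (K \<times> {0..1}))" by (rule compact_imp_bounded)
  then obtain B where B: "\<And>p. p \<in> K \<times> {0..1} \<Longrightarrow> \<bar>g p\<bar> \<le> B"
    unfolding bounded_iff by auto
  have "set_integrable lborel (K \<times> {0..1}) (\<lambda>p. g p *\<^sub>R u p)"
    by (rule set_integrable_bounded_mult[OF _ borel_measurable_continuous_onI[OF assms(2)] B])
      (use assms in \<open>auto simp: loc_integrable_def\<close>)
  moreover have "K \<subseteq> I" using assms(4) interior_subset by blast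
  ultimately show ?thesis
    using cyl_integral_cong_supp(2)[of I K "\<lambda>p. g p *\<^sub>R u p"] assms(5) by auto
qed

lemma test_integrable:
  fixes u :: "('n::finite) cyl_map"
  assumes "test_fun I \<phi>" "loc_integrable I u"
  shows "set_integrable lborel (I \<times> {0..1}) (\<lambda>p. \<phi> p *\<^sub>R u p)"
proof -
  obtain K where K: "compact K" "K \<subseteq> interior I" "\<forall>s t. s \<notin> K \<longrightarrow> \<phi> (s, t) = 0"
    using assms(1) unfolding test_fun_def by blast
  then show ?thesis
    using loc_integrable_mult_integrable[OF assms(2) smooth_cont[OF test_smooth[OF assms(1)]]]
    by blast
qed

lemma lborel_shift:
  fixes g :: "'a::euclidean_space \<Rightarrow> 'b::{banach, second_countable_topology}"
  assumes "integrable lborel g"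
  shows "integrable lborel (\<lambda>x. g (c + x))" "(LINT x|lborel. g (c + x)) = (LINT x|lborel. g x)"
proof -
  have m: "(+) c \<in> measurable lborel borel" by simp
  have gm: "g \<in> borel_measurable borel"
    using borel_measurable_integrable[OF assms] by simp
  have d: "distr lborel borel ((+) c) = (lborel :: 'a measure)" by (rule lborel_distr_plus)
  show "integrable lborel (\<lambda>x. g (c + x))"
    using integrable_distr_eq[OF m gm] assms unfolding d by simp
  show "(LINT x|lborel. g (c + x)) = (LINT x|lborel. g x)"
    using integral_distr[OF m gm] unfolding d by simp
qed

lemma mem_translate: "x \<in> (+) e ` A \<longleftrightarrow> x - e \<in> A" for x :: "'a::ab_group_add"
proof
  assume "x - e \<in> A"
  then have "e + (x - e) \<in> (+) e ` A" by blast
  then show "x \<in> (+) e ` A" by simp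
next
  assume "x \<in> (+) e ` A"
  then obtain y where "y \<in> A" "x = e + y" by blast
  then show "x - e \<in> A" by (metis add.commute add_diff_cancel_right')
qed

lemma sets_translate:
  assumes "A \<in> sets borel"
  shows "(+) e ` A \<in> sets (borel :: 'a::euclidean_space measure)"
proof -
  have "(\<lambda>x. x - e) -` A \<inter> space borel \<in> sets borel"
    by (rule measurable_sets[OF _ assms]) simp
  moreover have "(\<lambda>x. x - e) -` A \<inter> space borel = (+) e ` A"
    by (rule set_eqI) (simp only: vimage_eq Int_iff space_borel UNIV_I mem_translate simp_thms)
  ultimately show ?thesis by simp
qed

lemma set_integral_shift:
  fixes f :: "'a::euclidean_space \<Rightarrow> 'b::{banach, second_countable_topology}"
  assumes "set_integrable lborel A f"
  shows "set_integrable lborel ((+) (-c) ` A) (\<lambda>x. f (c + x))"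
    and "(LINT x:(+) (-c) ` A|lborel. f (c + x)) = (LINT x:A|lborel. f x)"
proof -
  have "x \<in> (+) (-c) ` A \<longleftrightarrow> c + x \<in> A" for x
    by (metis (no_types, lifting) add_minus_cancel image_iff minus_add_cancel)
  then have "(\<lambda>x. indicator ((+) (-c) ` A) x *\<^sub>R f (c + x))
      = (\<lambda>x. (\<lambda>y. indicat_real A y *\<^sub>R f y) (c + x))"
    by (auto simp: indicator_def)
  then show "set_integrable lborel ((+) (-c) ` A) (\<lambda>x. f (c + x))"
    and "(LINT x:(+) (-c) ` A|lborel. f (c + x)) = (LINT x:A|lborel. f x)"
    using lborel_shift[of "\<lambda>y. indicat_real A y *\<^sub>R f y" c] assms
    unfolding set_integrable_def set_lebesgue_integral_def by simp_all
qed

text \<open>The piece \<open>A1\<close> that is cut off from the fundamental domain \<open>A\<close> keeps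
  its integral when it is moved by the period \<open>e\<close>.\<close>

lemma set_integral_fundamental_domain:
  fixes f :: "'a::euclidean_space \<Rightarrow> 'b::{banach, second_countable_topology}"
  assumes f: "set_integrable lborel A f" and per: "\<And>x. f (e + x) = f x"
    and A: "A \<in> sets lborel" "A1 \<in> sets lborel" "A1 \<subseteq> A" and dis: "(A - A1) \<inter> (+) e ` A1 = {}"
  shows "set_integrable lborel ((A - A1) \<union> (+) e ` A1) f"
    and "(LINT x:(A - A1) \<union> (+) e ` A1|lborel. f x) = (LINT x:A|lborel. f x)"
proof -
  have f1: "set_integrable lborel A1 f" "set_integrable lborel (A - A1) f"
    using set_integrable_subset[OF f] A by auto
  have per': "f (- e + x) = f x" for x using per[of "- e + x"] by simp
  have f2: "set_integrable lborel ((+) e ` A1) f"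
    and e2: "(LINT x:(+) e ` A1|lborel. f x) = (LINT x:A1|lborel. f x)"
    using set_integral_shift[OF f1(1), of "- e"] per' by simp_all
  have s: "A - A1 \<in> sets lborel" "(+) e ` A1 \<in> sets lborel"
    using A sets_translate by auto
  show "set_integrable lborel ((A - A1) \<union> (+) e ` A1) f"
    by (rule set_integrable_Un[OF f1(2) f2 s])
  have "(LINT x:A|lborel. f x) = (LINT x:(A - A1) \<union> A1|lborel. f x)"
    using A(3) by (simp add: Un_absorb2 Un_commute)
  also have "\<dots> = (LINT x:A - A1|lborel. f x) + (LINT x:A1|lborel. f x)"
    by (rule set_integral_Un) (use f1 in auto)
  finally show "(LINT x:(A - A1) \<union> (+) e ` A1|lborel. f x) = (LINT x:A|lborel. f x)"
    using set_integral_Un[OF dis f1(2) f2] e2 by simp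
qed

lemma periodic_of_int:
  assumes "periodic f"
  shows "f (s, t + of_int n) = f (s, t)"
proof -
  have n: "f (s, t + real k) = f (s, t)" for t k
  proof (induction k)
    case (Suc k)
    have "f (s, (t + real k) + 1) = f (s, t + real k)"
      using assms unfolding periodic_def by blast
    then show ?case using Suc by (simp add: add.assoc add.commute[of 1])
  qed simp
  show ?thesis
  proof (cases "n \<ge> 0")
    case True
    then show ?thesis using n[of t "nat n"] by simp
  next
    case False
    then show ?thesis using n[of "t + of_int n" "nat (- n)"] by simp
  qed
qed

lemma null_lines:
  "UNIV \<times> {c} \<in> null_sets (lborel :: (real \<times> real) measure)"
  "{c} \<times> UNIV \<in> null_sets (lborel :: (real \<times> real) measure)"
  unfolding lborel_prod[symmetric] null_sets_def
  by (auto simp: lborel.emeasure_pair_measure_Times simp del: UNIV_Times_UNIV)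

lemma AE_lines:
  "AE p in (lborel :: (real \<times> real) measure). snd p \<noteq> c"
  "AE p in (lborel :: (real \<times> real) measure). fst p \<noteq> c"
  by (rule AE_I'[OF null_lines(1)[of c]], auto)
    (rule AE_I'[OF null_lines(2)[of c]], auto)

lemma sets_Times_real:
  assumes "I \<in> sets borel" "J \<in> sets borel"
  shows "I \<times> J \<in> sets (borel :: (real \<times> real) measure)"
  using assms unfolding borel_prod[symmetric] by (auto intro: pair_measureI)

text \<open>Translation in \<open>s\<close> moves the base, and the twist by \<open>b\<close> only moves the
  fundamental domain of the circle from \<open>[0, 1)\<close> to \<open>[\<theta>, 1 +
  \<theta>)\<close>, where \<open>\<theta>\<close> is the fractional part of \<open>b\<close>.
  Half-open intervals keep the translated pieces disjoint; the missing line \<open>t = 1\<close>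
  is a null set.\<close>

lemma periodic_integral_shift:
  fixes f :: "real \<times> real \<Rightarrow> 'b::{banach, second_countable_topology}"
  assumes f: "set_integrable lborel (I \<times> {0..1}) f" and per: "periodic f" and I: "I \<in> sets borel"
  shows "set_integrable lborel ((+) (-a) ` I \<times> {0..1}) (\<lambda>(s, t). f (s + a, t + b))"
    and "(LINT p:(+) (-a) ` I \<times> {0..1}|lborel. (\<lambda>(s, t). f (s + a, t + b)) p)
      = (LINT p:I \<times> {0..1}|lborel. f p)"
proof -
  define \<theta> where "\<theta> = frac b"
  have \<theta>: "0 \<le> \<theta>" "\<theta> < 1" by (auto simp: \<theta>_def frac_lt_1)
  let ?g = "\<lambda>p. f ((a, \<theta>) + p)"
  have "f (s, t + b) = f (s, t + \<theta>)" for s t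
    using periodic_of_int[OF per, of s "t + \<theta>" "\<lfloor>b\<rfloor>"]
    by (simp add: \<theta>_def frac_def add.assoc)
  then have g: "(\<lambda>(s, t). f (s + a, t + b)) = ?g"
    by (simp add: fun_eq_iff add.commute)
  have pe: "f ((0, 1) + x) = f x" for x
    using per unfolding periodic_def by (cases x) (simp add: add.commute)
  have pe': "?g ((0, 1) + x) = ?g x" for x
    using pe[of "(a, \<theta>) + x"] by (simp add: algebra_simps)
  have ae: "(LINT p:J \<times> {0..1}|lborel. h p) = (LINT p:J \<times> {0..<1}|lborel. h p)"
    if h: "set_integrable lborel (J \<times> {0..1}) h" and J: "J \<in> sets borel"
    for h :: "real \<times> real \<Rightarrow> 'b" and J
  proof -
    have s: "set_integrable lborel (J \<times> {0..<1}) h"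
      by (rule set_integrable_subset[OF h]) (use J in \<open>auto intro: sets_Times_real\<close>)
    show ?thesis
      unfolding set_lebesgue_integral_def
    proof (rule integral_cong_AE)
      show "(\<lambda>p. indicator (J \<times> {0..1}) p *\<^sub>R h p) \<in> borel_measurable lborel"
        "(\<lambda>p. indicator (J \<times> {0..<1}) p *\<^sub>R h p) \<in> borel_measurable lborel"
        using h s unfolding set_integrable_def by (blast dest: borel_measurable_integrable)+
      show "AE p in lborel. indicator (J \<times> {0..1}) p *\<^sub>R h p = indicator (J \<times> {0..<1}) p *\<^sub>R h p"
        using AE_lines(1)[of 1] by eventually_elim (auto simp: indicator_def)
    qed
  qed
  let ?I = "(+) (-a) ` I"
  have I': "?I \<in> sets borel" by (rule sets_translate[OF I])
  let ?A = "I \<times> {0..<1::real}" and ?A1 = "I \<times> {0..<\<theta>}"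
  have fA: "set_integrable lborel ?A f"
    by (rule set_integrable_subset[OF f]) (use I in \<open>auto intro: sets_Times_real\<close>)
  have A: "?A \<in> sets lborel" "?A1 \<in> sets lborel" "?A1 \<subseteq> ?A"
    using I \<theta> by (auto intro: sets_Times_real)
  have dis: "(?A - ?A1) \<inter> (+) (0, 1) ` ?A1 = {}"
    by auto
  have B: "(?A - ?A1) \<union> (+) (0, 1) ` ?A1 = I \<times> {\<theta>..<1 + \<theta>}"
  proof -
    have "(s, t) \<in> (+) (0, 1) ` ?A1 \<longleftrightarrow> s \<in> I \<and> 1 \<le> t \<and> t < 1 + \<theta>" for s t
      by (auto simp: mem_translate)
    then show ?thesis using \<theta> by (auto simp: set_eq_iff)
  qed
  have C: "(+) (- (a, \<theta>)) ` (I \<times> {\<theta>..<1 + \<theta>}) = ?I \<times> {0..<1}"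
  proof -
    have "(s, t) \<in> (+) (- (a, \<theta>)) ` (I \<times> {\<theta>..<1 + \<theta>}) \<longleftrightarrow> s \<in> ?I \<and> 0 \<le> t \<and> t < 1" for s t
      unfolding mem_translate by auto
    then show ?thesis by (auto simp: set_eq_iff)
  qed
  note 1 = set_integral_fundamental_domain[OF fA pe A dis, unfolded B]
  note 2 = set_integral_shift[OF 1(1), of "(a, \<theta>)", unfolded C]
  have "set_integrable lborel (?I \<times> {0}) ?g"
    by (rule set_integrable_subset[OF 2(1)]) (use I' in \<open>auto intro: sets_Times_real\<close>)
  then have "set_integrable lborel ((+) (- (0, - 1)) ` (?I \<times> {0})) (\<lambda>x. ?g ((0, -1) + x))"
    by (rule set_integral_shift)
  moreover have "x \<in> (+) (- (0, - 1)) ` (?I \<times> {0}) \<longleftrightarrow> x \<in> ?I \<times> {1::real}" for x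
    by (cases x) (auto simp: mem_translate)
  then have "(+) (- (0, - 1)) ` (?I \<times> {0}) = ?I \<times> {1::real}" by blast
  moreover have "?g ((0, -1) + x) = ?g x" for x
    using pe'[of "(0, -1) + x"] by (simp add: add.assoc[symmetric] zero_prod_def[symmetric])
  ultimately have "set_integrable lborel (?I \<times> {1}) ?g" by simp
  then have 3: "set_integrable lborel (?I \<times> {0..<1} \<union> ?I \<times> {1}) ?g"
    by (rule set_integrable_Un[OF 2(1)]) (use I' in \<open>auto intro: sets_Times_real\<close>)
  have "?I \<times> {0..<1} \<union> ?I \<times> {1} = ?I \<times> {0..1::real}" by auto
  with 3 have 4: "set_integrable lborel (?I \<times> {0..1}) ?g" by simp
  then show "set_integrable lborel ((+) (-a) ` I \<times> {0..1}) (\<lambda>(s, t). f (s + a, t + b))"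
    unfolding g .
  show "(LINT p:(+) (-a) ` I \<times> {0..1}|lborel. (\<lambda>(s, t). f (s + a, t + b)) p)
      = (LINT p:I \<times> {0..1}|lborel. f p)"
    unfolding g using ae[OF 4 I'] ae[OF f I] 1(2) 2(2) by simp
qed

lemma product_integral:
  fixes f :: "real \<Rightarrow> 'b::{banach, second_countable_topology}" and h :: "real \<Rightarrow> real"
  assumes h: "integrable lborel h" and f: "integrable lborel f"
  shows "integrable lborel (\<lambda>p. h (fst p) *\<^sub>R f (snd p))"
    and "(LINT p|lborel. h (fst p) *\<^sub>R f (snd p)) = (LINT s|lborel. h s) *\<^sub>R (LINT t|lborel. f t)"
proof -
  have m: "h \<in> borel_measurable lborel" "f \<in> borel_measurable lborel" using h f by auto
  have i: "integrable (lborel \<Otimes>\<^sub>M lborel) (\<lambda>p. h (fst p) *\<^sub>R f (snd p))"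
  proof (rule lborel_pair.Fubini_integrable)
    show "(\<lambda>p. h (fst p) *\<^sub>R f (snd p)) \<in> borel_measurable (lborel \<Otimes>\<^sub>M lborel)"
      using m by measurable
    show "integrable lborel (\<lambda>x. LINT y|lborel. norm (h (fst (x, y)) *\<^sub>R f (snd (x, y))))"
      using h f by simp
    show "AE x in lborel. integrable lborel (\<lambda>y. h (fst (x, y)) *\<^sub>R f (snd (x, y)))"
      using f by simp
  qed
  then show "integrable lborel (\<lambda>p. h (fst p) *\<^sub>R f (snd p))" by (simp add: lborel_prod)
  have "(LINT p|(lborel \<Otimes>\<^sub>M lborel). h (fst p) *\<^sub>R f (snd p))
      = (LINT s|lborel. LINT t|lborel. h s *\<^sub>R f t)"
    using lborel_pair.integral_fst'[OF i] by simp
  then show "(LINT p|lborel. h (fst p) *\<^sub>R f (snd p)) = (LINT s|lborel. h s) *\<^sub>R (LINT t|lborel. f t)"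
    using h f by (simp add: lborel_prod)
qed

text \<open>The statement on the line is the one on the unit square for a function that does not depend on
  \<open>s\<close>.\<close>

lemma circle_integral_shift:
  fixes f :: "real \<Rightarrow> 'b::{banach, second_countable_topology}"
  assumes f: "continuous_on UNIV f" and per: "\<And>t. f (t + 1) = f t"
  shows "(LINT t:{0..1}|lborel. f (t + b)) = (LINT t:{0..1}|lborel. f t)"
proof -
  have int: "integrable lborel (\<lambda>t. indicat_real {0..1} t *\<^sub>R g t)"
    if "continuous_on UNIV g" for g :: "real \<Rightarrow> 'b"
    using borel_integrable_compact[of "{0..1}" g] continuous_on_subset[OF that]
    by simp
  have f': "continuous_on UNIV (\<lambda>t. f (t + b))"
    by (rule continuous_on_compose2[OF f]) (auto intro: continuous_intros)
  have ind: "integrable lborel (indicat_real {0..1::real})"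
    "(LINT s|lborel. indicat_real {0..1::real} s) = 1"
    by (auto intro!: integrable_real_indicator)
  have eq: "(LINT p:{0..1::real} \<times> {0..1}|lborel. g (snd p)) = (LINT t:{0..1}|lborel. g t)"
    "set_integrable lborel ({0..1::real} \<times> {0..1::real}) (\<lambda>p. g (snd p))"
    if "continuous_on UNIV g" for g :: "real \<Rightarrow> 'b"
  proof -
    have *: "(\<lambda>p. indicat_real ({0..1::real} \<times> {0..1::real}) p *\<^sub>R g (snd p))
      = (\<lambda>p. indicat_real {0..1} (fst p) *\<^sub>R (indicat_real {0..1} (snd p) *\<^sub>R g (snd p)))"
      by (auto simp: fun_eq_iff indicator_def)
    show "(LINT p:{0..1::real} \<times> {0..1}|lborel. g (snd p)) = (LINT t:{0..1}|lborel. g t)"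
      "set_integrable lborel ({0..1::real} \<times> {0..1::real}) (\<lambda>p. g (snd p))"
      using product_integral[OF ind(1) int[OF that]] ind(2)
      unfolding set_lebesgue_integral_def set_integrable_def * by simp_all
  qed
  have "periodic (\<lambda>p. f (snd p))" using per by (simp add: periodic_def)
  from periodic_integral_shift(2)[OF eq(2)[OF f] this, of 0 b]
  show ?thesis using eq(1)[OF f] eq(1)[OF f'] by (simp add: case_prod_unfold)
qed

text \<open>By the fundamental theorem of calculus on lines: in direction \<open>s\<close> the boundary
  terms vanish by compact support, in direction \<open>t\<close> they cancel by periodicity. It
  follows that constants have vanishing weak derivatives.\<close>

lemma cyl_integral_partial_0:
  assumes "test_fun I \<phi>"
  shows "(LINT p:I \<times> {0..1}|lborel. partial_s \<phi> p) = 0"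
    and "(LINT p:I \<times> {0..1}|lborel. partial_t \<phi> p) = 0"
proof -
  obtain K where K: "compact K" "K \<subseteq> interior I" "\<And>s t. s \<notin> K \<Longrightarrow> \<phi> (s, t) = 0"
    using assms(1) unfolding test_fun_def by blast
  obtain M where M: "K \<subseteq> {-M..M}" "M > 0"
  proof -
    from compact_imp_bounded[OF K(1)] obtain M where "M > 0" "\<And>x. x \<in> K \<Longrightarrow> norm x \<le> M"
      unfolding bounded_pos by blast
    then have "K \<subseteq> {-M..M}" by (auto simp: abs_le_iff) (metis minus_le_iff)
    then show ?thesis using \<open>M > 0\<close> that by blast
  qed
  have z: "\<phi> (s, t) = 0" if "s \<notin> {-M..M}" for s t using K(3) M that by blast
  have KI: "K \<subseteq> I" using K(2) interior_subset by blast
  have sm: "smooth \<phi>" by (rule test_smooth[OF assms])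
  have sp: "smooth (partial_s \<phi>)" "smooth (partial_t \<phi>)"
    by (simp_all add: smooth_partial sm)
  have strip: "(LINT p:I \<times> {0..1}|lborel. g p)
      = (LINT p|(lborel \<Otimes>\<^sub>M lborel). indicator ({-M..M} \<times> {0..1}) p *\<^sub>R g p)"
    if "\<And>s t. s \<notin> K \<Longrightarrow> g (s, t) = 0" for g :: "real \<times> real \<Rightarrow> real"
  proof -
    have "(LINT p:I \<times> {0..1}|lborel. g p) = (LINT p:{-M..M} \<times> {0..1}|lborel. g p)"
      by (rule cyl_integral_cong_supp(1)) (use that KI M(1) in blast)+
    then show ?thesis by (simp add: set_lebesgue_integral_def lborel_prod)
  qed
  have int: "integrable (lborel \<Otimes>\<^sub>M lborel) (\<lambda>p. indicator ({-M..M} \<times> {0..1::real}) p *\<^sub>R g p)"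
    if "continuous_on UNIV g" for g :: "real \<times> real \<Rightarrow> real"
    unfolding lborel_prod
    by (rule borel_integrable_compact) (auto intro: compact_Times continuous_on_subset[OF that])
  have zs: "partial_s \<phi> (s, t) = 0" "partial_t \<phi> (s, t) = 0" if "s \<notin> K" for s t
    using partial_s_off[OF compact_imp_closed[OF K(1)], of \<phi> 0 s t] partial_t_off[of \<phi> s t] K(3) that
    by auto
  have cont_s: "isCont (\<lambda>s. g (s, t)) s" and cont_t: "isCont (\<lambda>t. g (s, t)) t"
    if "smooth g" for g and s t :: real
  proof -
    have "continuous_on UNIV (\<lambda>s. g (s, t))" "continuous_on UNIV (\<lambda>t. g (s, t))"
      by (rule continuous_on_compose2[OF smooth_cont[OF that]]; auto intro!: continuous_intros)+
    then show "isCont (\<lambda>s. g (s, t)) s" "isCont (\<lambda>t. g (s, t)) t"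
      by (auto simp: continuous_on_eq_continuous_at)
  qed
  have s0: "(LINT s|lborel. indicator ({-M..M} \<times> {0..1}) (s, t) *\<^sub>R partial_s \<phi> (s, t)) = 0" for t
  proof -
    have "(LINT s|lborel. partial_s \<phi> (s, t) * indicator {-M - 1..M + 1} s)
        = \<phi> (M + 1, t) - \<phi> (-M - 1, t)"
      by (rule integral_FTC_Icc_real)
        (use M(2) has_partial_s[OF smooth_diff[OF sm]] cont_s[OF sp(1)] in auto)
    also have "\<dots> = 0" using z by auto
    also have "(\<lambda>s. partial_s \<phi> (s, t) * indicator {-M - 1..M + 1} s)
        = (\<lambda>s. indicator {-M..M} s *\<^sub>R partial_s \<phi> (s, t))"
    proof
      fix s
      have "s \<notin> {-M..M} \<Longrightarrow> partial_s \<phi> (s, t) = 0" using zs(1) M(1) by blast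
      then show "partial_s \<phi> (s, t) * indicator {-M - 1..M + 1} s
        = indicator {-M..M} s *\<^sub>R partial_s \<phi> (s, t)"
        by (cases "s \<in> {-M..M}") (auto simp: indicator_def)
    qed
    finally have "(LINT s|lborel. indicator {-M..M} s *\<^sub>R partial_s \<phi> (s, t)) = 0" .
    then show ?thesis by (cases "t \<in> {0..1}") (auto simp: indicator_times)
  qed
  have t0: "(LINT t|lborel. indicator ({-M..M} \<times> {0..1}) (s, t) *\<^sub>R partial_t \<phi> (s, t)) = 0" for s
  proof -
    have "(LINT t|lborel. partial_t \<phi> (s, t) * indicator {0..1} t) = \<phi> (s, 1) - \<phi> (s, 0)"
      by (rule integral_FTC_Icc_real)
        (use has_partial_t[OF smooth_diff[OF sm]] cont_t[OF sp(2)] in auto)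
    also have "\<dots> = 0"
      using assms unfolding test_fun_def periodic_def by (metis add_0 diff_self)
    finally have "(LINT t|lborel. indicator {0..1} t *\<^sub>R partial_t \<phi> (s, t)) = 0"
      by (simp add: mult.commute)
    then show ?thesis by (cases "s \<in> {-M..M}") (auto simp: indicator_times)
  qed
  show "(LINT p:I \<times> {0..1}|lborel. partial_s \<phi> p) = 0"
    using strip[of "partial_s \<phi>", OF zs(1)]
      lborel_pair.integral_snd[of "\<lambda>s t. indicator ({-M..M} \<times> {0..1}) (s, t) *\<^sub>R partial_s \<phi> (s, t)"]
      int[OF smooth_cont[OF sp(1)]] s0
    by (simp add: case_prod_unfold)
  show "(LINT p:I \<times> {0..1}|lborel. partial_t \<phi> p) = 0"
    using strip[of "partial_t \<phi>", OF zs(2)]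
      lborel_pair.integral_fst'[OF int[OF smooth_cont[OF sp(2)]]] t0
    by simp
qed

section \<open>The fundamental lemma of the calculus of variations\<close>

text \<open>Weak derivatives only see the interior of \<open>I\<close>. For such bases the rest of the
  cylinder is a null set, so that they are determined almost everywhere on all of it.\<close>

definition strip_base :: "real set \<Rightarrow> bool" where
  "strip_base I \<longleftrightarrow> closed I \<and> finite (I - interior I)"

text \<open>The cutoff of the gluing construction also serves the analysis: test functions, approximations
  of indicators and mollifiers are all built from it.\<close>

locale smooth_cutoff =
  fixes \<beta> :: "real \<Rightarrow> real"
  assumes cutoff: "cutoff \<beta>"
begin

lemma cutoff_smooth: "smooth_real \<beta>"
  using cutoff by (simp add: cutoff_def smooth_real_def)

lemma bounds: "0 \<le> \<beta> s" "\<beta> s \<le> 1"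
  using cutoff by (simp_all add: cutoff_def)

lemma minus: "\<beta> (- s) = 1 - \<beta> s"
  using cutoff by (simp add: cutoff_def algebra_simps)

lemma eq_1: "s \<le> -1 \<Longrightarrow> \<beta> s = 1"
  using cutoff by (simp add: cutoff_def)

lemma eq_0: "s \<ge> 1 \<Longrightarrow> \<beta> s = 0"
  using minus[of "- s"] eq_1[of "- s"] by simp

lemma smooth_beta: "smooth f \<Longrightarrow> smooth (\<lambda>p. \<beta> (f p))"
  by (rule smooth_compose[OF cutoff_smooth])

text \<open>An approximation of the indicator of \<open>x > 0\<close> from below that already vanishes for
  \<open>x \<le> 0\<close>, so that products of such functions have supports in prescribed
  closed intervals.\<close>

definition step :: "nat \<Rightarrow> real \<Rightarrow> real" where
  "step n x = 1 - \<beta> (real n * x - 1)"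

lemma smooth_step: "smooth f \<Longrightarrow> smooth (\<lambda>p. step n (f p))"
  unfolding step_def by (intro smooth_diffs smooth_const smooth_beta smooth_cmult)

lemma step_bounds: "0 \<le> step n x" "step n x \<le> 1"
  using bounds by (simp_all add: step_def)

lemma step_0: "x \<le> 0 \<Longrightarrow> step n x = 0"
  unfolding step_def by (subst eq_1) (auto simp: mult_nonneg_nonpos)

lemma step_limit: "(\<lambda>n. step n x) \<longlonglongrightarrow> (if x > 0 then 1 else 0)"
proof (cases "x > 0")
  case True
  have "\<forall>\<^sub>F n in sequentially. step n x = 1"
  proof (rule eventually_sequentiallyI)
    fix n assume "nat \<lceil>2 / x\<rceil> \<le> n"
    then have "2 / x \<le> real n" by linarith
    then have "2 \<le> real n * x" using True by (simp add: pos_divide_le_eq)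
    then show "step n x = 1" by (simp add: step_def eq_0)
  qed
  with True show ?thesis by (simp add: tendsto_eventually)
qed (simp add: step_0)

text \<open>Over one period, an arc of the circle is a superlevel set of a smooth periodic function. The two
  inequalities for \<open>cos\<close> come from its monotonicity on \<open>[0, \<pi>]\<close>,
  with \<open>cos x = cos (2\<pi> - x)\<close> beyond \<open>\<pi>\<close>.\<close>

lemma cos_arc:
  assumes "0 \<le> p" "p < q" "q \<le> 1" "0 \<le> t" "t \<le> 1"
  shows "cos (2 * pi * (t - (p + q) / 2)) - cos (pi * (q - p)) > 0 \<longleftrightarrow> p < t \<and> t < q"
proof -
  define x where "x = 2 * pi * \<bar>t - (p + q) / 2\<bar>"
  define r where "r = pi * (q - p)"
  have "q - p \<le> 1" using assms by linarith
  then have r: "0 \<le> r" "r \<le> pi" using assms by (auto simp: r_def mult_left_le)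
  have c: "cos (2 * pi * (t - (p + q) / 2)) = cos x"
    using cos_minus[of "2 * pi * (t - (p + q) / 2)"] by (simp add: x_def abs_if algebra_simps)
  have x0: "0 \<le> x" by (simp add: x_def)
  have rr: "r = 2 * pi * ((q - p) / 2)" by (simp add: r_def)
  show ?thesis
  proof (cases "p < t \<and> t < q")
    case True
    then have "\<bar>t - (p + q) / 2\<bar> < (q - p) / 2" by (auto simp: abs_if field_simps)
    then have "x < r" unfolding x_def rr by (simp add: mult_strict_left_mono)
    then have "cos r < cos x" using cos_monotone_0_pi[of x r] x0 r by simp
    with True c show ?thesis by (simp add: r_def)
  next
    case False
    then have "(q - p) / 2 \<le> \<bar>t - (p + q) / 2\<bar>" by (auto simp: abs_if field_simps)
    then have 1: "r \<le> x" unfolding x_def rr by (simp add: mult_left_mono)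
    have "\<bar>t - (p + q) / 2\<bar> \<le> 1 - (q - p) / 2" using assms by (auto simp: abs_if field_simps)
    then have "x \<le> 2 * pi * (1 - (q - p) / 2)" unfolding x_def by (simp add: mult_left_mono)
    then have 2: "x \<le> 2 * pi - r" by (simp add: rr algebra_simps)
    have "cos x \<le> cos r"
    proof (cases "x \<le> pi")
      case True
      then show ?thesis using cos_monotone_0_pi_le[of r x] 1 r by simp
    next
      case False
      have "cos x = cos (2 * pi - x)" by (simp add: cos_diff)
      also have "\<dots> \<le> cos r" using cos_monotone_0_pi_le[of r "2 * pi - x"] 2 r False by simp
      finally show ?thesis .
    qed
    with False c show ?thesis by (simp add: r_def)
  qed
qed

text \<open>A smooth approximation of the indicator of \<open>(a, b) \<times> (p, q)\<close>. Using
  \<open>cos\<close> in the second variable makes it periodic without summing over translates.\<close>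

definition bump :: "nat \<Rightarrow> real \<Rightarrow> real \<Rightarrow> real \<Rightarrow> real \<Rightarrow> real \<times> real \<Rightarrow> real" where
  "bump n a b p q = (\<lambda>x. step n (fst x - a) * step n (b - fst x)
     * step n (cos (2 * pi * (snd x - (p + q) / 2)) - cos (pi * (q - p))))"

lemma test_bump:
  assumes "{a..b} \<subseteq> interior I"
  shows "test_fun I (bump n a b p q)"
  unfolding test_fun_def
proof (intro conjI exI)
  have "smooth (bump n a b p q)"
    unfolding bump_def
    by (intro smooth_mult smooth_step smooth_diffs smooth_const smooth_fst
        smooth_compose[OF smooth_real_cos] smooth_cmult smooth_snd)
  then show "\<forall>k. C_diff k (bump n a b p q)" by (simp add: smooth_def)
  have "cos (2 * pi * (t + 1 - m)) = cos (2 * pi * (t - m))" for t m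
    using cos_periodic[of "2 * pi * (t - m)"] by (simp add: algebra_simps)
  then show "periodic (bump n a b p q)" by (simp add: periodic_def bump_def)
  show "compact {a..b}" by simp
  show "{a..b} \<subseteq> interior I" by fact
  show "\<forall>s t. s \<notin> {a..b} \<longrightarrow> bump n a b p q (s, t) = 0"
    by (auto simp: bump_def step_0)
qed

lemma bump_le_1: "\<bar>bump n a b p q x\<bar> \<le> 1"
  using step_bounds by (simp add: bump_def abs_mult abs_of_nonneg mult_le_one)

lemma bump_limit:
  assumes "0 \<le> p" "p < q" "q \<le> 1" "0 \<le> snd x" "snd x \<le> 1"
  shows "(\<lambda>n. bump n a b p q x) \<longlonglongrightarrow> indicator ({a<..<b} \<times> {p<..<q}) x"
proof -
  let ?c = "cos (2 * pi * (snd x - (p + q) / 2)) - cos (pi * (q - p))"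
  have "(\<lambda>n. bump n a b p q x) \<longlonglongrightarrow> (if fst x - a > 0 then 1 else 0)
      * (if b - fst x > 0 then 1 else 0) * (if ?c > 0 then 1 else 0)"
    unfolding bump_def by (intro tendsto_mult step_limit)
  then show ?thesis
    unfolding cos_arc[OF assms(1-3) assms(4,5)] by (cases x) (auto simp: indicator_def split: if_splits)
qed

text \<open>The bump functions converge pointwise to the indicator of the rectangle and are bounded by one
  with support in a fixed strip, so dominated convergence applies.\<close>

lemma integral_rectangle_0:
  fixes z :: "('n::finite) cyl_map"
  assumes z: "loc_integrable I z"
    and 0: "\<And>\<phi>. test_fun I \<phi> \<Longrightarrow> (LINT p:I \<times> {0..1}|lborel. \<phi> p *\<^sub>R z p) = 0"
    and ab: "{a..b} \<subseteq> interior I" and pq: "0 \<le> p" "p < q" "q \<le> 1"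
  shows "(LINT x:{a<..<b} \<times> {p<..<q}|lborel. z x) = 0"
proof -
  let ?w = "\<lambda>x. indicator ({a..b} \<times> {0..1::real}) x *\<^sub>R z x"
  let ?F = "\<lambda>n x. indicator ({a..b} \<times> {0..1::real}) x *\<^sub>R (bump n a b p q x *\<^sub>R z x)"
  have w: "integrable lborel ?w"
    using z ab unfolding loc_integrable_def set_integrable_def by auto
  have ab': "{a..b} \<subseteq> I" using ab interior_subset by blast
  have off: "s \<notin> {a..b} \<Longrightarrow> bump n a b p q (s, t) = 0" for n s t
    by (auto simp: bump_def step_0)
  have F0: "(LINT x|lborel. ?F n x) = 0" for n
  proof -
    have "(LINT x:{a..b} \<times> {0..1}|lborel. bump n a b p q x *\<^sub>R z x)
        = (LINT x:I \<times> {0..1}|lborel. bump n a b p q x *\<^sub>R z x)"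
      by (rule cyl_integral_cong_supp(1)) (use ab' off in auto)
    also have "\<dots> = 0" by (rule 0[OF test_bump[OF ab]])
    finally show ?thesis by (simp only: set_lebesgue_integral_def)
  qed
  let ?L = "\<lambda>x. indicator ({a<..<b} \<times> {p<..<q}) x *\<^sub>R ?w x"
  have mw: "?w \<in> borel_measurable borel" using w by (auto dest: borel_measurable_integrable)
  have "(\<lambda>n. LINT x|lborel. ?F n x) \<longlonglongrightarrow> (LINT x|lborel. ?L x)"
  proof (rule integral_dominated_convergence[where w = "\<lambda>x. norm (?w x)"])
    have F: "?F n = (\<lambda>x. bump n a b p q x *\<^sub>R ?w x)" for n by (simp add: fun_eq_iff)
    have "bump n a b p q \<in> borel_measurable borel" for n
      by (rule borel_measurable_continuous_onI[OF smooth_cont[OF test_smooth[OF test_bump[OF ab]]]])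
    from borel_measurable_scaleR[OF this mw]
    show "?F n \<in> borel_measurable lborel" for n
      unfolding F by (simp only: measurable_lborel2)
    have "{a<..<b} \<times> {p<..<q} \<in> sets borel" by (rule sets_Times_real) auto
    then show "?L \<in> borel_measurable lborel"
      using borel_measurable_scaleR[OF borel_measurable_indicator mw]
      by (simp only: measurable_lborel2)
    show "integrable lborel (\<lambda>x. norm (?w x))" using w by (rule integrable_norm)
    show "AE x in lborel. (\<lambda>n. ?F n x) \<longlonglongrightarrow> ?L x"
    proof (rule AE_I2)
      fix x :: "real \<times> real"
      show "(\<lambda>n. ?F n x) \<longlonglongrightarrow> ?L x"
      proof (cases "x \<in> {a..b} \<times> {0..1}")
        case True
        then have "(\<lambda>n. bump n a b p q x) \<longlonglongrightarrow> indicator ({a<..<b} \<times> {p<..<q}) x"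
          by (intro bump_limit[OF pq]) auto
        then have "(\<lambda>n. bump n a b p q x *\<^sub>R z x) \<longlonglongrightarrow> indicator ({a<..<b} \<times> {p<..<q}) x *\<^sub>R z x"
          by (rule tendsto_scaleR) simp
        then show ?thesis using True by simp
      qed simp
    qed
    show "AE x in lborel. norm (?F n x) \<le> norm (?w x)" for n
    proof (rule AE_I2)
      fix x
      have "\<bar>bump n a b p q x\<bar> * norm (z x) \<le> 1 * norm (z x)"
        by (rule mult_right_mono[OF bump_le_1]) simp
      then show "norm (?F n x) \<le> norm (?w x)" by (auto simp: indicator_def)
    qed
  qed
  then have "(LINT x|lborel. ?L x) = 0" using F0 by (simp add: LIMSEQ_const_iff)
  moreover have "?L = (\<lambda>x. indicator ({a<..<b} \<times> {p<..<q}) x *\<^sub>R z x)"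
    using pq by (auto simp: fun_eq_iff indicator_def)
  ultimately show ?thesis unfolding set_lebesgue_integral_def by simp
qed

text \<open>Open boxes form an intersection-stable generator of the Borel sets, so the integral over every
  Borel set vanishes, and hence the function vanishes almost everywhere.\<close>

lemma AE_0_rectangle:
  fixes z :: "('n::finite) cyl_map"
  assumes z: "loc_integrable I z"
    and 0: "\<And>\<phi>. test_fun I \<phi> \<Longrightarrow> (LINT p:I \<times> {0..1}|lborel. \<phi> p *\<^sub>R z p) = 0"
    and ab: "{a..b} \<subseteq> interior I"
  shows "AE x in lborel. x \<in> {a<..<b} \<times> {0<..<1} \<longrightarrow> z x = 0"
proof -
  let ?Q = "{a<..<b} \<times> {0<..<1::real}"
  let ?z = "\<lambda>x. indicator ?Q x *\<^sub>R z x"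
  have Q: "?Q \<in> sets lborel" using sets_Times_real by simp
  have "set_integrable lborel ({a..b} \<times> {0..1}) z"
    using z ab unfolding loc_integrable_def by auto
  then have "set_integrable lborel ?Q z"
    by (rule set_integrable_subset) (use Q in auto)
  then have iz: "integrable lborel ?z" by (simp add: set_integrable_def)
  \<comment> \<open>The trace of a box on the rectangle is again a rectangle, possibly an empty one.\<close>
  have box: "(LINT x:box c d|lborel. ?z x) = 0" for c d :: "real \<times> real"
  proof -
    let ?R = "{max a (fst c)<..<min b (fst d)} \<times> {max 0 (snd c)<..<min 1 (snd d)}"
    have "x \<in> box c d \<and> x \<in> ?Q \<longleftrightarrow> x \<in> ?R" for x
      by (cases x; cases c; cases d) (auto simp: box_def Basis_prod_def)
    then have "(LINT x:box c d|lborel. ?z x) = (LINT x:?R|lborel. z x)"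
      unfolding set_lebesgue_integral_def
      by (intro Bochner_Integration.integral_cong) (auto simp: indicator_def)
    also have "\<dots> = 0"
    proof (cases "max 0 (snd c) < min 1 (snd d)")
      case True
      show ?thesis
        by (rule integral_rectangle_0[OF z 0]) (use ab True in auto)
    next
      case False
      then have R: "?R = {}" by auto
      show ?thesis unfolding R by (simp add: set_lebesgue_integral_def)
    qed
    finally show ?thesis .
  qed
  have all: "(LINT x:A|lborel. ?z x) = 0" if "A \<in> sets lborel" for A
  proof -
    have sz: "set_integrable lborel A ?z" if "A \<in> sets borel" for A
      using integrable_mult_indicator[OF _ iz, of A] that by (simp add: set_integrable_def)
    let ?G = "range (\<lambda>(a, b). box a b :: (real \<times> real) set)"
    have mem: "A \<in> sigma_sets UNIV ?G"
      using that unfolding sets_lborel borel_eq_box by simp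
    have stable: "Int_stable ?G"
      by (auto simp: Int_stable_def Int_interval)
        (metis (no_types, lifting) box_Int_box rangeI case_prod_conv)
    have sub: "?G \<subseteq> Pow UNIV" by simp
    from stable sub mem show ?thesis
    proof (induction A rule: sigma_sets_induct_disjoint)
      case (basic A)
      then show ?case using box by auto
    next
      case empty
      then show ?case by (simp add: set_lebesgue_integral_def)
    next
      case (compl A)
      have A: "A \<in> sets borel" using compl(1) unfolding borel_eq_box by simp
      have "(LINT x:UNIV|lborel. ?z x) = (LINT x:box (a, 0) (b, 1)|lborel. ?z x)"
        unfolding set_lebesgue_integral_def
        by (intro Bochner_Integration.integral_cong)
          (auto simp: indicator_def box_def Basis_prod_def)
      then have U: "(LINT x:UNIV|lborel. ?z x) = 0" using box by simp
      have "(LINT x:A \<union> (UNIV - A)|lborel. ?z x)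
          = (LINT x:A|lborel. ?z x) + (LINT x:UNIV - A|lborel. ?z x)"
        by (rule set_integral_Un) (use A sz in auto)
      then show ?case using U compl by simp
    next
      case (union A)
      have A: "A i \<in> sets borel" for i using union(2) unfolding borel_eq_box by auto
      have "(LINT x:(\<Union>i. A i)|lborel. ?z x) = (\<Sum>i. (LINT x:A i|lborel. ?z x))"
      proof (rule lebesgue_integral_countable_add)
        show "\<And>i. A i \<in> sets lborel" using A by simp
        show "\<And>i j. i \<noteq> j \<Longrightarrow> A i \<inter> A j = {}"
          using union(1) by (auto simp: disjoint_family_on_def)
        show "set_integrable lborel (\<Union>i. A i) ?z" by (rule sz) (use A in auto)
      qed
      then show ?case using union by simp
    qed
  qed
  have "AE x in lborel. ?z x = 0" by (rule sigma_finite_measure.density_zero[OF sigma_finite_lborel iz all])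
  then show ?thesis by eventually_elim auto
qed

text \<open>Countably many rectangles with rational base exhaust the interior of the cylinder; the lines
  through the ends of the base and the lines \<open>t = 0\<close> and \<open>t = 1\<close> are
  null sets.\<close>

lemma fundamental_lemma:
  fixes z :: "('n::finite) cyl_map"
  assumes z: "loc_integrable I z" and I: "strip_base I"
    and 0: "\<And>\<phi>. test_fun I \<phi> \<Longrightarrow> (LINT p:I \<times> {0..1}|lborel. \<phi> p *\<^sub>R z p) = 0"
  shows "AE x in lborel. x \<in> I \<times> {0..1} \<longrightarrow> z x = 0"
proof -
  have "AE x in lborel. \<forall>a\<in>\<rat>. \<forall>b\<in>\<rat>. {a..b} \<subseteq> interior I \<longrightarrow>
      x \<in> {a<..<b} \<times> {0<..<1} \<longrightarrow> z x = 0"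
    using AE_0_rectangle[OF z 0] by (auto simp: AE_ball_countable countable_rat)
  moreover have "AE x in lborel. \<forall>c\<in>I - interior I. fst (x :: real \<times> real) \<noteq> c"
    using I AE_lines(2) by (subst AE_ball_countable) (auto simp: strip_base_def countable_finite)
  ultimately show ?thesis
    using AE_lines(1)[of 0] AE_lines(1)[of 1]
  proof eventually_elim
    case (elim x)
    show ?case
    proof
      assume x: "x \<in> I \<times> {0..1}"
      then have i: "fst x \<in> interior I" using elim(2) by auto
      then obtain e where e: "e > 0" "cball (fst x) e \<subseteq> interior I"
        using open_contains_cball[of "interior I"] by auto
      obtain a where a: "a \<in> \<rat>" "fst x - e < a" "a < fst x"
        using Rats_dense_in_real[of "fst x - e" "fst x"] e by auto
      obtain b where b: "b \<in> \<rat>" "fst x < b" "b < fst x + e"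
        using Rats_dense_in_real[of "fst x" "fst x + e"] e by auto
      have "{a..b} \<subseteq> cball (fst x) e" using a b by (auto simp: dist_real_def)
      then have "{a..b} \<subseteq> interior I" using e by blast
      moreover have "x \<in> {a<..<b} \<times> {0<..<1}"
        using x a b elim(3,4) by (cases x) auto
      ultimately show "z x = 0" using elim(1) a(1) b(1) by blast
    qed
  qed
qed

end

section \<open>Weak derivatives\<close>

lemma set_borel_measurable_add:
  fixes f g :: "real \<times> real \<Rightarrow> real ^ ('n::finite)"
  assumes "set_borel_measurable borel A f" "set_borel_measurable borel A g"
  shows "set_borel_measurable borel A (\<lambda>p. f p + g p)"
  using borel_measurable_add[OF assms[unfolded set_borel_measurable_def]]
  by (simp add: set_borel_measurable_def scaleR_add_right)

lemma set_borel_measurable_mult: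
  fixes f :: "real \<times> real \<Rightarrow> real ^ ('n::finite)"
  assumes "set_borel_measurable borel A f" "g \<in> borel_measurable borel" "B \<in> sets borel"
    and "\<And>p. p \<in> B \<Longrightarrow> p \<notin> A \<Longrightarrow> g p = 0"
  shows "set_borel_measurable borel B (\<lambda>p. g p *\<^sub>R f p)"
proof -
  have "(\<lambda>p. indicator B p *\<^sub>R (g p *\<^sub>R f p))
      = (\<lambda>p. (indicator B p * g p) *\<^sub>R (indicator A p *\<^sub>R f p))"
    using assms(4) by (auto simp: fun_eq_iff indicator_def)
  moreover have "(\<lambda>p. indicator B p * g p) \<in> borel_measurable borel"
    using assms(2,3) by simp
  ultimately show ?thesis
    using borel_measurable_scaleR[OF _ assms(1)[unfolded set_borel_measurable_def]]
    by (simp only: set_borel_measurable_def)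
qed

lemma loc_integrable_add:
  "loc_integrable I u \<Longrightarrow> loc_integrable I w \<Longrightarrow> loc_integrable I (\<lambda>p. u p + w p)"
  by (simp add: loc_integrable_def set_integral_add)

lemma loc_integrable_mult:
  fixes u :: "('n::finite) cyl_map"
  assumes u: "loc_integrable I u" and G: "continuous_on UNIV G" "closed S"
    and off: "\<And>s t. s \<notin> S \<Longrightarrow> G (s, t) = 0" and J: "interior J \<inter> S \<subseteq> interior I"
  shows "loc_integrable J (\<lambda>p. G p *\<^sub>R u p)"
  unfolding loc_integrable_def
proof (intro allI impI)
  fix K assume K: "compact K \<and> K \<subseteq> interior J"
  let ?K = "K \<inter> S"
  have cK: "compact ?K" using K G(2) by (auto intro: compact_Int_closed)
  have "set_integrable lborel (?K \<times> {0..1}) u"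
    using u cK K J unfolding loc_integrable_def by blast
  moreover have "bounded (G ` (?K \<times> {0..1}))"
    by (intro compact_imp_bounded compact_continuous_image
        continuous_on_subset[OF G(1)] compact_Times cK) auto
  then obtain B where "\<And>p. p \<in> ?K \<times> {0..1} \<Longrightarrow> \<bar>G p\<bar> \<le> B"
    unfolding bounded_iff by auto
  ultimately have "set_integrable lborel (?K \<times> {0..1}) (\<lambda>p. G p *\<^sub>R u p)"
    by (rule set_integrable_bounded_mult[OF _ borel_measurable_continuous_onI[OF G(1)]])
  then show "set_integrable lborel (K \<times> {0..1}) (\<lambda>p. G p *\<^sub>R u p)"
    using cyl_integral_cong_supp(2)[of K ?K "\<lambda>p. G p *\<^sub>R u p"] off by auto
qed

lemma loc_integrable_scaleR:
  "loc_integrable I u \<Longrightarrow> loc_integrable I (\<lambda>p. c *\<^sub>R u p)"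
  by (simp add: loc_integrable_def)

lemma weak_deriv_add:
  assumes u: "weak_deriv I i j u v" and w: "weak_deriv I i j w z"
  shows "weak_deriv I i j (\<lambda>p. u p + w p) (\<lambda>p. v p + z p)"
proof -
  let ?D = "\<lambda>\<phi>. (partial_s ^^ i) ((partial_t ^^ j) \<phi>)"
  have int: "set_integrable lborel (I \<times> {0..1}) (\<lambda>p. ?D \<phi> p *\<^sub>R u p)"
    "set_integrable lborel (I \<times> {0..1}) (\<lambda>p. ?D \<phi> p *\<^sub>R w p)"
    "set_integrable lborel (I \<times> {0..1}) (\<lambda>p. \<phi> p *\<^sub>R v p)"
    "set_integrable lborel (I \<times> {0..1}) (\<lambda>p. \<phi> p *\<^sub>R z p)" if "test_fun I \<phi>" for \<phi>
    using u w that by (auto simp: weak_deriv_def intro!: test_integrable test_partials)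
  show ?thesis
    unfolding weak_deriv_def
  proof (intro conjI allI impI)
    show "periodic (\<lambda>p. v p + z p)" using u w by (simp add: weak_deriv_def periodic_def)
    show "set_borel_measurable borel (I \<times> UNIV) (\<lambda>p. v p + z p)"
      using u w by (simp add: weak_deriv_def set_borel_measurable_add)
    show "loc_integrable I (\<lambda>p. u p + w p)" "loc_integrable I (\<lambda>p. v p + z p)"
      using u w by (simp_all add: weak_deriv_def loc_integrable_add)
    fix \<phi> assume t: "test_fun I \<phi>"
    then have "(LINT p:I \<times> {0..1}|lborel. ?D \<phi> p *\<^sub>R u p)
        = (-1) ^ (i + j) *\<^sub>R (LINT p:I \<times> {0..1}|lborel. \<phi> p *\<^sub>R v p)"
      "(LINT p:I \<times> {0..1}|lborel. ?D \<phi> p *\<^sub>R w p)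
        = (-1) ^ (i + j) *\<^sub>R (LINT p:I \<times> {0..1}|lborel. \<phi> p *\<^sub>R z p)"
      using u w by (simp_all add: weak_deriv_def)
    then show "(LINT p:I \<times> {0..1}|lborel. ?D \<phi> p *\<^sub>R (u p + w p))
        = (-1) ^ (i + j) *\<^sub>R (LINT p:I \<times> {0..1}|lborel. \<phi> p *\<^sub>R (v p + z p))"
      unfolding scaleR_add_right
      by (simp only: set_integral_add(2)[OF int(1,2)[OF t]] set_integral_add(2)[OF int(3,4)[OF t]]
          scaleR_add_right)
  qed
qed

lemma weak_deriv_scaleR:
  assumes u: "weak_deriv I i j u v"
  shows "weak_deriv I i j (\<lambda>p. c *\<^sub>R u p) (\<lambda>p. c *\<^sub>R v p)"
  unfolding weak_deriv_def
proof (intro conjI allI impI)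
  show "periodic (\<lambda>p. c *\<^sub>R v p)" using u by (simp add: weak_deriv_def periodic_def)
  have "(\<lambda>p. indicator (I \<times> UNIV) p *\<^sub>R v p) \<in> borel_measurable borel"
    using u by (simp add: weak_deriv_def set_borel_measurable_def)
  from borel_measurable_scaleR[OF borel_measurable_const[of c] this]
  show "set_borel_measurable borel (I \<times> UNIV) (\<lambda>p. c *\<^sub>R v p)"
    unfolding set_borel_measurable_def scaleR_left_commute[of "indicator _ _" c] .
  show "loc_integrable I (\<lambda>p. c *\<^sub>R u p)" "loc_integrable I (\<lambda>p. c *\<^sub>R v p)"
    using u by (simp_all add: weak_deriv_def loc_integrable_scaleR)
  fix \<phi> assume "test_fun I \<phi>"
  then have *: "(LINT p:I \<times> {0..1}|lborel. (partial_s ^^ i) ((partial_t ^^ j) \<phi>) p *\<^sub>R u p)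
      = (-1) ^ (i + j) *\<^sub>R (LINT p:I \<times> {0..1}|lborel. \<phi> p *\<^sub>R v p)"
    using u by (simp add: weak_deriv_def)
  have comm: "x *\<^sub>R (c *\<^sub>R y) = c *\<^sub>R (x *\<^sub>R y)" for x and y :: "real ^ 'a"
    by (rule scaleR_left_commute)
  show "(LINT p:I \<times> {0..1}|lborel. (partial_s ^^ i) ((partial_t ^^ j) \<phi>) p *\<^sub>R (c *\<^sub>R u p))
      = (-1) ^ (i + j) *\<^sub>R (LINT p:I \<times> {0..1}|lborel. \<phi> p *\<^sub>R (c *\<^sub>R v p))"
    by (simp only: comm set_integral_scaleR_right *)
qed

text \<open>The multiplier is moved onto the test function by \<open>leibniz_adjoint\<close>. The hypotheses
  on \<open>S\<close> allow the base to change at the same time: with \<open>J \<subseteq>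
  I\<close> this contains restriction, and with \<open>I \<subseteq> J\<close> extension by zero
  across the ends of \<open>I\<close> that \<open>S\<close> avoids.\<close>

lemma weak_deriv_mult:
  fixes u :: "('n::finite) cyl_map"
  assumes v: "\<And>l. l \<le> i \<Longrightarrow> weak_deriv I l j u (v l)"
    and G: "smooth G" "t_invariant G" "closed S" and off: "\<And>s t. s \<notin> S \<Longrightarrow> G (s, t) = 0"
    and J: "interior J \<inter> S \<subseteq> interior I" "J \<inter> S \<subseteq> I" "closed J"
  shows "weak_deriv J i j (\<lambda>p. G p *\<^sub>R u p)
    (\<lambda>p. \<Sum>l\<le>i. (real (i choose l) * (partial_s ^^ l) G p) *\<^sub>R v (i - l) p)"
proof -
  let ?G = "\<lambda>l. (partial_s ^^ l) G"
  let ?V = "\<lambda>p. \<Sum>l\<le>i. (real (i choose l) * ?G l p) *\<^sub>R v (i - l) p"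
  have sG: "smooth (?G l)" for l using G(1) by (rule smooth_partials)
  have tG: "t_invariant (?G l)" for l using G(2) by (rule t_invariant_partial_s)
  have offG: "?G l (s, t) = 0" if "s \<notin> S" for l s t
    using partials_s_off[OF G(3), of G s l t] off that by blast
  have per: "?G l (s, t + 1) = ?G l (s, t)" for l s t
  proof -
    have "?G l (s, t + 1) = ?G l (s, 0)" "?G l (s, t) = ?G l (s, 0)"
      using tG[of l] unfolding t_invariant_def by blast+
    then show ?thesis by simp
  qed
  have li: "loc_integrable J (\<lambda>p. (real (i choose l) * ?G l p) *\<^sub>R v (i - l) p)" if "l \<le> i" for l
    by (rule loc_integrable_mult[OF _ _ G(3) _ J(1)])
      (use v[of "i - l"] offG smooth_cont[OF smooth_cmult[OF sG]] in \<open>auto simp: weak_deriv_def\<close>)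
  show ?thesis
    unfolding weak_deriv_def
  proof (intro conjI allI impI)
    show "periodic ?V"
      using v unfolding periodic_def weak_deriv_def by (simp add: per)
    have "set_borel_measurable borel (J \<times> UNIV) (\<lambda>p. (real (i choose l) * ?G l p) *\<^sub>R v (i - l) p)"
      if "l \<le> i" for l
    proof (rule set_borel_measurable_mult)
      show "set_borel_measurable borel (I \<times> UNIV) (v (i - l))"
        using v[of "i - l"] by (simp add: weak_deriv_def)
      show "(\<lambda>p. real (i choose l) * ?G l p) \<in> borel_measurable borel"
        by (rule borel_measurable_continuous_onI[OF smooth_cont[OF smooth_cmult[OF sG]]])
      show "J \<times> (UNIV :: real set) \<in> sets borel"
        by (rule sets_Times_real) (use J(3) in auto)
      show "real (i choose l) * ?G l p = 0" if "p \<in> J \<times> UNIV" "p \<notin> I \<times> UNIV" for p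
        using offG[of "fst p" l "snd p"] that J(2) by (cases p) auto
    qed
    then show "set_borel_measurable borel (J \<times> UNIV) ?V"
      unfolding set_borel_measurable_def scaleR_sum_right by (intro borel_measurable_sum) auto
    show "loc_integrable J (\<lambda>p. G p *\<^sub>R u p)"
      by (rule loc_integrable_mult[OF _ smooth_cont[OF G(1)] G(3) off J(1)])
        (use v[of 0] in \<open>simp add: weak_deriv_def\<close>)
    show "loc_integrable J ?V"
      using li unfolding loc_integrable_def set_integrable_def scaleR_sum_right
      by (intro allI impI Bochner_Integration.integrable_sum) auto
    fix \<phi> assume t: "test_fun J \<phi>"
    obtain K where K: "K \<subseteq> interior J" "\<And>s t. s \<notin> K \<Longrightarrow> \<phi> (s, t) = 0" "closed K"
      using t compact_imp_closed unfolding test_fun_def by blast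
    have KJ: "K \<subseteq> J" using K(1) interior_subset by blast
    let ?\<psi> = "(partial_t ^^ j) \<phi>"
    let ?T = "\<lambda>l q. ?G l q * \<phi> q"
    have t\<psi>: "test_fun J ?\<psi>" using t by (rule test_partials)
    have tT: "test_fun I (?T l)" for l
      by (rule test_mult[OF t sG tG G(3) offG J(1)])
    have off\<psi>: "(partial_s ^^ i) ?\<psi> (s, t) = 0" if "s \<notin> K" for s t
    proof (rule partials_s_off[OF K(3) _ that])
      show "?\<psi> (s, t) = 0" if "s \<notin> K" for s t
      proof (induction j arbitrary: t)
        case (Suc j)
        then show ?case using partial_t_off[of "(partial_t ^^ j) \<phi>" s t] by simp
      qed (use K(2) that in simp)
    qed
    have wd: "(LINT p:I \<times> {0..1}|lborel. (partial_s ^^ (i - l)) ((partial_t ^^ j) (?T l)) p *\<^sub>R u p)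
       = (-1) ^ (i - l + j) *\<^sub>R (LINT p:I \<times> {0..1}|lborel. ?T l p *\<^sub>R v (i - l) p)" for l
    proof -
      have "weak_deriv I (i - l) j u (v (i - l))" by (rule v) simp
      then show ?thesis using tT[of l] unfolding weak_deriv_def by blast
    qed
    have iu: "set_integrable lborel (I \<times> {0..1})
        (\<lambda>p. (partial_s ^^ (i - l)) ((partial_t ^^ j) (?T l)) p *\<^sub>R u p)" for l
      by (intro test_integrable test_partials tT) (use v[of 0] in \<open>simp add: weak_deriv_def\<close>)
    have iv: "set_integrable lborel (I \<times> {0..1}) (\<lambda>p. ?T l p *\<^sub>R v (i - l) p)" for l
      by (intro test_integrable tT) (use v[of "i - l"] in \<open>simp add: weak_deriv_def\<close>)
    let ?c = "\<lambda>l. (-1) ^ l * real (i choose l)"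
    have "(LINT p:J \<times> {0..1}|lborel. (partial_s ^^ i) ?\<psi> p *\<^sub>R (G p *\<^sub>R u p))
        = (LINT p:I \<times> {0..1}|lborel. (partial_s ^^ i) ?\<psi> p *\<^sub>R (G p *\<^sub>R u p))"
    proof (rule cyl_integral_cong_supp(1))
      fix s t
      show "(partial_s ^^ i) ?\<psi> (s, t) *\<^sub>R (G (s, t) *\<^sub>R u (s, t)) = 0" if "s \<in> J" "s \<notin> I"
      proof -
        have "s \<notin> S" using J(2) that by blast
        then show ?thesis by (simp add: off)
      qed
      show "(partial_s ^^ i) ?\<psi> (s, t) *\<^sub>R (G (s, t) *\<^sub>R u (s, t)) = 0" if "s \<notin> J"
      proof -
        have "s \<notin> K" using KJ that by blast
        then show ?thesis by (simp add: off\<psi>)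
      qed
    qed
    also have "\<dots> = (LINT p:I \<times> {0..1}|lborel.
        (\<Sum>l\<le>i. ?c l *\<^sub>R ((partial_s ^^ (i - l)) ((partial_t ^^ j) (?T l)) p *\<^sub>R u p)))"
      using leibniz_adjoint[OF G(1) test_smooth[OF t\<psi>], of _ i]
        partials_t_mult[OF sG tG test_smooth[OF t], of j]
      by (simp add: mult.commute scaleR_sum_left[symmetric])
    also have "\<dots> = (\<Sum>l\<le>i. LINT p:I \<times> {0..1}|lborel.
        ?c l *\<^sub>R ((partial_s ^^ (i - l)) ((partial_t ^^ j) (?T l)) p *\<^sub>R u p))"
      using iu unfolding set_lebesgue_integral_def set_integrable_def scaleR_sum_right
      by (subst Bochner_Integration.integral_sum)
        (auto simp: scaleR_left_commute[of "indicator _ _"] simp del: scaleR_scaleR)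
    also have "\<dots> = (\<Sum>l\<le>i. ?c l *\<^sub>R ((-1) ^ (i - l + j) *\<^sub>R
        (LINT p:I \<times> {0..1}|lborel. ?T l p *\<^sub>R v (i - l) p)))"
      by (simp only: set_integral_scaleR_right wd)
    also have "\<dots> = (\<Sum>l\<le>i. (-1) ^ (i + j) *\<^sub>R (real (i choose l) *\<^sub>R
        (LINT p:I \<times> {0..1}|lborel. ?T l p *\<^sub>R v (i - l) p)))"
    proof (rule sum.cong[OF refl])
      fix l assume "l \<in> {..i}"
      then have "l + (i - l + j) = i + j" by simp
      \<comment> \<open>The signs of the Leibniz rule and of the lower order weak derivative add up to that of
        order \<open>i + j\<close>.\<close>
      then have "(-1) ^ l * (-1) ^ (i - l + j) = (-1 :: real) ^ (i + j)"
        by (metis power_add)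
      then have "?c l * (-1) ^ (i - l + j) = (-1) ^ (i + j) * real (i choose l)"
        by (simp add: mult_ac)
      then show "?c l *\<^sub>R ((-1) ^ (i - l + j) *\<^sub>R (LINT p:I \<times> {0..1}|lborel. ?T l p *\<^sub>R v (i - l) p))
        = (-1) ^ (i + j) *\<^sub>R (real (i choose l) *\<^sub>R
            (LINT p:I \<times> {0..1}|lborel. ?T l p *\<^sub>R v (i - l) p))"
        by (simp only: scaleR_scaleR)
    qed
    also have "\<dots> = (-1) ^ (i + j) *\<^sub>R (\<Sum>l\<le>i. LINT p:I \<times> {0..1}|lborel.
        real (i choose l) *\<^sub>R (?T l p *\<^sub>R v (i - l) p))"
      by (simp only: set_integral_scaleR_right scaleR_sum_right)
    also have "(\<Sum>l\<le>i. LINT p:I \<times> {0..1}|lborel. real (i choose l) *\<^sub>R (?T l p *\<^sub>R v (i - l) p))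
        = (LINT p:I \<times> {0..1}|lborel. (\<Sum>l\<le>i. real (i choose l) *\<^sub>R (?T l p *\<^sub>R v (i - l) p)))"
      using iv unfolding set_lebesgue_integral_def set_integrable_def scaleR_sum_right
      by (subst Bochner_Integration.integral_sum)
        (auto simp: scaleR_left_commute[of "indicator _ _"] simp del: scaleR_scaleR)
    also have "\<dots> = (LINT p:I \<times> {0..1}|lborel. \<phi> p *\<^sub>R ?V p)"
      by (simp add: scaleR_sum_right mult_ac)
    also have "\<dots> = (LINT p:J \<times> {0..1}|lborel. \<phi> p *\<^sub>R ?V p)"
    proof (rule cyl_integral_cong_supp(1))
      show "\<phi> (s, t) *\<^sub>R ?V (s, t) = 0" if "s \<notin> J" for s t using K(2) KJ that by auto
      show "\<phi> (s, t) *\<^sub>R ?V (s, t) = 0" if "s \<in> J" "s \<notin> I" for s t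
      proof -
        have "s \<notin> S" using J(2) that by blast
        then show ?thesis by (simp add: offG)
      qed
    qed
    finally show "(LINT p:J \<times> {0..1}|lborel. (partial_s ^^ i) ?\<psi> p *\<^sub>R (G p *\<^sub>R u p))
      = (-1) ^ (i + j) *\<^sub>R (LINT p:J \<times> {0..1}|lborel. \<phi> p *\<^sub>R ?V p)" .
  qed
qed

lemma loc_integrable_shift:
  fixes u :: "('n::finite) cyl_map"
  assumes u: "loc_integrable I u" "periodic u"
  shows "loc_integrable ((+) (-a) ` I) (\<lambda>(s, t). u (s + a, t + b))"
  unfolding loc_integrable_def
proof (intro allI impI)
  fix K assume K: "compact K \<and> K \<subseteq> interior ((+) (-a) ` I)"
  have c: "compact ((+) a ` K)" using K by (blast intro: compact_translation)
  have "(+) a ` K \<subseteq> interior I" using K unfolding interior_translation by auto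
  with c u have "set_integrable lborel (((+) a ` K) \<times> {0..1}) u" by (auto simp: loc_integrable_def)
  from periodic_integral_shift(1)[OF this u(2), of a b]
  show "set_integrable lborel (K \<times> {0..1}) (\<lambda>(s, t). u (s + a, t + b))"
    using borel_closed[OF compact_imp_closed[OF c]] by (simp add: image_image)
qed

text \<open>Translating test functions back turns the defining identity into the one for \<open>u\<close>,
  by the invariance of cylinder integrals under translations and twists.\<close>

lemma weak_deriv_shift:
  fixes u :: "('n::finite) cyl_map"
  assumes v: "weak_deriv I i j u v" and u: "periodic u" and I: "closed I"
  shows "weak_deriv ((+) (-a) ` I) i j (\<lambda>(s, t). u (s + a, t + b)) (\<lambda>(s, t). v (s + a, t + b))"
proof -
  have I': "I \<in> sets borel" using I by simp
  have pv: "periodic v" using v by (simp add: weak_deriv_def)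
  show ?thesis
    unfolding weak_deriv_def
  proof (intro conjI allI impI)
    show "periodic (\<lambda>(s, t). v (s + a, t + b))"
    proof -
      have "v (s + a, (t + b) + 1) = v (s + a, t + b)" for s t
        using pv unfolding periodic_def by blast
      then show ?thesis by (simp add: periodic_def add_ac)
    qed
    have m: "(\<lambda>p. indicator (I \<times> UNIV) p *\<^sub>R v p) \<in> borel_measurable borel"
      using v by (simp add: weak_deriv_def set_borel_measurable_def)
    have "(\<lambda>p. (\<lambda>p. indicator (I \<times> UNIV) p *\<^sub>R v p) ((a, b) + p)) \<in> borel_measurable borel"
      by (rule measurable_compose[OF _ m]) simp
    moreover have "(\<lambda>p. (\<lambda>p. indicator (I \<times> UNIV) p *\<^sub>R v p) ((a, b) + p))
        = (\<lambda>p. indicator ((+) (-a) ` I \<times> UNIV) p *\<^sub>R (\<lambda>(s, t). v (s + a, t + b)) p)"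
    proof
      fix p :: "real \<times> real"
      obtain s t where p: "p = (s, t)" by (cases p)
      have "s \<in> (+) (-a) ` I \<longleftrightarrow> a + s \<in> I" by (simp only: mem_translate) (simp add: add.commute)
      then show "(\<lambda>p. indicator (I \<times> UNIV) p *\<^sub>R v p) ((a, b) + p)
        = indicator ((+) (-a) ` I \<times> UNIV) p *\<^sub>R (\<lambda>(s, t). v (s + a, t + b)) p"
        unfolding p by (simp only: indicator_def mem_Times_iff prod.case plus_prod_def
            fst_conv snd_conv add.commute UNIV_I simp_thms)
    qed
    ultimately show "set_borel_measurable borel ((+) (-a) ` I \<times> UNIV) (\<lambda>(s, t). v (s + a, t + b))"
      by (simp only: set_borel_measurable_def)
    show "loc_integrable ((+) (-a) ` I) (\<lambda>(s, t). u (s + a, t + b))"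
      "loc_integrable ((+) (-a) ` I) (\<lambda>(s, t). v (s + a, t + b))"
      by (rule loc_integrable_shift; use v u in \<open>simp add: weak_deriv_def\<close>)+
    fix \<phi> assume t: "test_fun ((+) (-a) ` I) \<phi>"
    let ?\<phi> = "\<lambda>(s, t). \<phi> (s + (- a), t + (- b))"
    let ?D = "\<lambda>\<phi>. (partial_s ^^ i) ((partial_t ^^ j) \<phi>)"
    have t': "test_fun I ?\<phi>" by (rule test_shift[OF t])
    have D: "?D ?\<phi> = (\<lambda>(s, t). ?D \<phi> (s + (- a), t + (- b)))"
      by (simp only: partials_shift)
    have eq: "(LINT p:(+) (-a) ` I \<times> {0..1}|lborel. \<xi> p *\<^sub>R (\<lambda>(s, t). w (s + a, t + b)) p)
      = (LINT p:I \<times> {0..1}|lborel. (\<lambda>(s, t). \<xi> (s + (- a), t + (- b))) p *\<^sub>R w p)"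
      if \<xi>: "test_fun ((+) (-a) ` I) \<xi>" and w: "loc_integrable I w" "periodic w"
      for \<xi> and w :: "'n cyl_map"
    proof -
      let ?f = "\<lambda>p. (\<lambda>(s, t). \<xi> (s + (- a), t + (- b))) p *\<^sub>R w p"
      have t\<xi>: "test_fun I (\<lambda>(s, t). \<xi> (s + (- a), t + (- b)))" by (rule test_shift[OF \<xi>])
      have "periodic ?f"
        using t\<xi> w(2) unfolding test_fun_def periodic_def by simp
      from periodic_integral_shift(2)[OF test_integrable[OF t\<xi> w(1)] this I', of a b]
      show ?thesis by (simp add: case_prod_unfold)
    qed
    have lu: "loc_integrable I u" "loc_integrable I v" using v by (auto simp: weak_deriv_def)
    show "(LINT p:(+) (-a) ` I \<times> {0..1}|lborel. ?D \<phi> p *\<^sub>R (\<lambda>(s, t). u (s + a, t + b)) p)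
      = (-1) ^ (i + j) *\<^sub>R
        (LINT p:(+) (-a) ` I \<times> {0..1}|lborel. \<phi> p *\<^sub>R (\<lambda>(s, t). v (s + a, t + b)) p)"
      unfolding eq[OF t lu(2) pv] eq[OF test_partials(1)[OF test_partials(2)[OF t]] lu(1) u]
        D[symmetric]
      using v t' unfolding weak_deriv_def by blast
  qed
qed

lemma test_fun_integrable:
  assumes "test_fun I \<phi>"
  shows "set_integrable lborel (I \<times> {0..1}) \<phi>"
proof -
  obtain K where K: "compact K" "K \<subseteq> interior I" "\<And>s t. s \<notin> K \<Longrightarrow> \<phi> (s, t) = 0"
    using assms(1) unfolding test_fun_def by blast
  have "integrable lborel (\<lambda>p. indicator (K \<times> {0..1}) p *\<^sub>R \<phi> p)"
    by (rule borel_integrable_compact)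
      (use K(1) continuous_on_subset[OF smooth_cont[OF test_smooth[OF assms]]] in
        \<open>auto intro: compact_Times\<close>)
  moreover have "K \<subseteq> I" using K(2) interior_subset by blast
  ultimately show ?thesis
    using cyl_integral_cong_supp(2)[of I K \<phi>] K(3) unfolding set_integrable_def by auto
qed

lemma weak_deriv_const:
  fixes c :: "real ^ ('n::finite)"
  assumes I: "closed I"
  shows "weak_deriv I i j (\<lambda>p. c) (\<lambda>p. if i = 0 \<and> j = 0 then c else 0)"
proof -
  have li: "loc_integrable I (\<lambda>p. d)" for d :: "real ^ 'n"
    unfolding loc_integrable_def
  proof (intro allI impI)
    fix K assume "compact K \<and> K \<subseteq> interior I"
    then have "compact (K \<times> {0..1::real})" by (simp add: compact_Times)
    then show "set_integrable lborel (K \<times> {0..1::real}) (\<lambda>p. d)"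
      unfolding set_integrable_def using borel_integrable_compact[of "K \<times> {0..1}" "\<lambda>_. d"] by simp
  qed
  show ?thesis
    unfolding weak_deriv_def
  proof (intro conjI allI impI)
    have "I \<times> (UNIV :: real set) \<in> sets borel" using I by (intro sets_Times_real) auto
    from borel_measurable_scaleR[OF borel_measurable_indicator[OF this]
        borel_measurable_const[of "if i = 0 \<and> j = 0 then c else 0"]]
    show "set_borel_measurable borel (I \<times> (UNIV :: real set)) (\<lambda>p. if i = 0 \<and> j = 0 then c else 0)"
      unfolding set_borel_measurable_def .
    fix \<phi> assume t: "test_fun I \<phi>"
    have "(LINT p:I \<times> {0..1}|lborel. (partial_s ^^ i) ((partial_t ^^ j) \<phi>) p) = 0"
      if "\<not> (i = 0 \<and> j = 0)"
    proof (cases i)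
      case (Suc i')
      then show ?thesis
        using cyl_integral_partial_0(1)[OF test_partials(1)[OF test_partials(2)[OF t]], of i' j] by simp
    next
      case 0
      with that obtain j' where "j = Suc j'" by (cases j) auto
      then show ?thesis
        using cyl_integral_partial_0(2)[OF test_partials(2)[OF t], of j'] 0 by simp
    qed
    moreover have "(LINT p:I \<times> {0..1}|lborel. (partial_s ^^ i) ((partial_t ^^ j) \<phi>) p *\<^sub>R c)
        = (LINT p:I \<times> {0..1}|lborel. (partial_s ^^ i) ((partial_t ^^ j) \<phi>) p) *\<^sub>R c"
      using integral_scaleR_left[OF test_fun_integrable[OF test_partials(1)[OF test_partials(2)[OF t]],
            unfolded set_integrable_def], of i j c]
      unfolding set_lebesgue_integral_def by simp
    ultimately show "(LINT p:I \<times> {0..1}|lborel. (partial_s ^^ i) ((partial_t ^^ j) \<phi>) p *\<^sub>R c)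
      = (-1) ^ (i + j) *\<^sub>R
        (LINT p:I \<times> {0..1}|lborel. \<phi> p *\<^sub>R (if i = 0 \<and> j = 0 then c else 0))"
      by auto
  qed (auto simp: periodic_def li)
qed

section \<open>Weighted Sobolev norms\<close>

text \<open>The integrand of the weighted norm, set to zero outside the strip so that maps over different
  bases can be compared pointwise on the whole plane.\<close>

definition wabs :: "real set \<Rightarrow> real \<Rightarrow> ('n::finite) cyl_map \<Rightarrow> real \<times> real \<Rightarrow> real" where
  "wabs I d v p = indicator (I \<times> {0..1}) p * (exp (d * \<bar>fst p\<bar>) * norm (v p))"

definition finite_energy :: "real set \<Rightarrow> real \<Rightarrow> ('n::finite) cyl_map \<Rightarrow> bool" where
  "finite_energy I d v \<longleftrightarrow> integrable lborel (\<lambda>p. (wabs I d v p)\<^sup>2)"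

definition energy :: "real set \<Rightarrow> real \<Rightarrow> ('n::finite) cyl_map \<Rightarrow> real" where
  "energy I d v = (LINT p|lborel. (wabs I d v p)\<^sup>2)"

lemma set_energy:
  "set_integrable lborel (I \<times> {0..1}) (\<lambda>p. (exp (d * \<bar>fst p\<bar>) * norm (v p))\<^sup>2) \<longleftrightarrow> finite_energy I d v"
  "(LINT p:I \<times> {0..1}|lborel. (exp (d * \<bar>fst p\<bar>) * norm (v p))\<^sup>2) = energy I d v"
proof -
  have "(\<lambda>p. indicator (I \<times> {0..1::real}) p *\<^sub>R (exp (d * \<bar>fst p\<bar>) * norm (v p))\<^sup>2)
      = (\<lambda>p. (wabs I d v p)\<^sup>2)"
    by (auto simp: wabs_def fun_eq_iff indicator_def)
  then show "set_integrable lborel (I \<times> {0..1}) (\<lambda>p. (exp (d * \<bar>fst p\<bar>) * norm (v p))\<^sup>2)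
      \<longleftrightarrow> finite_energy I d v"
    "(LINT p:I \<times> {0..1}|lborel. (exp (d * \<bar>fst p\<bar>) * norm (v p))\<^sup>2) = energy I d v"
    by (simp_all add: set_integrable_def set_lebesgue_integral_def finite_energy_def energy_def)
qed

lemma wabs_nonneg: "0 \<le> wabs I d v p"
  by (simp add: wabs_def)

lemma energy_nonneg: "0 \<le> energy I d v"
  by (simp add: energy_def)

lemma wabs_measurable:
  fixes v :: "('n::finite) cyl_map"
  assumes "set_borel_measurable borel (I \<times> UNIV) v"
  shows "wabs I d v \<in> borel_measurable borel"
proof -
  have "wabs I d v = (\<lambda>p. indicator (UNIV \<times> {0..1}) p *
      (exp (d * \<bar>fst p\<bar>) * norm (indicator (I \<times> UNIV) p *\<^sub>R v p)))"
    by (auto simp: wabs_def fun_eq_iff indicator_def)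
  moreover have "(\<lambda>p. exp (d * \<bar>fst p\<bar>)) \<in> borel_measurable (borel :: (real \<times> real) measure)"
    by (intro borel_measurable_continuous_onI continuous_intros)
  moreover have "(UNIV :: real set) \<times> {0..1::real} \<in> sets borel" by (rule sets_Times_real) auto
  then have "indicat_real ((UNIV :: real set) \<times> {0..1::real}) \<in> borel_measurable borel" by simp
  ultimately show ?thesis
    using borel_measurable_times[OF _ borel_measurable_times[OF _ measurable_compose[OF
            assms[unfolded set_borel_measurable_def] borel_measurable_norm]]]
    by (simp only:)
qed

text \<open>The common source of all norm estimates: a pointwise bound by a finite sum of weighted
  derivatives, combined with the Cauchy-Schwarz inequality for that sum.\<close>

lemma energy_dominated:
  fixes V :: "('n::finite) cyl_map" and v :: "'l \<Rightarrow> 'n cyl_map"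
  assumes V: "set_borel_measurable borel (J \<times> UNIV) V" and L: "finite L"
    and fin: "\<And>l. l \<in> L \<Longrightarrow> finite_energy I d (v l)"
    and dom: "\<And>p. wabs J e V p \<le> A * (\<Sum>l\<in>L. wabs I d (v l) p)"
  shows "finite_energy J e V"
    and "energy J e V \<le> A\<^sup>2 * (real (card L) * (\<Sum>l\<in>L. energy I d (v l)))"
proof -
  let ?F = "\<lambda>p. A\<^sup>2 * (real (card L) * (\<Sum>l\<in>L. (wabs I d (v l) p)\<^sup>2))"
  have F: "integrable lborel ?F"
    using fin by (intro integrable_mult_right Bochner_Integration.integrable_sum)
      (auto simp: finite_energy_def)
  have le: "(wabs J e V p)\<^sup>2 \<le> ?F p" for p
  proof -
    have "(wabs J e V p)\<^sup>2 \<le> (A * (\<Sum>l\<in>L. wabs I d (v l) p))\<^sup>2"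
      by (rule power_mono[OF dom wabs_nonneg])
    also have "\<dots> = A\<^sup>2 * (\<Sum>l\<in>L. wabs I d (v l) p)\<^sup>2" by (rule power_mult_distrib)
    also have "\<dots> \<le> A\<^sup>2 * ((\<Sum>l\<in>L. (wabs I d (v l) p)\<^sup>2) * real (card L))"
      by (intro mult_left_mono sum_squared_le_sum_of_squares) simp
    finally show ?thesis by (simp add: mult_ac)
  qed
  have m: "(\<lambda>p. (wabs J e V p)\<^sup>2) \<in> borel_measurable lborel"
    using wabs_measurable[OF V, of e] by simp
  have int: "integrable lborel (\<lambda>p. (wabs J e V p)\<^sup>2)"
  proof (rule Bochner_Integration.integrable_bound[OF F m AE_I2])
    fix p
    show "norm ((wabs J e V p)\<^sup>2) \<le> norm (?F p)"
      using le[of p] by simp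
  qed
  then show "finite_energy J e V" by (simp add: finite_energy_def)
  have "energy J e V \<le> (LINT p|lborel. ?F p)"
    unfolding energy_def by (rule integral_mono[OF int F le])
  also have "\<dots> = A\<^sup>2 * (real (card L) * (\<Sum>l\<in>L. energy I d (v l)))"
    using fin unfolding finite_energy_def energy_def
    by (simp add: Bochner_Integration.integral_sum)
  finally show "energy J e V \<le> A\<^sup>2 * (real (card L) * (\<Sum>l\<in>L. energy I d (v l)))" .
qed

lemma finite_order_pairs: "finite {(i, j). i + j \<le> (k::nat)}"
  by (rule finite_subset[of _ "{..k} \<times> {..k}"]) auto

text \<open>The price of bounding the derivatives one by one: there are \<open>card {(i, j). i + j \<le>
  k}\<close> of them.\<close>

definition norm_const :: "nat \<Rightarrow> real" where
  "norm_const k = sqrt (real (card {(i::nat, j). i + j \<le> k}))"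

context smooth_cutoff
begin

lemma weak_deriv_unique:
  fixes u :: "('n::finite) cyl_map"
  assumes I: "strip_base I" and v: "weak_deriv I i j u v" and z: "weak_deriv I i j u z"
  shows "AE x in lborel. x \<in> I \<times> {0..1} \<longrightarrow> v x = z x"
proof -
  have w: "weak_deriv I i j (\<lambda>p. u p + (-1) *\<^sub>R u p) (\<lambda>p. v p + (-1) *\<^sub>R z p)"
    by (rule weak_deriv_add[OF v weak_deriv_scaleR[OF z]])
  have "(LINT p:I \<times> {0..1}|lborel. \<phi> p *\<^sub>R (v p + (-1) *\<^sub>R z p)) = 0" if "test_fun I \<phi>" for \<phi>
  proof -
    have "(LINT p:I \<times> {0..1}|lborel. (partial_s ^^ i) ((partial_t ^^ j) \<phi>) p *\<^sub>R (u p + (-1) *\<^sub>R u p))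
      = (-1) ^ (i + j) *\<^sub>R (LINT p:I \<times> {0..1}|lborel. \<phi> p *\<^sub>R (v p + (-1) *\<^sub>R z p))"
      using w that unfolding weak_deriv_def by blast
    then show ?thesis by simp
  qed
  then have "AE x in lborel. x \<in> I \<times> {0..1} \<longrightarrow> v x + (-1) *\<^sub>R z x = 0"
    using w by (intro fundamental_lemma[OF _ I]) (auto simp: weak_deriv_def)
  then show ?thesis by eventually_elim auto
qed

lemma weak_deriv_wd: "weak_deriv I i j u v \<Longrightarrow> weak_deriv I i j u (wd I i j u)"
  unfolding wd_def by (rule someI[of "weak_deriv I i j u"])

text \<open>Weak derivatives agree almost everywhere, so the choice made in the definition of the Sobolev
  norm is immaterial.\<close>

lemma energy_wd:
  assumes I: "strip_base I" and v: "weak_deriv I i j u v"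
  shows "finite_energy I d (wd I i j u) \<longleftrightarrow> finite_energy I d v"
    and "energy I d (wd I i j u) = energy I d v"
proof -
  have w: "weak_deriv I i j u (wd I i j u)" using v by (rule weak_deriv_wd)
  have m: "(\<lambda>p. (wabs I d z p)\<^sup>2) \<in> borel_measurable lborel" if "weak_deriv I i j u z" for z
    using wabs_measurable[of I z d] that by (simp add: weak_deriv_def)
  have ae: "AE p in lborel. (wabs I d (wd I i j u) p)\<^sup>2 = (wabs I d v p)\<^sup>2"
    using weak_deriv_unique[OF I w v] by eventually_elim (auto simp: wabs_def indicator_def)
  show "finite_energy I d (wd I i j u) \<longleftrightarrow> finite_energy I d v"
    unfolding finite_energy_def by (rule integrable_cong_AE[OF m[OF w] m[OF v] ae])
  show "energy I d (wd I i j u) = energy I d v"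
    unfolding energy_def by (rule integral_cong_AE[OF m[OF w] m[OF v] ae])
qed

lemma sobolev_wd:
  assumes "strip_base I" "sobolev I k d u" "i + j \<le> k"
  shows "weak_deriv I i j u (wd I i j u)" "finite_energy I d (wd I i j u)"
proof -
  obtain v where v: "weak_deriv I i j u v" "finite_energy I d v"
    using assms(2,3) unfolding sobolev_def set_energy by blast
  show "weak_deriv I i j u (wd I i j u)" using v(1) by (rule weak_deriv_wd)
  show "finite_energy I d (wd I i j u)" using energy_wd(1)[OF assms(1) v(1)] v(2) by simp
qed

lemma sobolev_norm_nonneg: "0 \<le> sobolev_norm I k d u"
  unfolding sobolev_norm_def set_energy by (auto intro!: real_sqrt_ge_zero sum_nonneg energy_nonneg)

lemma energy_le_norm:
  assumes "i + j \<le> k"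
  shows "energy I d (wd I i j u) \<le> (sobolev_norm I k d u)\<^sup>2"
proof -
  let ?e = "\<lambda>(i, j). energy I d (wd I i j u)"
  have "?e (i, j) \<le> (\<Sum>x\<in>{(i, j). i + j \<le> k}. ?e x)"
    by (rule member_le_sum) (use assms finite_order_pairs energy_nonneg in auto)
  also have "\<dots> = (sobolev_norm I k d u)\<^sup>2"
    unfolding sobolev_norm_def set_energy
    by (subst real_sqrt_pow2) (auto intro!: sum_nonneg energy_nonneg)
  finally show ?thesis by simp
qed

lemma sobolevI:
  assumes J: "strip_base J" and w: "periodic w" "continuous_on (J \<times> UNIV) w"
    and V: "\<And>i j. i + j \<le> k \<Longrightarrow> \<exists>V. weak_deriv J i j w V \<and> finite_energy J d V \<and> energy J d V \<le> B\<^sup>2"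
    and B: "B \<ge> 0"
  shows "sobolev J k d w" "sobolev_norm J k d w \<le> norm_const k * B"
proof -
  show "sobolev J k d w"
    unfolding sobolev_def set_energy using w V by blast
  have "energy J d (wd J i j w) \<le> B\<^sup>2" if "i + j \<le> k" for i j
    using V[OF that] energy_wd(2)[OF J] by metis
  then have "(\<Sum>(i, j)\<in>{(i, j). i + j \<le> k}. energy J d (wd J i j w))
      \<le> (\<Sum>(i, j)\<in>{(i::nat, j). i + j \<le> k}. B\<^sup>2)"
    by (intro sum_mono) auto
  then have "sobolev_norm J k d w \<le> sqrt (\<Sum>(i, j)\<in>{(i::nat, j). i + j \<le> k}. B\<^sup>2)"
    unfolding sobolev_norm_def set_energy by (rule real_sqrt_le_mono)
  also have "\<dots> = norm_const k * B"
    using B by (simp add: norm_const_def real_sqrt_mult case_prod_unfold)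
  finally show "sobolev_norm J k d w \<le> norm_const k * B" .
qed

lemma norm_const_nonneg: "0 \<le> norm_const k"
  by (simp add: norm_const_def)

lemma sobolev_add:
  fixes u w :: "('n::finite) cyl_map"
  assumes I: "strip_base I" and u: "sobolev I k d u" and w: "sobolev I k d w"
  shows "sobolev I k d (\<lambda>p. u p + w p)"
    and "sobolev_norm I k d (\<lambda>p. u p + w p)
      \<le> norm_const k * (2 * (sobolev_norm I k d u + sobolev_norm I k d w))"
proof -
  let ?N = "sobolev_norm I k d u" and ?M = "sobolev_norm I k d w"
  have "\<exists>V. weak_deriv I i j (\<lambda>p. u p + w p) V \<and> finite_energy I d V
      \<and> energy I d V \<le> (2 * (?N + ?M))\<^sup>2" if ij: "i + j \<le> k" for i j
  proof (intro exI conjI)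
    let ?v = "\<lambda>b. if b then wd I i j u else wd I i j w"
    note U = sobolev_wd[OF I u ij] and W = sobolev_wd[OF I w ij]
    let ?V = "\<lambda>p. wd I i j u p + wd I i j w p"
    show wdV: "weak_deriv I i j (\<lambda>p. u p + w p) ?V" by (rule weak_deriv_add[OF U(1) W(1)])
    have m: "set_borel_measurable borel (I \<times> UNIV) ?V" using wdV by (simp add: weak_deriv_def)
    have dom: "wabs I d ?V p \<le> 1 * (\<Sum>b\<in>UNIV. wabs I d (?v b) p)" for p
      using norm_triangle_ineq[of "wd I i j u p" "wd I i j w p"]
      by (auto simp: wabs_def UNIV_bool indicator_def distrib_left[symmetric])
    have fin: "finite_energy I d (?v b)" for b using U(2) W(2) by simp
    show "finite_energy I d ?V"
      by (rule energy_dominated(1)[OF m finite_class.finite_UNIV fin dom])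
    have "energy I d ?V \<le> 2 * (energy I d (wd I i j u) + energy I d (wd I i j w))"
      using energy_dominated(2)[OF m finite_class.finite_UNIV fin dom] by (simp add: UNIV_bool)
    also have "\<dots> \<le> 2 * (?N\<^sup>2 + ?M\<^sup>2)"
      using energy_le_norm[OF ij, of I d u] energy_le_norm[OF ij, of I d w] by simp
    also have "\<dots> \<le> (2 * (?N + ?M))\<^sup>2"
      using sobolev_norm_nonneg[of I k d u] sobolev_norm_nonneg[of I k d w]
      by (simp add: power2_eq_square algebra_simps)
    finally show "energy I d ?V \<le> (2 * (?N + ?M))\<^sup>2" .
  qed
  note * = sobolevI[OF I _ _ this]
  have p: "periodic (\<lambda>p. u p + w p)" using u w by (simp add: sobolev_def periodic_def)
  have c: "continuous_on (I \<times> UNIV) (\<lambda>p. u p + w p)"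
    using u w by (auto simp: sobolev_def intro: continuous_on_add)
  show "sobolev I k d (\<lambda>p. u p + w p)"
    and "sobolev_norm I k d (\<lambda>p. u p + w p)
      \<le> norm_const k * (2 * (sobolev_norm I k d u + sobolev_norm I k d w))"
    using *[OF p c] sobolev_norm_nonneg[of I k d u] sobolev_norm_nonneg[of I k d w] by auto
qed

lemma sobolev_scaleR:
  fixes u :: "('n::finite) cyl_map"
  assumes I: "strip_base I" and u: "sobolev I k d u"
  shows "sobolev I k d (\<lambda>p. c *\<^sub>R u p)"
    and "sobolev_norm I k d (\<lambda>p. c *\<^sub>R u p) \<le> norm_const k * (\<bar>c\<bar> * sobolev_norm I k d u)"
proof -
  let ?N = "sobolev_norm I k d u"
  have "\<exists>V. weak_deriv I i j (\<lambda>p. c *\<^sub>R u p) V \<and> finite_energy I d V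
      \<and> energy I d V \<le> (\<bar>c\<bar> * ?N)\<^sup>2" if ij: "i + j \<le> k" for i j
  proof (intro exI conjI)
    note U = sobolev_wd[OF I u ij]
    let ?V = "\<lambda>p. c *\<^sub>R wd I i j u p"
    show wdV: "weak_deriv I i j (\<lambda>p. c *\<^sub>R u p) ?V" by (rule weak_deriv_scaleR[OF U(1)])
    have m: "set_borel_measurable borel (I \<times> UNIV) ?V" using wdV by (simp add: weak_deriv_def)
    have dom: "wabs I d ?V p \<le> \<bar>c\<bar> * (\<Sum>b\<in>{()}. wabs I d (wd I i j u) p)" for p
      by (simp add: wabs_def)
    show "finite_energy I d ?V"
      by (rule energy_dominated(1)[OF m _ _ dom]) (use U(2) in auto)
    have "energy I d ?V \<le> \<bar>c\<bar>\<^sup>2 * energy I d (wd I i j u)"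
      using energy_dominated(2)[OF m _ _ dom] U(2) by simp
    also have "\<dots> \<le> (\<bar>c\<bar> * ?N)\<^sup>2"
      using energy_le_norm[OF ij, of I d u] by (simp add: power_mult_distrib mult_left_mono)
    finally show "energy I d ?V \<le> (\<bar>c\<bar> * ?N)\<^sup>2" .
  qed
  note * = sobolevI[OF I _ _ this]
  have p: "periodic (\<lambda>p. c *\<^sub>R u p)" using u by (simp add: sobolev_def periodic_def)
  have c: "continuous_on (I \<times> UNIV) (\<lambda>p. c *\<^sub>R u p)"
    using u by (auto simp: sobolev_def intro: continuous_intros)
  show "sobolev I k d (\<lambda>p. c *\<^sub>R u p)"
    and "sobolev_norm I k d (\<lambda>p. c *\<^sub>R u p) \<le> norm_const k * (\<bar>c\<bar> * sobolev_norm I k d u)"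
    using *[OF p c] sobolev_norm_nonneg[of I k d u] by auto
qed

lemma sobolev_mono:
  assumes I: "strip_base I" and u: "sobolev I k d u" and k: "k' \<le> k" and d: "d' \<le> d"
  shows "sobolev I k' d' u"
proof -
  have "\<exists>v. weak_deriv I i j u v \<and> finite_energy I d' v" if ij: "i + j \<le> k'" for i j
  proof (intro exI conjI)
    have ij': "i + j \<le> k" using ij k by simp
    note U = sobolev_wd[OF I u ij']
    show "weak_deriv I i j u (wd I i j u)" by (rule U(1))
    have "exp (d' * \<bar>fst p\<bar>) * norm (wd I i j u p) \<le> exp (d * \<bar>fst p\<bar>) * norm (wd I i j u p)" for p
      using d by (intro mult_right_mono) (auto intro: mult_right_mono)
    then have dom: "wabs I d' (wd I i j u) p \<le> 1 * (\<Sum>b\<in>{()}. wabs I d (wd I i j u) p)" for p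
      by (auto simp: wabs_def indicator_def)
    show "finite_energy I d' (wd I i j u)"
      by (rule energy_dominated(1)[OF _ _ _ dom]) (use U in \<open>auto simp: weak_deriv_def\<close>)
  qed
  then show ?thesis using u unfolding sobolev_def set_energy by blast
qed

end

text \<open>Recording a closed set \<open>S\<close> that carries \<open>G\<close> makes the change of base
  in the next lemma possible.\<close>

definition multiplier :: "(real \<times> real \<Rightarrow> real) \<Rightarrow> real set \<Rightarrow> bool" where
  "multiplier G S \<longleftrightarrow> smooth G \<and> t_invariant G \<and> closed S \<and> (\<forall>s t. s \<notin> S \<longrightarrow> G (s, t) = 0)
     \<and> (\<forall>l. \<exists>B. \<forall>p. \<bar>(partial_s ^^ l) G p\<bar> \<le> B)"

context smooth_cutoff
begin

text \<open>By the Leibniz rule every derivative of the product is dominated by derivatives of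
  \<open>u\<close>. The two weights are compared on \<open>J \<inter> S\<close> only: this is
  how maps on a finite cylinder enter the exponentially weighted spaces.\<close>

lemma sobolev_mult:
  assumes G: "multiplier G S" and I: "strip_base I" and J: "strip_base J"
    and IJ: "interior J \<inter> S \<subseteq> interior I" "J \<inter> S \<subseteq> I"
    and wt: "\<And>s. s \<in> J \<inter> S \<Longrightarrow> exp (d' * \<bar>s\<bar>) \<le> W * exp (d * \<bar>s\<bar>)"
  shows "\<exists>C\<ge>0. \<forall>u :: ('n::finite) cyl_map. sobolev I k d u \<longrightarrow>
    sobolev J k d' (\<lambda>p. G p *\<^sub>R u p) \<and>
    sobolev_norm J k d' (\<lambda>p. G p *\<^sub>R u p) \<le> C * sobolev_norm I k d u"
proof -
  let ?G = "\<lambda>l. (partial_s ^^ l) G"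
  have sG: "smooth G" "t_invariant G" "closed S" and off: "\<And>s t. s \<notin> S \<Longrightarrow> G (s, t) = 0"
    using G by (auto simp: multiplier_def)
  have "\<forall>l. \<exists>B. \<forall>p. \<bar>?G l p\<bar> \<le> B" using G by (simp add: multiplier_def)
  then obtain b where b: "\<And>l p. \<bar>?G l p\<bar> \<le> b l" by metis
  have b0: "0 \<le> b l" for l using b[of l "(0, 0)"] by linarith
  \<comment> \<open>A crude common bound for all coefficients in the Leibniz rule up to order
    \<open>k\<close>.\<close>
  define B where "B = (\<Sum>l\<le>k. \<Sum>i\<le>k. real (i choose l) * b l)"
  have B0: "0 \<le> B" using b0 by (simp add: B_def sum_nonneg)
  have B: "\<bar>real (i choose l) * ?G l p\<bar> \<le> B" if "l \<le> k" "i \<le> k" for i l p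
  proof -
    have "\<bar>real (i choose l) * ?G l p\<bar> \<le> real (i choose l) * b l"
      using b[of l p] by (simp add: abs_mult mult_left_mono)
    also have "\<dots> \<le> (\<Sum>i\<le>k. real (i choose l) * b l)"
      by (rule member_le_sum) (use that b0 in auto)
    also have "\<dots> \<le> B"
      unfolding B_def by (rule member_le_sum) (use that b0 in \<open>auto intro!: sum_nonneg\<close>)
    finally show ?thesis .
  qed
  define A where "A = B * max W 0"
  have A0: "0 \<le> A" using B0 by (simp add: A_def)
  define C where "C = A * real (Suc k)"
  have offG: "?G l (s, t) = 0" if "s \<notin> S" for l s t
    using partials_s_off[OF sG(3), of G s l t] off that by blast
  show ?thesis
  proof (intro exI[of _ "norm_const k * C"] conjI allI impI)
    show "0 \<le> norm_const k * C" using A0 norm_const_nonneg by (simp add: C_def)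
    fix u :: "'n cyl_map" assume u: "sobolev I k d u"
    let ?N = "sobolev_norm I k d u"
    have V: "\<exists>V. weak_deriv J i j (\<lambda>p. G p *\<^sub>R u p) V \<and> finite_energy J d' V
      \<and> energy J d' V \<le> (C * ?N)\<^sup>2" if ij: "i + j \<le> k" for i j
    proof (intro exI conjI)
      let ?v = "\<lambda>l. wd I l j u"
      let ?V = "\<lambda>p. \<Sum>l\<le>i. (real (i choose l) * ?G l p) *\<^sub>R ?v (i - l) p"
      have v: "weak_deriv I l j u (?v l)" "finite_energy I d (?v l)"
        "energy I d (?v l) \<le> ?N\<^sup>2" if "l \<le> i" for l
        using sobolev_wd[OF I u, of l j] energy_le_norm[of l j k I d u] ij that by auto
      show wdV: "weak_deriv J i j (\<lambda>p. G p *\<^sub>R u p) ?V"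
        by (rule weak_deriv_mult[OF v(1) sG off IJ]) (use J in \<open>auto simp: strip_base_def\<close>)
      have m: "set_borel_measurable borel (J \<times> UNIV) ?V" using wdV by (simp add: weak_deriv_def)
      have dom: "wabs J d' ?V p \<le> A * (\<Sum>l\<in>{..i}. wabs I d (?v (i - l)) p)" for p
      proof (cases "p \<in> J \<times> {0..1} \<and> fst p \<in> S")
        case True
        then have pI: "p \<in> I \<times> {0..1}" using IJ(2) by (cases p) auto
        have "norm (?V p) \<le> (\<Sum>l\<le>i. B * norm (?v (i - l) p))"
        proof (rule sum_norm_le)
          fix l assume "l \<in> {..i}"
          then have "\<bar>real (i choose l) * ?G l p\<bar> \<le> B" using ij by (intro B) auto
          then show "norm ((real (i choose l) * ?G l p) *\<^sub>R ?v (i - l) p) \<le> B * norm (?v (i - l) p)"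
            by (simp add: mult_right_mono)
        qed
        also have "\<dots> = B * (\<Sum>l\<le>i. norm (?v (i - l) p))" by (simp add: sum_distrib_left)
        finally have 1: "norm (?V p) \<le> B * (\<Sum>l\<le>i. norm (?v (i - l) p))" .
        have "exp (d' * \<bar>fst p\<bar>) \<le> W * exp (d * \<bar>fst p\<bar>)" using True by (intro wt) auto
        also have "\<dots> \<le> max W 0 * exp (d * \<bar>fst p\<bar>)" by (rule mult_right_mono) auto
        finally have "exp (d' * \<bar>fst p\<bar>) * norm (?V p)
            \<le> (max W 0 * exp (d * \<bar>fst p\<bar>)) * (B * (\<Sum>l\<le>i. norm (?v (i - l) p)))"
          using 1 by (rule mult_mono) auto
        also have "\<dots> = A * (\<Sum>l\<le>i. exp (d * \<bar>fst p\<bar>) * norm (?v (i - l) p))"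
          by (simp add: A_def sum_distrib_left mult_ac)
        finally show ?thesis using True pI by (simp add: wabs_def)
      next
        case False
        have "wabs J d' ?V p = 0"
        proof (cases "p \<in> J \<times> {0..1}")
          case True
          with False have "?V p = 0" using offG[of "fst p" _ "snd p"] by simp
          then show ?thesis by (simp add: wabs_def)
        qed (simp add: wabs_def)
        then show ?thesis using A0 by (simp add: sum_nonneg wabs_nonneg)
      qed
      have fin: "finite_energy I d (?v (i - l))" if "l \<in> {..i}" for l using v(2) by simp
      show "finite_energy J d' ?V" by (rule energy_dominated(1)[OF m _ fin dom]) auto
      have "energy J d' ?V \<le> A\<^sup>2 * (real (card {..i}) * (\<Sum>l\<in>{..i}. energy I d (?v (i - l))))"
        by (rule energy_dominated(2)[OF m _ fin dom]) auto
      also have "\<dots> \<le> A\<^sup>2 * (real (card {..i}) * (real (card {..i}) * ?N\<^sup>2))"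
        using v(3) by (intro mult_left_mono sum_bounded_above) auto
      also have "\<dots> = (A * real (Suc i) * ?N)\<^sup>2" by (simp add: power2_eq_square mult_ac)
      also have "\<dots> \<le> (C * ?N)\<^sup>2"
        unfolding C_def using ij A0 sobolev_norm_nonneg[of I k d u]
        by (intro power_mono mult_right_mono mult_left_mono) auto
      finally show "energy J d' ?V \<le> (C * ?N)\<^sup>2" .
    qed
    have per: "periodic (\<lambda>p. G p *\<^sub>R u p)"
    proof -
      have "G (s, t + 1) = G (s, t)" for s t
      proof -
        have "G (s, t + 1) = G (s, 0)" "G (s, t) = G (s, 0)"
          using sG(2) unfolding t_invariant_def by blast+
        then show ?thesis by simp
      qed
      then show ?thesis using u by (simp add: sobolev_def periodic_def)
    qed
    have cont: "continuous_on (J \<times> UNIV) (\<lambda>p. G p *\<^sub>R u p)"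
    proof -
      have cJ: "closed J" using J by (simp add: strip_base_def)
      \<comment> \<open>The product is continuous on two closed sets that cover \<open>J\<close>: on \<open>J
        \<inter> S\<close>, where \<open>u\<close> is continuous, and on the zero set of
        \<open>G\<close>.\<close>
      have "continuous_on ((J \<inter> S) \<times> UNIV) (\<lambda>p. G p *\<^sub>R u p)"
      proof (intro continuous_on_scaleR)
        show "continuous_on ((J \<inter> S) \<times> UNIV) G"
          by (rule continuous_on_subset[OF smooth_cont[OF sG(1)]]) simp
        show "continuous_on ((J \<inter> S) \<times> UNIV) u"
          by (rule continuous_on_subset[of "I \<times> UNIV"]) (use u IJ(2) in \<open>auto simp: sobolev_def\<close>)
      qed
      moreover have "continuous_on (J \<times> UNIV \<inter> {p. G p = 0}) (\<lambda>p. G p *\<^sub>R u p)"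
      proof (rule continuous_on_eq[of _ "\<lambda>p. 0"])
        show "0 = G p *\<^sub>R u p" if "p \<in> J \<times> UNIV \<inter> {p. G p = 0}" for p using that by auto
      qed simp
      moreover have "closed {p. G p = 0}"
        by (rule closed_Collect_eq[OF smooth_cont[OF sG(1)]]) simp
      then have "closed ((J \<inter> S) \<times> (UNIV :: real set))" "closed (J \<times> UNIV \<inter> {p. G p = 0})"
        using cJ sG(3) by (auto intro: closed_Times)
      ultimately have "continuous_on ((J \<inter> S) \<times> UNIV \<union> (J \<times> UNIV \<inter> {p. G p = 0})) (\<lambda>p. G p *\<^sub>R u p)"
        by (intro continuous_on_closed_Un)
      moreover have "(J \<inter> S) \<times> UNIV \<union> (J \<times> UNIV \<inter> {p. G p = 0}) = J \<times> UNIV"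
        using off by auto
      ultimately show ?thesis by simp
    qed
    have CN: "0 \<le> C * ?N" using A0 sobolev_norm_nonneg[of I k d u] by (simp add: C_def)
    show "sobolev J k d' (\<lambda>p. G p *\<^sub>R u p)" by (rule sobolevI(1)[OF J per cont V CN])
    show "sobolev_norm J k d' (\<lambda>p. G p *\<^sub>R u p) \<le> norm_const k * C * sobolev_norm I k d u"
      using sobolevI(2)[OF J per cont V CN] by (simp add: mult.assoc)
  qed
qed

end

section \<open>Translations, constants and averages over circles\<close>

lemma weak_deriv_cong:
  assumes "\<And>s t. s \<in> I \<Longrightarrow> u (s, t) = w (s, t)"
  shows "weak_deriv I i j u v \<longleftrightarrow> weak_deriv I i j w v"
proof -
  have i: "(\<lambda>p. indicator (A \<times> {0..1::real}) p *\<^sub>R u p) = (\<lambda>p. indicator (A \<times> {0..1}) p *\<^sub>R w p)"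
    if "A \<subseteq> I" for A using that assms by (auto simp: indicator_def fun_eq_iff)
  have "indicator (I \<times> {0..1::real}) p *\<^sub>R f p *\<^sub>R u p = indicator (I \<times> {0..1}) p *\<^sub>R f p *\<^sub>R w p"
    for f :: "real \<times> real \<Rightarrow> real" and p
    using assms by (cases p) (auto simp: indicator_def)
  then have l: "(LINT p:I \<times> {0..1}|lborel. f p *\<^sub>R u p) = (LINT p:I \<times> {0..1}|lborel. f p *\<^sub>R w p)"
    for f unfolding set_lebesgue_integral_def by presburger
  have "loc_integrable I u \<longleftrightarrow> loc_integrable I w"
  proof -
    have "set_integrable lborel (K \<times> {0..1}) u \<longleftrightarrow> set_integrable lborel (K \<times> {0..1}) w"
      if "K \<subseteq> interior I" for K
      using i[of K] that interior_subset[of I] by (simp add: set_integrable_def)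
    then show ?thesis unfolding loc_integrable_def by blast
  qed
  then show ?thesis unfolding weak_deriv_def l by simp
qed

text \<open>The values off \<open>I\<close> enter only through periodicity, which is required on the whole
  plane.\<close>

lemma sobolev_cong:
  assumes "\<And>s t. s \<in> I \<Longrightarrow> u (s, t) = w (s, t)"
  shows "sobolev_norm I k d u = sobolev_norm I k d w"
    and "periodic w \<Longrightarrow> sobolev I k d u \<Longrightarrow> sobolev I k d w"
proof -
  have "weak_deriv I i j u = weak_deriv I i j w" for i j
    by (rule ext) (rule weak_deriv_cong, rule assms)
  then show "sobolev_norm I k d u = sobolev_norm I k d w"
    unfolding sobolev_norm_def wd_def by simp
  assume "periodic w" and u: "sobolev I k d u"
  have "continuous_on (I \<times> UNIV) w"
    by (rule continuous_on_eq[of _ u]) (use u assms in \<open>auto simp: sobolev_def\<close>)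
  then show "sobolev I k d w"
    using u \<open>periodic w\<close> \<open>\<And>i j. weak_deriv I i j u = weak_deriv I i j w\<close>
    unfolding sobolev_def by simp
qed

lemma strip_base_simps:
  "strip_base UNIV" "strip_base {a..}" "strip_base {..a}" "a < b \<Longrightarrow> strip_base {a..b}"
proof -
  have "{a..} - {a<..} = {a}" "{..a} - {..<a} = {a}" "a < b \<Longrightarrow> {a..b} - {a<..<b} = {a, b}"
    by auto
  then show "strip_base UNIV" "strip_base {a..}" "strip_base {..a}" "a < b \<Longrightarrow> strip_base {a..b}"
    by (simp_all add: strip_base_def)
qed

lemma strip_base_translate: "strip_base I \<Longrightarrow> strip_base ((+) a ` I)"
proof -
  have "(+) a ` I - (+) a ` interior I = (+) a ` (I - interior I)" by auto
  then show "strip_base I \<Longrightarrow> strip_base ((+) a ` I)"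
    by (simp only: strip_base_def interior_translation) (auto intro: closed_translation)
qed

lemma strip_measure:
  assumes "a \<le> b"
  shows "integrable lborel (indicat_real ({a..b} \<times> {0..1::real}))"
    and "(LINT p|lborel. indicat_real ({a..b} \<times> {0..1::real}) p) = b - a"
proof -
  have *: "indicat_real ({a..b} \<times> {0..1::real})
      = (\<lambda>p. indicat_real {a..b} (fst p) *\<^sub>R indicat_real {0..1} (snd p))"
    by (auto simp: indicator_def fun_eq_iff)
  have i: "integrable lborel (indicat_real {a..b})" for a b :: real
    using borel_integrable_compact[of "{a..b}" "\<lambda>_. 1 :: real"] by simp
  show "integrable lborel (indicat_real ({a..b} \<times> {0..1::real}))"
    unfolding * by (rule product_integral[OF i i])
  show "(LINT p|lborel. indicat_real ({a..b} \<times> {0..1::real}) p) = b - a"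
    unfolding * product_integral(2)[OF i i] using assms by simp
qed

context smooth_cutoff
begin

text \<open>Translation by \<open>a\<close> changes the weight by a factor of at most \<open>exp
  (\<bar>d\<bar> \<bar>a\<bar>)\<close>.\<close>

lemma sobolev_shift:
  assumes I: "strip_base I"
  shows "\<exists>C\<ge>0. \<forall>u :: ('n::finite) cyl_map. sobolev I k d u \<longrightarrow>
    sobolev ((+) (-a) ` I) k d (\<lambda>(s, t). u (s + a, t + b)) \<and>
    sobolev_norm ((+) (-a) ` I) k d (\<lambda>(s, t). u (s + a, t + b)) \<le> C * sobolev_norm I k d u"
proof -
  let ?J = "(+) (-a) ` I"
  have cI: "closed I" using I by (simp add: strip_base_def)
  have bI: "I \<in> sets borel" using cI by simp
  have J: "strip_base ?J" by (rule strip_base_translate[OF I])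
  define A where "A = exp (\<bar>d\<bar> * \<bar>a\<bar>)"
  have A0: "0 \<le> A" by (simp add: A_def)
  show ?thesis
  proof (intro exI[of _ "norm_const k * A"] conjI allI impI)
    show "0 \<le> norm_const k * A" using A0 norm_const_nonneg by simp
    fix u :: "'n cyl_map" assume u: "sobolev I k d u"
    let ?w = "\<lambda>(s, t). u (s + a, t + b)"
    let ?N = "sobolev_norm I k d u"
    have V: "\<exists>V. weak_deriv ?J i j ?w V \<and> finite_energy ?J d V
      \<and> energy ?J d V \<le> (A * ?N)\<^sup>2" if ij: "i + j \<le> k" for i j
    proof (intro exI conjI)
      let ?v = "wd I i j u"
      let ?V = "\<lambda>(s, t). ?v (s + a, t + b)"
      note v = sobolev_wd[OF I u ij]
      have pu: "periodic u" using u by (simp add: sobolev_def)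
      have pv: "periodic ?v" using v(1) by (simp add: weak_deriv_def)
      show wV: "weak_deriv ?J i j ?w ?V" by (rule weak_deriv_shift[OF v(1) pu cI])
      let ?f = "\<lambda>p. (exp (d * \<bar>fst p\<bar>) * norm (?v p))\<^sup>2"
      have f: "set_integrable lborel (I \<times> {0..1}) ?f" using v(2) by (simp only: set_energy)
      have pf: "periodic ?f" using pv by (simp add: periodic_def)
      note sh = periodic_integral_shift[OF f pf bI, of a b]
      have F: "integrable lborel (\<lambda>p. A\<^sup>2 * (indicator (?J \<times> {0..1}) p *\<^sub>R (\<lambda>(s, t). ?f (s + a, t + b)) p))"
        by (rule integrable_mult_right) (use sh(1) in \<open>simp only: set_integrable_def\<close>)
      have le: "(wabs ?J d ?V p)\<^sup>2 \<le> A\<^sup>2 * (indicator (?J \<times> {0..1}) p *\<^sub>R (\<lambda>(s, t). ?f (s + a, t + b)) p)" for p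
      proof (cases "p \<in> ?J \<times> {0..1}")
        case True
        obtain s t where p: "p = (s, t)" by (cases p)
        have "d * \<bar>s\<bar> \<le> \<bar>d\<bar> * \<bar>a\<bar> + d * \<bar>s + a\<bar>"
        proof -
          have "\<bar>d * (\<bar>s\<bar> - \<bar>s + a\<bar>)\<bar> \<le> \<bar>d\<bar> * \<bar>a\<bar>"
            unfolding abs_mult by (rule mult_left_mono) auto
          then show ?thesis by (simp add: algebra_simps abs_le_iff)
        qed
        then have "exp (d * \<bar>s\<bar>) \<le> A * exp (d * \<bar>s + a\<bar>)"
          unfolding A_def exp_add[symmetric] by simp
        then have "exp (d * \<bar>s\<bar>) * norm (?v (s + a, t + b))
            \<le> A * exp (d * \<bar>s + a\<bar>) * norm (?v (s + a, t + b))"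
          by (rule mult_right_mono) simp
        then have "(exp (d * \<bar>s\<bar>) * norm (?v (s + a, t + b)))\<^sup>2
            \<le> (A * exp (d * \<bar>s + a\<bar>) * norm (?v (s + a, t + b)))\<^sup>2"
          by (rule power_mono) simp
        then show ?thesis using True
          by (simp only: p wabs_def indicator_simps prod.case fst_conv mult_1 scaleR_one
              power_mult_distrib mult.assoc)
      qed (simp add: wabs_def)
      have m: "(\<lambda>p. (wabs ?J d ?V p)\<^sup>2) \<in> borel_measurable lborel"
      proof -
        have "set_borel_measurable borel (?J \<times> UNIV) ?V" using wV by (simp only: weak_deriv_def)
        from wabs_measurable[OF this] show ?thesis
          by (simp only: measurable_lborel2) (rule borel_measurable_power)
      qed
      have int: "integrable lborel (\<lambda>p. (wabs ?J d ?V p)\<^sup>2)"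
      proof (rule Bochner_Integration.integrable_bound[OF F m AE_I2])
        fix p
        show "norm ((wabs ?J d ?V p)\<^sup>2)
            \<le> norm (A\<^sup>2 * (indicator (?J \<times> {0..1}) p *\<^sub>R (\<lambda>(s, t). ?f (s + a, t + b)) p))"
          using order_trans[OF le[of p] abs_ge_self] by (simp only: real_norm_def abs_power2)
      qed
      then show "finite_energy ?J d ?V" by (simp only: finite_energy_def)
      have "energy ?J d ?V
          \<le> (LINT p|lborel. A\<^sup>2 * (indicator (?J \<times> {0..1}) p *\<^sub>R (\<lambda>(s, t). ?f (s + a, t + b)) p))"
        unfolding energy_def by (rule integral_mono[OF int F le])
      also have "\<dots> = A\<^sup>2 * (LINT p:?J \<times> {0..1}|lborel. (\<lambda>(s, t). ?f (s + a, t + b)) p)"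
        by (simp only: integral_mult_right_zero set_lebesgue_integral_def)
      also have "\<dots> = A\<^sup>2 * energy I d ?v" by (simp only: sh(2) set_energy)
      also have "\<dots> \<le> A\<^sup>2 * ?N\<^sup>2" by (intro mult_left_mono energy_le_norm ij) simp
      finally show "energy ?J d ?V \<le> (A * ?N)\<^sup>2" by (simp only: power_mult_distrib)
    qed
    have per: "periodic ?w"
    proof -
      have "u (s + a, (t + b) + 1) = u (s + a, t + b)" for s t
        using u unfolding sobolev_def periodic_def by blast
      then show ?thesis by (simp add: periodic_def add_ac)
    qed
    have cont: "continuous_on (?J \<times> UNIV) ?w"
    proof -
      have c: "continuous_on (I \<times> UNIV) u" using u by (simp add: sobolev_def)
      have "s + a \<in> I" if "s \<in> ?J" for s using that by (auto simp del: add_uminus_conv_diff)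
      then have "continuous_on (?J \<times> UNIV) (\<lambda>p. u (fst p + a, snd p + b))"
        by (intro continuous_on_compose2[OF c] continuous_intros) auto
      then show ?thesis by (simp only: case_prod_unfold)
    qed
    have AN: "0 \<le> A * ?N" using A0 sobolev_norm_nonneg[of I k d u] by simp
    show "sobolev ?J k d ?w" by (rule sobolevI(1)[OF J per cont V AN])
    show "sobolev_norm ?J k d ?w \<le> norm_const k * A * ?N"
      using sobolevI(2)[OF J per cont V AN] by (simp only: mult.assoc)
  qed
qed

lemma sobolev_const:
  fixes c :: "real ^ ('n::finite)"
  assumes ab: "a < b"
  shows "sobolev {a..b} k 0 (\<lambda>p. c)"
    and "sobolev_norm {a..b} k 0 (\<lambda>p. c) \<le> norm_const k * (sqrt (b - a) * norm c)"
proof -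
  have J: "strip_base {a..b}" using ab by (rule strip_base_simps)
  have e: "finite_energy {a..b} 0 (\<lambda>p. x) \<and> energy {a..b} 0 (\<lambda>p. x) = (b - a) * (norm x)\<^sup>2"
    for x :: "real ^ 'n"
  proof -
    have "(\<lambda>p. (wabs {a..b} 0 (\<lambda>p. x) p)\<^sup>2)
        = (\<lambda>p. indicat_real ({a..b} \<times> {0..1}) p * (norm x)\<^sup>2)"
      by (auto simp: wabs_def indicator_def fun_eq_iff)
    then show ?thesis
      using strip_measure[of a b] ab by (simp add: finite_energy_def energy_def)
  qed
  have V: "\<exists>V. weak_deriv {a..b} i j (\<lambda>p. c) V \<and> finite_energy {a..b} 0 V
    \<and> energy {a..b} 0 V \<le> (sqrt (b - a) * norm c)\<^sup>2" for i j
  proof (intro exI conjI)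
    show "weak_deriv {a..b} i j (\<lambda>p. c) (\<lambda>p. if i = 0 \<and> j = 0 then c else 0)"
      by (rule weak_deriv_const) simp
    show "finite_energy {a..b} 0 (\<lambda>p. if i = 0 \<and> j = 0 then c else 0)"
      using e[of "if i = 0 \<and> j = 0 then c else 0"] by blast
    show "energy {a..b} 0 (\<lambda>p. if i = 0 \<and> j = 0 then c else 0) \<le> (sqrt (b - a) * norm c)\<^sup>2"
      using e[of "if i = 0 \<and> j = 0 then c else 0"] ab by (simp add: power_mult_distrib)
  qed
  have p: "periodic (\<lambda>p. c)" by (simp add: periodic_def)
  have B: "0 \<le> sqrt (b - a) * norm c" using ab by simp
  show "sobolev {a..b} k 0 (\<lambda>p. c)"
    by (rule sobolevI(1)[OF J p _ V B]) simp
  show "sobolev_norm {a..b} k 0 (\<lambda>p. c) \<le> norm_const k * (sqrt (b - a) * norm c)"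
    by (rule sobolevI(2)[OF J p _ V B]) simp
qed

lemma sobolev_zero:
  fixes I :: "real set"
  assumes I: "strip_base I"
  shows "sobolev I k d (\<lambda>p. 0 :: real ^ ('n::finite))"
    and "sobolev_norm I k d (\<lambda>p. 0 :: real ^ 'n) = 0"
proof -
  have cI: "closed I" using I by (simp add: strip_base_def)
  have w0: "wabs I d (\<lambda>p. 0 :: real ^ 'n) = (\<lambda>p. 0)" by (simp add: wabs_def fun_eq_iff)
  have V: "\<exists>V. weak_deriv I i j (\<lambda>p. 0 :: real ^ 'n) V \<and> finite_energy I d V \<and> energy I d V \<le> 0\<^sup>2" for i j
  proof (intro exI conjI)
    show "weak_deriv I i j (\<lambda>p. 0 :: real ^ 'n) (\<lambda>p. 0)"
      using weak_deriv_const[OF cI, of i j "0 :: real ^ 'n"] by simp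
  qed (simp_all add: finite_energy_def energy_def w0)
  have p: "periodic (\<lambda>p. 0 :: real ^ 'n)" by (simp add: periodic_def)
  show "sobolev I k d (\<lambda>p. 0 :: real ^ 'n)" by (rule sobolevI(1)[OF I p _ V]) simp_all
  have "sobolev_norm I k d (\<lambda>p. 0 :: real ^ 'n) \<le> norm_const k * 0"
    by (rule sobolevI(2)[OF I p _ V]) simp_all
  then show "sobolev_norm I k d (\<lambda>p. 0 :: real ^ 'n) = 0"
    using sobolev_norm_nonneg[of I k d "\<lambda>p. 0 :: real ^ 'n"] by simp
qed

lemma weak_deriv_self:
  assumes I: "strip_base I" and u: "sobolev I k d u"
  shows "weak_deriv I 0 0 u u" "finite_energy I d u" "energy I d u \<le> (sobolev_norm I k d u)\<^sup>2"
proof -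
  note w = sobolev_wd[OF I u, of 0 0]
  have "closed (I \<times> (UNIV :: real set))" using I by (auto simp: strip_base_def intro: closed_Times)
  then have "set_borel_measurable borel (I \<times> UNIV) u"
    using u unfolding set_borel_measurable_def sobolev_def
    by (intro borel_measurable_continuous_on_indicator) auto
  then show self: "weak_deriv I 0 0 u u"
    using w(1) u by (simp add: weak_deriv_def sobolev_def)
  show "finite_energy I d u" "energy I d u \<le> (sobolev_norm I k d u)\<^sup>2"
    using energy_wd[OF I self, of d] w(2) energy_le_norm[of 0 0 k I d u] by auto
qed

text \<open>The energy is at least \<open>n \<bar>c\<bar>\<^sup>2\<close> for every \<open>n\<close>,
  already on the cylinder of length \<open>n\<close>.\<close>

lemma sobolev_eventually_const:
  assumes I: "strip_base I" and u: "sobolev I k d u" and d: "0 \<le> d"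
    and M: "{M..} \<subseteq> I" and c: "\<And>s t. M \<le> s \<Longrightarrow> u (s, t) = c"
  shows "c = 0"
proof (rule ccontr)
  assume "c \<noteq> 0"
  then have c0: "0 < (norm c)\<^sup>2" by simp
  have i: "integrable lborel (\<lambda>p. (wabs I d u p)\<^sup>2)"
    using weak_deriv_self(2)[OF I u] by (simp add: finite_energy_def)
  have "real n * (norm c)\<^sup>2 \<le> energy I d u" for n
  proof -
    let ?Q = "{M..M + real n} \<times> {0..1::real}"
    note q = strip_measure[of M "M + real n"]
    have "(LINT p|lborel. indicat_real ?Q p * (norm c)\<^sup>2) \<le> energy I d u"
      unfolding energy_def
    proof (rule integral_mono)
      show "integrable lborel (\<lambda>p. indicat_real ?Q p * (norm c)\<^sup>2)" using q(1) by simp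
      show "indicat_real ?Q p * (norm c)\<^sup>2 \<le> (wabs I d u p)\<^sup>2" for p
      proof (cases "p \<in> ?Q")
        case True
        then have p: "p \<in> I \<times> {0..1}" "u p = c" using M c by (cases p, auto)+
        have "1 * norm c \<le> exp (d * \<bar>fst p\<bar>) * norm c"
          using d by (intro mult_right_mono) auto
        then have "(norm c)\<^sup>2 \<le> (exp (d * \<bar>fst p\<bar>) * norm c)\<^sup>2" by (intro power_mono) auto
        then show ?thesis using True p by (simp add: wabs_def)
      qed simp
    qed (rule i)
    then show ?thesis using q by simp
  qed
  moreover obtain n where "energy I d u < real n * (norm c)\<^sup>2"
    using ex_less_of_nat_mult[OF c0] by blast
  ultimately show False by (meson not_le)
qed

text \<open>Outside \<open>(-1, 1)\<close> the cutoff takes one of its extreme values 0 and 1, which settles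
  the points \<open>\<plusminus>1\<close> without one-sided derivatives.\<close>

lemma deriv_beta:
  shows "1 \<le> \<bar>x\<bar> \<Longrightarrow> deriv \<beta> x = 0" and "deriv \<beta> x \<le> 0"
proof -
  have D: "DERIV \<beta> x :> deriv \<beta> x" by (rule smooth_real_has_deriv[OF cutoff_smooth])
  show *: "deriv \<beta> x = 0" if "1 \<le> \<bar>x\<bar>"
  proof (cases "x \<ge> 0")
    case True
    then have "\<beta> x = 0" using that by (intro eq_0) simp
    then show ?thesis by (intro DERIV_local_min[OF D, of 1]) (auto simp: bounds)
  next
    case False
    then have "\<beta> x = 1" using that by (intro eq_1) simp
    then show ?thesis by (intro DERIV_local_max[OF D, of 1]) (auto simp: bounds)
  qed
  show "deriv \<beta> x \<le> 0"
  proof (cases "1 \<le> \<bar>x\<bar>")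
    case False
    then have "deriv \<beta> x < 0" using cutoff by (simp add: cutoff_def abs_if split: if_splits)
    then show ?thesis by simp
  qed (simp add: *)
qed

text \<open>Integrate \<open>x \<le> N + x\<^sup>2 / N\<close> over the strip. The parameter
  \<open>N\<close> will be any positive number above the Sobolev norm.\<close>

lemma L1_le_energy:
  assumes v: "set_borel_measurable borel (I \<times> UNIV) v" and fin: "finite_energy I d v"
    and ab: "{a..b} \<subseteq> I" "a \<le> b" and d: "0 \<le> d" and N: "0 < N" "energy I d v \<le> N\<^sup>2"
  shows "set_integrable lborel ({a..b} \<times> {0..1}) v"
    and "(LINT p:{a..b} \<times> {0..1}|lborel. norm (v p)) \<le> (b - a + 1) * N"
proof -
  let ?Q = "{a..b} \<times> {0..1::real}"
  let ?F = "\<lambda>p. N * indicat_real ?Q p + (1 / N) * (wabs I d v p)\<^sup>2"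
  note q = strip_measure[OF ab(2)]
  have F: "integrable lborel ?F"
    using q(1) fin unfolding finite_energy_def
    by (intro Bochner_Integration.integrable_add integrable_mult_right)
  have le: "norm (indicator ?Q p *\<^sub>R v p) \<le> ?F p" for p
  proof (cases "p \<in> ?Q")
    case True
    let ?x = "norm (v p)"
    have pI: "p \<in> I \<times> {0..1}" using True ab(1) by (cases p) auto
    have "1 * ?x \<le> exp (d * \<bar>fst p\<bar>) * ?x" using d by (intro mult_right_mono) auto
    then have "?x\<^sup>2 \<le> (wabs I d v p)\<^sup>2" using pI by (simp add: wabs_def power_mono)
    then have 1: "(1 / N) * ?x\<^sup>2 \<le> (1 / N) * (wabs I d v p)\<^sup>2" using N by (intro mult_left_mono) auto
    have "0 \<le> (N - ?x)\<^sup>2" by simp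
    then have "2 * (N * ?x) \<le> N * N + ?x\<^sup>2" by (simp add: power2_eq_square algebra_simps)
    moreover have "0 \<le> N * ?x" using N(1) by simp
    ultimately have "N * ?x \<le> N * N + ?x\<^sup>2" by linarith
    then have "?x \<le> N + (1 / N) * ?x\<^sup>2"
      using N(1) by (simp add: field_simps)
    with 1 True show ?thesis by simp
  next
    case False
    then show ?thesis using N(1) by simp
  qed
  have Q: "?Q \<in> sets borel" by (rule sets_Times_real) auto
  have "(\<lambda>p. indicator ?Q p *\<^sub>R v p) = (\<lambda>p. indicat_real ?Q p *\<^sub>R (indicator (I \<times> UNIV) p *\<^sub>R v p))"
    using ab(1) by (auto simp: indicator_def fun_eq_iff)
  then have m: "(\<lambda>p. indicator ?Q p *\<^sub>R v p) \<in> borel_measurable lborel"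
    using borel_measurable_scaleR[OF borel_measurable_indicator[OF Q] v[unfolded set_borel_measurable_def]]
    by (simp only: measurable_lborel2)
  show i: "set_integrable lborel ?Q v"
    unfolding set_integrable_def
  proof (rule Bochner_Integration.integrable_bound[OF F m AE_I2])
    show "norm (indicator ?Q p *\<^sub>R v p) \<le> norm (?F p)" for p
      using order_trans[OF le[of p] abs_ge_self] by (simp only: real_norm_def)
  qed
  have eq: "(\<lambda>p. indicat_real ?Q p *\<^sub>R norm (v p)) = (\<lambda>p. norm (indicator ?Q p *\<^sub>R v p))"
    by (simp add: fun_eq_iff)
  have "(LINT p:?Q|lborel. norm (v p)) \<le> (LINT p|lborel. ?F p)"
    unfolding set_lebesgue_integral_def eq
    by (rule integral_mono[OF integrable_norm[OF i[unfolded set_integrable_def]] F le])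
  also have "\<dots> = N * (b - a) + (1 / N) * energy I d v"
    using q fin by (simp add: finite_energy_def energy_def)
  also have "(1 / N) * energy I d v \<le> (1 / N) * N\<^sup>2"
    using N by (intro mult_left_mono) auto
  finally show "(LINT p:?Q|lborel. norm (v p)) \<le> (b - a + 1) * N"
    using N(1) by (simp add: power2_eq_square algebra_simps)
qed

text \<open>The test function \<open>\<phi> = \<beta> (s - s0) - \<beta> ((s - s0) / \<epsilon>)\<close> is
  bounded by one and supported in \<open>[s0 - 1, s0 + 1]\<close>. Its derivative is the sum of
  a fixed function \<open>g\<close> and a mollifier \<open>h\<close> of mass one concentrated on
  \<open>\<bar>s - s0\<bar> \<le> \<epsilon>\<close>. Testing the weak derivative with
  \<open>\<phi>\<close> expresses the mollified average of \<open>u\<close> through integrals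
  over the strip, and for small \<open>\<epsilon>\<close> uniform continuity replaces it by the
  average over the circle \<open>s = s0\<close>, up to \<open>\<kappa>\<close>.\<close>

lemma trace_le_L1:
  fixes u :: "('n::finite) cyl_map"
  assumes I: "strip_base I" and K: "{s0 - 1..s0 + 1} \<subseteq> interior I"
    and u: "continuous_on (I \<times> UNIV) u" and v: "weak_deriv I 1 0 u v"
    and iv: "set_integrable lborel ({s0 - 1..s0 + 1} \<times> {0..1}) v"
    and B: "\<And>x. \<bar>deriv \<beta> x\<bar> \<le> B"
  shows "norm (LINT t:{0..1}|lborel. u (s0, t))
    \<le> B * (LINT p:{s0 - 1..s0 + 1} \<times> {0..1}|lborel. norm (u p))
      + (LINT p:{s0 - 1..s0 + 1} \<times> {0..1}|lborel. norm (v p))" (is "?T \<le> ?R")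
proof (rule field_le_epsilon)
  fix \<kappa> :: real assume \<kappa>: "0 < \<kappa>"
  let ?K = "{s0 - 1..s0 + 1}" and ?Q = "{s0 - 1..s0 + 1} \<times> {0..1::real}"
  have KI: "?K \<subseteq> I" using K interior_subset by blast
  have QI: "?Q \<subseteq> I \<times> UNIV" using KI by blast
  have cQ: "compact ?Q" by (intro compact_Times) auto
  have uQ: "continuous_on ?Q u" by (rule continuous_on_subset[OF u QI])
  obtain r where r: "r > 0" "\<And>p q. p \<in> ?Q \<Longrightarrow> q \<in> ?Q \<Longrightarrow> dist q p < r \<Longrightarrow> dist (u q) (u p) < \<kappa>"
    using compact_uniformly_continuous[OF uQ cQ] \<kappa> unfolding uniformly_continuous_on_def by metis
  define \<epsilon> where "\<epsilon> = min 1 (r / 2)"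
  have \<epsilon>: "0 < \<epsilon>" "\<epsilon> \<le> 1" "\<epsilon> < r" using r by (auto simp: \<epsilon>_def)
  define h where "h s = - (deriv \<beta> ((s - s0) / \<epsilon>) / \<epsilon>)" for s
  define g where "g s = deriv \<beta> (s - s0)" for s
  let ?\<phi> = "\<lambda>p. \<beta> (fst p - s0) - \<beta> ((1 / \<epsilon>) * (fst p - s0))"
  have sm\<phi>: "smooth ?\<phi>"
    by (intro smooth_diffs smooth_beta smooth_cmult smooth_fst smooth_const)
  have off\<phi>: "?\<phi> (s, t) = 0" if "s \<notin> ?K" for s t
  proof (cases "s > s0")
    case True
    with that have "s - s0 \<ge> 1" by simp
    moreover have "(1 / \<epsilon>) * (s - s0) \<ge> 1 * 1"
      using calculation \<epsilon> by (intro mult_mono) auto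
    ultimately show ?thesis by (simp add: eq_0)
  next
    case False
    with that have "s0 - s \<ge> 1" by simp
    moreover have "(1 / \<epsilon>) * (s0 - s) \<ge> 1 * 1"
      using calculation \<epsilon> by (intro mult_mono) auto
    then have "(1 / \<epsilon>) * (s - s0) \<le> -1" by (simp add: algebra_simps diff_divide_distrib)
    ultimately show ?thesis by (simp add: eq_1)
  qed
  have t\<phi>: "test_fun I ?\<phi>"
    unfolding test_fun_def
    using sm\<phi> off\<phi> K by (auto simp: smooth_def periodic_def intro!: exI[of _ ?K])
  have D: "partial_s ?\<phi> = (\<lambda>p. g (fst p) + h (fst p))"
  proof (rule partial_s_eqI)
    fix s t
    show "((\<lambda>x. ?\<phi> (x, t)) has_real_derivative (\<lambda>p. g (fst p) + h (fst p)) (s, t)) (at s)"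
    proof -
      have 1: "((\<lambda>x. \<beta> (x - s0)) has_real_derivative deriv \<beta> (s - s0) * 1) (at s)"
        by (rule DERIV_chain2[OF smooth_real_has_deriv[OF cutoff_smooth]]) (auto intro!: derivative_eq_intros)
      have 2: "((\<lambda>x. \<beta> ((1 / \<epsilon>) * (x - s0))) has_real_derivative
          deriv \<beta> ((1 / \<epsilon>) * (s - s0)) * (1 / \<epsilon>)) (at s)"
        by (rule DERIV_chain2[OF smooth_real_has_deriv[OF cutoff_smooth]])
          (use \<epsilon>(1) in \<open>auto intro!: derivative_eq_intros\<close>)
      show ?thesis using DERIV_diff[OF 1 2] by (simp add: g_def h_def)
    qed
  qed
  have cd: "continuous_on UNIV (deriv \<beta>)"
    by (rule differentiable_imp_continuous_on[OF smooth_real_diff[OF smooth_real_deriv[OF cutoff_smooth]]])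
  have cg: "continuous_on A g" and ch: "continuous_on A h" for A
    unfolding g_def h_def using \<epsilon>(1)
    by (intro continuous_intros continuous_on_compose2[OF cd]; simp)+
  have intQ: "set_integrable lborel ?Q f" if "continuous_on ?Q f" for f :: "real \<times> real \<Rightarrow> 'b::{banach, second_countable_topology}"
    unfolding set_integrable_def by (rule borel_integrable_compact[OF cQ that])
  have cfst: "continuous_on ?Q (\<lambda>p. f (fst p))" if "continuous_on ?K f" for f :: "real \<Rightarrow> real"
    by (rule continuous_on_compose2[OF that]) (auto intro: continuous_intros)
  have u0: "continuous_on ?Q (\<lambda>p. u (s0, snd p))"
    by (rule continuous_on_compose2[OF uQ]) (intro continuous_intros, auto)
  have ig: "set_integrable lborel ?Q (\<lambda>p. g (fst p) *\<^sub>R u p)"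
    and ih: "set_integrable lborel ?Q (\<lambda>p. h (fst p) *\<^sub>R u p)"
    and ih0: "set_integrable lborel ?Q (\<lambda>p. h (fst p) *\<^sub>R u (s0, snd p))"
    and iu: "set_integrable lborel ?Q (\<lambda>p. norm (u p))"
    by (intro intQ continuous_on_scaleR cfst cg ch uQ u0 continuous_on_norm)+
  have weak: "(LINT p:?Q|lborel. g (fst p) *\<^sub>R u p) + (LINT p:?Q|lborel. h (fst p) *\<^sub>R u p)
      = - (LINT p:?Q|lborel. ?\<phi> p *\<^sub>R v p)"
  proof -
    have w: "(LINT p:I \<times> {0..1}|lborel. partial_s ?\<phi> p *\<^sub>R u p) = - (LINT p:I \<times> {0..1}|lborel. ?\<phi> p *\<^sub>R v p)"
    proof -
      have "(LINT p:I \<times> {0..1}|lborel. (partial_s ^^ 1) ((partial_t ^^ 0) ?\<phi>) p *\<^sub>R u p)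
        = (-1) ^ (1 + 0) *\<^sub>R (LINT p:I \<times> {0..1}|lborel. ?\<phi> p *\<^sub>R v p)"
        using v t\<phi> unfolding weak_deriv_def by blast
      then show ?thesis by simp
    qed
    have "(LINT p:I \<times> {0..1}|lborel. ?\<phi> p *\<^sub>R v p) = (LINT p:?Q|lborel. ?\<phi> p *\<^sub>R v p)"
      by (rule cyl_integral_cong_supp(1)) (use off\<phi> KI in auto)
    moreover have "(LINT p:I \<times> {0..1}|lborel. partial_s ?\<phi> p *\<^sub>R u p) = (LINT p:?Q|lborel. partial_s ?\<phi> p *\<^sub>R u p)"
    proof (rule cyl_integral_cong_supp(1))
      show "partial_s ?\<phi> (s, t) *\<^sub>R u (s, t) = 0" if "s \<notin> ?K" for s t
        using partial_s_off[of ?K ?\<phi> 0 s t] off\<phi> that by auto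
    qed (use KI in auto)
    moreover have "(LINT p:?Q|lborel. partial_s ?\<phi> p *\<^sub>R u p)
        = (LINT p:?Q|lborel. g (fst p) *\<^sub>R u p) + (LINT p:?Q|lborel. h (fst p) *\<^sub>R u p)"
      unfolding D scaleR_add_left by (rule set_integral_add(2)[OF ig ih])
    ultimately show ?thesis using w by simp
  qed
  have h0: "0 \<le> h s" for s using deriv_beta(2)[of "(s - s0) / \<epsilon>"] \<epsilon>(1) by (simp add: h_def divide_nonpos_pos)
  have hint: "integrable lborel (\<lambda>s. indicat_real ?K s * h s)" "(LINT s|lborel. indicat_real ?K s * h s) = 1"
  proof -
    show "integrable lborel (\<lambda>s. indicat_real ?K s * h s)"
      using borel_integrable_compact[of ?K h] ch by simp
    have "(LINT s|lborel. h s * indicat_real ?K s)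
        = - \<beta> ((s0 + 1 - s0) / \<epsilon>) - (- \<beta> ((s0 - 1 - s0) / \<epsilon>))"
    proof (rule integral_FTC_Icc_real)
      show "((\<lambda>s. - \<beta> ((s - s0) / \<epsilon>)) has_real_derivative h s) (at s)" for s
      proof -
        have "((\<lambda>x. \<beta> ((x - s0) / \<epsilon>)) has_real_derivative deriv \<beta> ((s - s0) / \<epsilon>) * (1 / \<epsilon>)) (at s)"
          using \<epsilon>(1)
          by (intro DERIV_chain2[OF smooth_real_has_deriv[OF cutoff_smooth]]) (auto intro!: derivative_eq_intros)
        from DERIV_minus[OF this] show ?thesis by (simp add: h_def)
      qed
      show "isCont h s" for s using ch[of UNIV] by (simp add: continuous_on_eq_continuous_at)
    qed simp
    also have "\<dots> = 1"
      using \<epsilon> by (subst eq_0, simp, subst eq_1) (auto simp: divide_simps)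
    finally show "(LINT s|lborel. indicat_real ?K s * h s) = 1" by (simp add: mult.commute)
  qed
  have "continuous_on {0..1} (\<lambda>t. u (s0, t))"
    by (rule continuous_on_compose2[OF uQ]) (auto intro: continuous_intros)
  then have tint: "integrable lborel (\<lambda>t. indicat_real {0..1} t *\<^sub>R u (s0, t))"
    using borel_integrable_compact[of "{0..1::real}" "\<lambda>t. u (s0, t)"] by simp
  have T: "(LINT p:?Q|lborel. h (fst p) *\<^sub>R u (s0, snd p)) = (LINT t:{0..1}|lborel. u (s0, t))"
  proof -
    have "(\<lambda>p. indicat_real ?Q p *\<^sub>R (h (fst p) *\<^sub>R u (s0, snd p)))
      = (\<lambda>p. (indicat_real ?K (fst p) * h (fst p)) *\<^sub>R (indicat_real {0..1} (snd p) *\<^sub>R u (s0, snd p)))"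
      by (auto simp: indicator_def fun_eq_iff)
    then show ?thesis
      using product_integral(2)[OF hint(1) tint] hint(2) by (simp add: set_lebesgue_integral_def)
  qed
  have hQ: "set_integrable lborel ?Q (\<lambda>p. h (fst p))" "(LINT p:?Q|lborel. h (fst p)) = 1"
  proof -
    show "set_integrable lborel ?Q (\<lambda>p. h (fst p))" by (intro intQ cfst ch)
    have i1: "integrable lborel (indicat_real {0..1::real})"
      by (rule integrable_real_indicator) auto
    have "(\<lambda>p. indicat_real ?Q p *\<^sub>R h (fst p))
      = (\<lambda>p. (indicat_real ?K (fst p) * h (fst p)) *\<^sub>R indicat_real {0..1} (snd p))"
      by (auto simp: indicator_def fun_eq_iff)
    then show "(LINT p:?Q|lborel. h (fst p)) = 1"
      using product_integral(2)[OF hint(1) i1] hint(2) by (simp add: set_lebesgue_integral_def)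
  qed
  have snorm: "norm (LINT p:?Q|lborel. f p) \<le> (LINT p:?Q|lborel. F p)"
    if f: "set_integrable lborel ?Q f" and F: "set_integrable lborel ?Q F"
      and le: "\<And>p. p \<in> ?Q \<Longrightarrow> norm (f p) \<le> F p" for f :: "'n cyl_map" and F
    unfolding set_lebesgue_integral_def
    by (rule Bochner_Integration.integral_norm_bound_integral[OF f[unfolded set_integrable_def]
          F[unfolded set_integrable_def]]) (auto simp: indicator_def le)
  have 1: "norm ((LINT p:?Q|lborel. h (fst p) *\<^sub>R u (s0, snd p)) - (LINT p:?Q|lborel. h (fst p) *\<^sub>R u p)) \<le> \<kappa>"
  proof -
    have "norm (LINT p:?Q|lborel. h (fst p) *\<^sub>R u (s0, snd p) - h (fst p) *\<^sub>R u p)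
        \<le> (LINT p:?Q|lborel. \<kappa> * h (fst p))"
    proof (rule snorm)
      show "set_integrable lborel ?Q (\<lambda>p. h (fst p) *\<^sub>R u (s0, snd p) - h (fst p) *\<^sub>R u p)"
        by (rule set_integral_diff(1)[OF ih0 ih])
      show "set_integrable lborel ?Q (\<lambda>p. \<kappa> * h (fst p))" using hQ(1) by simp
      fix p assume p: "p \<in> ?Q"
      show "norm (h (fst p) *\<^sub>R u (s0, snd p) - h (fst p) *\<^sub>R u p) \<le> \<kappa> * h (fst p)"
      proof (cases "\<bar>fst p - s0\<bar> < \<epsilon>")
        case True
        have "dist (s0, snd p) p < r"
          using True \<epsilon>(3) by (cases p) (simp add: dist_Pair_Pair dist_real_def abs_minus_commute)
        then have "dist (u (s0, snd p)) (u p) < \<kappa>" using p by (intro r(2)) auto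
        then have "h (fst p) * norm (u (s0, snd p) - u p) \<le> h (fst p) * \<kappa>"
          using h0 by (intro mult_left_mono) (auto simp: dist_norm)
        then show ?thesis
          using h0[of "fst p"] by (simp add: scaleR_diff_right[symmetric] mult.commute)
      next
        case False
        then have "1 \<le> \<bar>(fst p - s0) / \<epsilon>\<bar>" using \<epsilon>(1) by (simp add: abs_divide)
        then have "h (fst p) = 0" by (simp add: h_def deriv_beta(1))
        then show ?thesis by simp
      qed
    qed
    also have "\<dots> = \<kappa>" using hQ(2) by simp
    finally show ?thesis by (simp only: set_integral_diff(2)[OF ih0 ih])
  qed
  have 2: "norm (LINT p:?Q|lborel. g (fst p) *\<^sub>R u p) \<le> B * (LINT p:?Q|lborel. norm (u p))"
  proof -
    have "norm (LINT p:?Q|lborel. g (fst p) *\<^sub>R u p) \<le> (LINT p:?Q|lborel. B * norm (u p))"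
      by (rule snorm[OF ig]) (use iu B in \<open>auto simp: g_def intro: mult_right_mono\<close>)
    then show ?thesis by simp
  qed
  have 3: "norm (LINT p:?Q|lborel. ?\<phi> p *\<^sub>R v p) \<le> (LINT p:?Q|lborel. norm (v p))"
  proof (rule snorm)
    show "set_integrable lborel ?Q (\<lambda>p. norm (v p))"
      using integrable_norm[OF iv[unfolded set_integrable_def]] by (simp add: set_integrable_def)
    have b: "\<bar>?\<phi> p\<bar> \<le> 1" for p
      using bounds[of "fst p - s0"] bounds[of "(1 / \<epsilon>) * (fst p - s0)"] by linarith
    show "set_integrable lborel ?Q (\<lambda>p. ?\<phi> p *\<^sub>R v p)"
      by (rule set_integrable_bounded_mult[OF iv borel_measurable_continuous_onI[OF smooth_cont[OF sm\<phi>]] b])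
    show "norm (?\<phi> p *\<^sub>R v p) \<le> norm (v p)" for p
      using mult_right_mono[OF b[of p], of "norm (v p)"] by simp
  qed
  define x1 where "x1 = (LINT p:?Q|lborel. g (fst p) *\<^sub>R u p)"
  define x2 where "x2 = (LINT p:?Q|lborel. h (fst p) *\<^sub>R u p)"
  define x3 where "x3 = (LINT p:?Q|lborel. ?\<phi> p *\<^sub>R v p)"
  define x0 where "x0 = (LINT t:{0..1}|lborel. u (s0, t))"
  have w: "x1 + x2 = - x3" unfolding x1_def x2_def x3_def by (rule weak)
  have "x0 = (x0 - x2) + (- x3) + (- x1)" unfolding w[symmetric] by simp
  then have "norm x0 = norm ((x0 - x2) + (- x3) + (- x1))" by (rule arg_cong)
  also have "\<dots> \<le> norm (x0 - x2) + norm x3 + norm x1"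
    using norm_triangle_ineq[of "(x0 - x2) + (- x3)" "- x1"] norm_triangle_ineq[of "x0 - x2" "- x3"]
    unfolding norm_minus_cancel by linarith
  finally have "norm x0 \<le> norm (x0 - x2) + norm x3 + norm x1" .
  moreover have "norm (x0 - x2) \<le> \<kappa>" using 1 unfolding T x0_def x2_def .
  ultimately show "?T \<le> ?R + \<kappa>"
    using 2 3 unfolding x0_def x1_def x3_def by simp
qed

lemma deriv_beta_bounded: "\<exists>B. \<forall>x. \<bar>deriv \<beta> x\<bar> \<le> B"
proof -
  have cd: "continuous_on {-1..1} (deriv \<beta>)"
    by (rule continuous_on_subset[OF differentiable_imp_continuous_on[OF smooth_real_diff[OF smooth_real_deriv[OF cutoff_smooth]]]]) simp
  then have "bounded (deriv \<beta> ` {-1..1})"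
    by (intro compact_imp_bounded compact_continuous_image) auto
  then obtain B where "\<forall>x\<in>deriv \<beta> ` {-1..1}. norm x \<le> B"
    unfolding bounded_iff by blast
  then have B: "\<And>x. x \<in> {-1..1} \<Longrightarrow> \<bar>deriv \<beta> x\<bar> \<le> B" by auto
  have "\<bar>deriv \<beta> x\<bar> \<le> B" for x
  proof (cases "x \<in> {-1..1}")
    case False
    then have "deriv \<beta> x = 0" by (intro deriv_beta(1)) auto
    moreover have "0 \<le> B" using B[of 0] by fastforce
    ultimately show ?thesis by simp
  qed (rule B)
  then show ?thesis by blast
qed

text \<open>Evaluation on a circle costs one derivative. The estimate is proved with an arbitrary
  \<open>N\<close> above the Sobolev norm, because the latter may vanish.\<close>

lemma trace_bounded:
  assumes I: "strip_base I" and K: "{s0 - 1..s0 + 1} \<subseteq> interior I" and d: "0 \<le> d" and k: "1 \<le> k"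
  shows "\<exists>C\<ge>0. \<forall>u :: ('n::finite) cyl_map. sobolev I k d u \<longrightarrow>
    norm (LINT t:{0..1}|lborel. u (s0, t)) \<le> C * sobolev_norm I k d u"
proof -
  obtain B where B: "\<And>x. \<bar>deriv \<beta> x\<bar> \<le> B" using deriv_beta_bounded by blast
  have B0: "0 \<le> B" using B[of 0] by linarith
  have KI: "{s0 - 1..s0 + 1} \<subseteq> I" using K interior_subset by blast
  show ?thesis
  proof (intro exI[of _ "3 * (B + 1)"] conjI allI impI)
    show "0 \<le> 3 * (B + 1)" using B0 by simp
    fix u :: "'n cyl_map" assume u: "sobolev I k d u"
    let ?N = "sobolev_norm I k d u"
    let ?T = "norm (LINT t:{0..1}|lborel. u (s0, t))"
    have N0: "0 \<le> ?N" by (rule sobolev_norm_nonneg)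
    have "?T \<le> 3 * (B + 1) * N" if N: "?N < N" for N
    proof -
      have N': "0 < N" using N N0 by linarith
      have NN: "?N\<^sup>2 \<le> N\<^sup>2" using N N0 by (intro power_mono) auto
      note u0 = weak_deriv_self[OF I u]
      have ij: "1 + 0 \<le> k" using k by simp
      note v = sobolev_wd[OF I u ij] and ev = energy_le_norm[OF ij, of I d u]
      have U: "(LINT p:{s0 - 1..s0 + 1} \<times> {0..1}|lborel. norm (u p)) \<le> (s0 + 1 - (s0 - 1) + 1) * N"
        by (rule L1_le_energy(2)[OF _ u0(2) KI _ d N'])
          (use u0 NN in \<open>auto simp: weak_deriv_def\<close>)
      have V: "(LINT p:{s0 - 1..s0 + 1} \<times> {0..1}|lborel. norm (wd I 1 0 u p)) \<le> (s0 + 1 - (s0 - 1) + 1) * N"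
        "set_integrable lborel ({s0 - 1..s0 + 1} \<times> {0..1}) (wd I 1 0 u)"
        by (rule L1_le_energy[OF _ v(2) KI _ d N']; use v(1) ev NN in \<open>auto simp: weak_deriv_def\<close>)+
      have "?T \<le> B * (LINT p:{s0 - 1..s0 + 1} \<times> {0..1}|lborel. norm (u p))
          + (LINT p:{s0 - 1..s0 + 1} \<times> {0..1}|lborel. norm (wd I 1 0 u p))"
        by (rule trace_le_L1[OF I K _ v(1) V(2) B]) (use u in \<open>simp add: sobolev_def\<close>)
      also have "\<dots> \<le> B * (3 * N) + 3 * N"
        using U V(1) B0 by (intro add_mono mult_left_mono) auto
      finally show ?thesis by (simp add: algebra_simps)
    qed
    then have "?T / (3 * (B + 1)) \<le> N" if "?N < N" for N
      using that B0 by (simp add: pos_divide_le_eq mult_ac)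
    then have "?T / (3 * (B + 1)) \<le> ?N" by (rule dense_ge)
    then show "?T \<le> 3 * (B + 1) * ?N" using B0 by (simp add: pos_divide_le_eq mult_ac)
  qed
qed

end

section \<open>Sc-isomorphisms onto a product\<close>

text \<open>The preimages of \<open>(0, g x)\<close> and \<open>(f x, 0)\<close> are the components of
  \<open>x\<close> in the two kernels, and on \<open>ker g\<close> the norm of the product is
  the norm of the first factor. Constants are taken nonnegative at the start, since boundedness
  is defined without a sign condition.\<close>

lemma sc_isomorphism_onto_product:
  fixes X :: "'v::real_vector sc_space" and Y :: "'w::real_vector sc_space"
    and Z :: "'z::real_vector sc_space"
  assumes iso: "sc_isomorphism X (sc_prod Y Z) (\<lambda>x. (f x, g x))"
    and X: "subspace (Level X 0)" "\<And>m. Level X m \<subseteq> Level X 0"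
      "\<And>m x. x \<in> Level X m \<Longrightarrow> 0 \<le> LNorm X m x"
    and Y0: "\<And>m. 0 \<in> Level Y m" "\<And>m. LNorm Y m 0 = 0"
    and Z0: "\<And>m. 0 \<in> Level Z m" "\<And>m. LNorm Z m 0 = 0"
  shows "sc_direct_sum X (sc_kernel X f) (sc_kernel X g)"
    and "(\<And>m y. y \<in> Level Y m \<Longrightarrow> 0 \<le> LNorm Y m y) \<Longrightarrow>
      sc_isomorphism (sc_subspace X (sc_kernel X g)) Y f"
proof -
  let ?h = "\<lambda>x. (f x, g x)"
  have lin: "f (x + y) = f x + f y" "g (x + y) = g x + g y"
    "f (c *\<^sub>R x) = c *\<^sub>R f x" "g (c *\<^sub>R x) = c *\<^sub>R g x"
    if "x \<in> Level X 0" "y \<in> Level X 0" for x y c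
    using iso that by (auto simp: sc_isomorphism_def linear_on_def)
  have X0: "0 \<in> Level X 0" "\<And>x y. x \<in> Level X 0 \<Longrightarrow> y \<in> Level X 0 \<Longrightarrow> x + y \<in> Level X 0"
    "\<And>c x. x \<in> Level X 0 \<Longrightarrow> c *\<^sub>R x \<in> Level X 0"
    using X(1) by (auto simp: subspace_def)
  have f0: "f 0 = 0" "g 0 = 0" using lin(3,4)[OF X0(1) X0(1), of 0] by simp_all
  have bij: "bij_betw ?h (Level X m) (Level Y m \<times> Level Z m)" for m
    using iso by (simp add: sc_isomorphism_def sc_prod_def)
  have inj: "x = y" if "x \<in> Level X 0" "y \<in> Level X 0" "f x = f y" "g x = g y" for x y
    using bij[of 0] that by (auto simp: bij_betw_def inj_on_def)
  have into: "f x \<in> Level Y m" "g x \<in> Level Z m" if "x \<in> Level X m" for x m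
    using bij[of m] that by (auto simp: bij_betw_def)
  have onto: "\<exists>x\<in>Level X m. f x = y \<and> g x = z" if "y \<in> Level Y m" "z \<in> Level Z m" for y z m
  proof -
    have "(y, z) \<in> ?h ` Level X m" using bij[of m] that by (simp add: bij_betw_def)
    then show ?thesis by auto
  qed
  have bounds: "\<exists>C. \<forall>x\<in>Level X m. sqrt ((LNorm Y m (f x))\<^sup>2 + (LNorm Z m (g x))\<^sup>2) \<le> C * LNorm X m x"
    "\<exists>C. \<forall>x\<in>Level X m. LNorm X m x \<le> C * sqrt ((LNorm Y m (f x))\<^sup>2 + (LNorm Z m (g x))\<^sup>2)" for m
    using iso by (simp_all add: sc_isomorphism_def sc_prod_def)
  have up: "\<exists>C\<ge>0. \<forall>x\<in>Level X m. sqrt ((LNorm Y m (f x))\<^sup>2 + (LNorm Z m (g x))\<^sup>2) \<le> C * LNorm X m x" for m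
  proof -
    obtain C where C: "\<And>x. x \<in> Level X m \<Longrightarrow>
        sqrt ((LNorm Y m (f x))\<^sup>2 + (LNorm Z m (g x))\<^sup>2) \<le> C * LNorm X m x"
      using bounds(1) by blast
    have "C * LNorm X m x \<le> \<bar>C\<bar> * LNorm X m x" if "x \<in> Level X m" for x
      using X(3)[OF that] by (intro mult_right_mono) auto
    then show ?thesis using C by (intro exI[of _ "\<bar>C\<bar>"]) (auto intro: order_trans)
  qed
  have down: "\<exists>C\<ge>0. \<forall>x\<in>Level X m. LNorm X m x \<le> C * sqrt ((LNorm Y m (f x))\<^sup>2 + (LNorm Z m (g x))\<^sup>2)" for m
  proof -
    obtain C where C: "\<And>x. x \<in> Level X m \<Longrightarrow>
        LNorm X m x \<le> C * sqrt ((LNorm Y m (f x))\<^sup>2 + (LNorm Z m (g x))\<^sup>2)"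
      using bounds(2) by blast
    have "C * sqrt ((LNorm Y m (f x))\<^sup>2 + (LNorm Z m (g x))\<^sup>2)
      \<le> \<bar>C\<bar> * sqrt ((LNorm Y m (f x))\<^sup>2 + (LNorm Z m (g x))\<^sup>2)" for x
      by (intro mult_right_mono) auto
    then show ?thesis using C by (intro exI[of _ "\<bar>C\<bar>"]) (auto intro: order_trans)
  qed
  show "sc_direct_sum X (sc_kernel X f) (sc_kernel X g)"
    unfolding sc_direct_sum_def
  proof (intro conjI allI)
    show "subspace (sc_kernel X f)" "subspace (sc_kernel X g)"
      using X0 lin f0 by (auto simp: subspace_def sc_kernel_def)
    show "sc_kernel X f \<subseteq> Level X 0" "sc_kernel X g \<subseteq> Level X 0"
      by (auto simp: sc_kernel_def)
    show "sc_kernel X f \<inter> sc_kernel X g = {0}"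
      using inj[OF _ X0(1)] X0(1) f0 by (auto simp: sc_kernel_def)
    fix m
    obtain C where C: "C \<ge> 0" "\<And>x. x \<in> Level X m \<Longrightarrow>
        sqrt ((LNorm Y m (f x))\<^sup>2 + (LNorm Z m (g x))\<^sup>2) \<le> C * LNorm X m x"
      using up[of m] by blast
    obtain D where D: "D \<ge> 0" "\<And>x. x \<in> Level X m \<Longrightarrow>
        LNorm X m x \<le> D * sqrt ((LNorm Y m (f x))\<^sup>2 + (LNorm Z m (g x))\<^sup>2)"
      using down[of m] by blast
    show "\<exists>C. \<forall>x\<in>Level X m. \<exists>y\<in>sc_kernel X f \<inter> Level X m. \<exists>z\<in>sc_kernel X g \<inter> Level X m.
        x = y + z \<and> LNorm X m y \<le> C * LNorm X m x \<and> LNorm X m z \<le> C * LNorm X m x"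
    proof (intro exI[of _ "D * C"] ballI)
      fix x assume x: "x \<in> Level X m"
      obtain y where y: "y \<in> Level X m" "f y = 0" "g y = g x"
        using onto[OF Y0(1) into(2)[OF x]] by blast
      obtain z where z: "z \<in> Level X m" "f z = f x" "g z = 0"
        using onto[OF into(1)[OF x] Z0(1)] by blast
      have l0: "x \<in> Level X 0" "y \<in> Level X 0" "z \<in> Level X 0" using x y z X(2) by blast+
      have "x = y + z"
        by (rule inj) (use l0 X0(2) lin(1,2)[OF l0(2,3)] y z in auto)
      moreover have "LNorm X m y \<le> D * C * LNorm X m x"
      proof -
        have "LNorm X m y \<le> D * sqrt ((LNorm Z m (g x))\<^sup>2)" using D(2)[OF y(1)] y Y0(2) by simp
        also have "\<dots> \<le> D * sqrt ((LNorm Y m (f x))\<^sup>2 + (LNorm Z m (g x))\<^sup>2)"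
          using D(1) by (intro mult_left_mono real_sqrt_le_mono) auto
        also have "\<dots> \<le> D * (C * LNorm X m x)" using C(2)[OF x] D(1) by (rule mult_left_mono)
        finally show ?thesis by simp
      qed
      moreover have "LNorm X m z \<le> D * C * LNorm X m x"
      proof -
        have "LNorm X m z \<le> D * sqrt ((LNorm Y m (f x))\<^sup>2)" using D(2)[OF z(1)] z Z0(2) by simp
        also have "\<dots> \<le> D * sqrt ((LNorm Y m (f x))\<^sup>2 + (LNorm Z m (g x))\<^sup>2)"
          using D(1) by (intro mult_left_mono real_sqrt_le_mono) auto
        also have "\<dots> \<le> D * (C * LNorm X m x)" using C(2)[OF x] D(1) by (rule mult_left_mono)
        finally show ?thesis by simp
      qed
      ultimately show "\<exists>y\<in>sc_kernel X f \<inter> Level X m. \<exists>z\<in>sc_kernel X g \<inter> Level X m.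
        x = y + z \<and> LNorm X m y \<le> D * C * LNorm X m x \<and> LNorm X m z \<le> D * C * LNorm X m x"
        using y z l0 by (auto simp: sc_kernel_def)
    qed
  qed
  assume Ynn: "\<And>m y. y \<in> Level Y m \<Longrightarrow> 0 \<le> LNorm Y m y"
  have lev: "Level (sc_subspace X (sc_kernel X g)) m = {x \<in> Level X m. g x = 0}" for m
    using X(2) by (auto simp: sc_subspace_def sc_kernel_def)
  have LN: "LNorm (sc_subspace X (sc_kernel X g)) = LNorm X" by (simp add: sc_subspace_def)
  have bij': "bij_betw f {x \<in> Level X m. g x = 0} (Level Y m)" for m
    unfolding bij_betw_def
  proof
    show "inj_on f {x \<in> Level X m. g x = 0}"
    proof (rule inj_onI)
      fix x y assume "x \<in> {x \<in> Level X m. g x = 0}" "y \<in> {x \<in> Level X m. g x = 0}" "f x = f y"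
      then show "x = y" using X(2)[of m] by (intro inj) auto
    qed
    show "f ` {x \<in> Level X m. g x = 0} = Level Y m"
      using into(1)[of _ m] onto[OF _ Z0(1)] by (auto simp: image_iff) metis
  qed
  show "sc_isomorphism (sc_subspace X (sc_kernel X g)) Y f"
    unfolding sc_isomorphism_def lev LN
  proof (intro conjI allI bij')
    show "linear_on {x \<in> Level X 0. g x = 0} f"
      using lin(1) lin(3)[OF _ X0(1)] by (simp add: linear_on_def)
    fix m
    obtain C where C: "C \<ge> 0" "\<And>x. x \<in> Level X m \<Longrightarrow>
        sqrt ((LNorm Y m (f x))\<^sup>2 + (LNorm Z m (g x))\<^sup>2) \<le> C * LNorm X m x"
      using up[of m] by blast
    show "\<exists>C. \<forall>x\<in>{x \<in> Level X m. g x = 0}. LNorm Y m (f x) \<le> C * LNorm X m x"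
    proof (intro exI[of _ C] ballI)
      fix x assume x: "x \<in> {x \<in> Level X m. g x = 0}"
      then have "\<bar>LNorm Y m (f x)\<bar> \<le> C * LNorm X m x" using C(2)[of x] Z0(2) by simp
      then show "LNorm Y m (f x) \<le> C * LNorm X m x" by simp
    qed
    obtain D where D: "D \<ge> 0" "\<And>x. x \<in> Level X m \<Longrightarrow>
        LNorm X m x \<le> D * sqrt ((LNorm Y m (f x))\<^sup>2 + (LNorm Z m (g x))\<^sup>2)"
      using down[of m] by blast
    show "\<exists>C. \<forall>x\<in>{x \<in> Level X m. g x = 0}. LNorm X m x \<le> C * LNorm Y m (f x)"
    proof (intro exI[of _ D] ballI)
      fix x assume x: "x \<in> {x \<in> Level X m. g x = 0}"
      then have "0 \<le> LNorm Y m (f x)" using into(1)[of x m] Ynn by simp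
      then show "LNorm X m x \<le> D * LNorm Y m (f x)" using D(2)[of x] x Z0(2) by simp
    qed
  qed
qed

section \<open>Bounded families of maps\<close>

text \<open>Outside the compact interval from \<open>lo\<close> to \<open>hi\<close> the derivatives of
  positive order vanish; on it all of them are bounded by continuity.\<close>

lemma multiplierI:
  assumes G: "smooth G" "t_invariant G" "closed S" "\<And>s t. s \<notin> S \<Longrightarrow> G (s, t) = 0"
    and lo: "\<And>s t. s < lo \<Longrightarrow> G (s, t) = cl" and hi: "\<And>s t. s > hi \<Longrightarrow> G (s, t) = ch"
  shows "multiplier G S"
proof -
  have bd: "\<exists>B. \<forall>p. \<bar>F p\<bar> \<le> B"
    if F: "smooth F" "t_invariant F" and z: "\<And>s t. s < lo \<Longrightarrow> F (s, t) = c" "\<And>s t. s > hi \<Longrightarrow> F (s, t) = d"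
    for F c d
  proof -
    have "bounded (F ` ({lo..hi} \<times> {0}))"
      by (intro compact_imp_bounded compact_continuous_image compact_Times
          continuous_on_subset[OF smooth_cont[OF F(1)]]) auto
    then obtain B where "\<forall>x\<in>F ` ({lo..hi} \<times> {0}). norm x \<le> B" unfolding bounded_iff by blast
    then have B: "\<bar>F (s, 0)\<bar> \<le> B" if "s \<in> {lo..hi}" for s using that by auto
    have "\<bar>F (s, t)\<bar> \<le> max B (max \<bar>c\<bar> \<bar>d\<bar>)" for s t
    proof (cases "s \<in> {lo..hi}")
      case True
      have "F (s, t) = F (s, 0)" using F(2) unfolding t_invariant_def by blast
      then show ?thesis using B[OF True] by simp
    next
      case False
      then have "s < lo \<or> s > hi" by auto
      then show ?thesis using z[of s t] by auto
    qed
    then show ?thesis by (metis surj_pair)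
  qed
  have "\<exists>B. \<forall>p. \<bar>(partial_s ^^ l) G p\<bar> \<le> B" for l
  proof (cases l)
    case 0
    then show ?thesis using bd[OF G(1,2) lo hi] by simp
  next
    case (Suc n)
    have z: "partial_s G (s, t) = 0" if "s \<notin> {lo..hi}" for s t
    proof (cases "s < lo")
      case True
      then show ?thesis using partial_s_off[of "{lo..}" G cl s t] lo by simp
    next
      case False
      then show ?thesis using partial_s_off[of "{..hi}" G ch s t] hi that by simp
    qed
    have "(partial_s ^^ l) G (s, t) = 0" if "s \<notin> {lo..hi}" for s t
      using partials_s_off[of "{lo..hi}" "partial_s G" s n t] z that by (simp add: Suc funpow_swap1)
    then show ?thesis
      by (intro bd[of _ 0 0] smooth_partials t_invariant_partial_s G) auto
  qed
  then show ?thesis using G by (simp add: multiplier_def)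
qed

text \<open>The gluing map and its inverse are composed of many bounded operations. Families
  \<open>T\<close> whose norms are controlled by a function \<open>e\<close> of the data keep
  the constants of the single steps out of sight: here \<open>X\<close> is the set of data and
  \<open>e\<close> their norm.\<close>

definition tame_vec :: "'x set \<Rightarrow> ('x \<Rightarrow> real) \<Rightarrow> ('x \<Rightarrow> real ^ ('n::finite)) \<Rightarrow> bool" where
  "tame_vec X e v \<longleftrightarrow> (\<exists>C\<ge>0. \<forall>x\<in>X. norm (v x) \<le> C * e x)"

definition tame :: "'x set \<Rightarrow> ('x \<Rightarrow> real) \<Rightarrow> real set \<Rightarrow> nat \<Rightarrow> real \<Rightarrow>
    ('x \<Rightarrow> ('n::finite) cyl_map) \<Rightarrow> bool" where
  "tame X e I k d T \<longleftrightarrow>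
     (\<exists>C\<ge>0. \<forall>x\<in>X. sobolev I k d (T x) \<and> sobolev_norm I k d (T x) \<le> C * e x)"

lemma tame_vec_add:
  assumes "tame_vec X e v" "tame_vec X e w"
  shows "tame_vec X e (\<lambda>x. v x + w x)"
proof -
  obtain C D where "C \<ge> 0" "\<And>x. x \<in> X \<Longrightarrow> norm (v x) \<le> C * e x"
    "D \<ge> 0" "\<And>x. x \<in> X \<Longrightarrow> norm (w x) \<le> D * e x" using assms unfolding tame_vec_def by metis
  then show ?thesis
    unfolding tame_vec_def
    by (intro exI[of _ "C + D"]) (auto simp: distrib_right intro!: order_trans[OF norm_triangle_ineq] add_mono)
qed

lemma tame_vec_scaleR:
  assumes "tame_vec X e v"
  shows "tame_vec X e (\<lambda>x. c *\<^sub>R v x)"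
proof -
  obtain C where "C \<ge> 0" "\<And>x. x \<in> X \<Longrightarrow> norm (v x) \<le> C * e x"
    using assms unfolding tame_vec_def by metis
  then show ?thesis
    unfolding tame_vec_def
    by (intro exI[of _ "\<bar>c\<bar> * C"]) (auto simp: mult.assoc intro!: mult_left_mono)
qed

lemma tame_vec_cong:
  "tame_vec X e v \<Longrightarrow> (\<And>x. x \<in> X \<Longrightarrow> v x = w x) \<Longrightarrow> tame_vec X e w"
  unfolding tame_vec_def by (metis (no_types, lifting))

lemma tame_sobolev: "tame X e I k d T \<Longrightarrow> x \<in> X \<Longrightarrow> sobolev I k d (T x)"
  unfolding tame_def by blast

lemma tame_cong:
  assumes "tame X e I k d T" "\<And>x. x \<in> X \<Longrightarrow> periodic (U x)"
    and "\<And>x s t. x \<in> X \<Longrightarrow> s \<in> I \<Longrightarrow> T x (s, t) = U x (s, t)"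
  shows "tame X e I k d U"
proof -
  have "sobolev I k d (U x) \<and> sobolev_norm I k d (U x) = sobolev_norm I k d (T x)"
    if "x \<in> X" "sobolev I k d (T x)" for x
    using sobolev_cong[of I "T x" "U x"] assms(2,3) that by metis
  then show ?thesis using assms(1) unfolding tame_def by (metis (no_types, lifting))
qed

context smooth_cutoff
begin

lemma tame_add:
  assumes I: "strip_base I" and T: "tame X e I k d T" and U: "tame X e I k d U"
  shows "tame X e I k d (\<lambda>x p. T x p + U x p)"
proof -
  obtain C where C: "C \<ge> 0" "\<And>x. x \<in> X \<Longrightarrow> sobolev I k d (T x)"
    "\<And>x. x \<in> X \<Longrightarrow> sobolev_norm I k d (T x) \<le> C * e x" using T unfolding tame_def by blast
  obtain D where D: "D \<ge> 0" "\<And>x. x \<in> X \<Longrightarrow> sobolev I k d (U x)"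
    "\<And>x. x \<in> X \<Longrightarrow> sobolev_norm I k d (U x) \<le> D * e x" using U unfolding tame_def by blast
  show ?thesis
    unfolding tame_def
  proof (intro exI[of _ "norm_const k * (2 * (C + D))"] conjI ballI)
    show "0 \<le> norm_const k * (2 * (C + D))" using C D norm_const_nonneg by simp
    fix x assume x: "x \<in> X"
    note s = sobolev_add[OF I C(2)[OF x] D(2)[OF x]]
    show "sobolev I k d (\<lambda>p. T x p + U x p)" by (rule s)
    have "sobolev_norm I k d (\<lambda>p. T x p + U x p) \<le> norm_const k * (2 * (C * e x + D * e x))"
      by (rule order_trans[OF s(2)]) (intro mult_left_mono add_mono C(3) D(3) x norm_const_nonneg; simp)
    then show "sobolev_norm I k d (\<lambda>p. T x p + U x p) \<le> norm_const k * (2 * (C + D)) * e x"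
      by (simp add: algebra_simps)
  qed
qed

lemma tame_scaleR:
  assumes I: "strip_base I" and T: "tame X e I k d T"
  shows "tame X e I k d (\<lambda>x p. c *\<^sub>R T x p)"
proof -
  obtain C where C: "C \<ge> 0" "\<And>x. x \<in> X \<Longrightarrow> sobolev I k d (T x)"
    "\<And>x. x \<in> X \<Longrightarrow> sobolev_norm I k d (T x) \<le> C * e x" using T unfolding tame_def by blast
  show ?thesis
    unfolding tame_def
  proof (intro exI[of _ "norm_const k * (\<bar>c\<bar> * C)"] conjI ballI)
    show "0 \<le> norm_const k * (\<bar>c\<bar> * C)" using C norm_const_nonneg by simp
    fix x assume x: "x \<in> X"
    note s = sobolev_scaleR[OF I C(2)[OF x], of c]
    show "sobolev I k d (\<lambda>p. c *\<^sub>R T x p)" by (rule s)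
    have "sobolev_norm I k d (\<lambda>p. c *\<^sub>R T x p) \<le> norm_const k * (\<bar>c\<bar> * (C * e x))"
      by (rule order_trans[OF s(2)]) (intro mult_left_mono C(3) x norm_const_nonneg; simp)
    then show "sobolev_norm I k d (\<lambda>p. c *\<^sub>R T x p) \<le> norm_const k * (\<bar>c\<bar> * C) * e x"
      by (simp add: algebra_simps)
  qed
qed

lemma tame_chain:
  assumes T: "tame X e I k d T"
    and F: "\<exists>C\<ge>0. \<forall>u. sobolev I k d u \<longrightarrow> sobolev J k d' (F u) \<and> sobolev_norm J k d' (F u) \<le> C * sobolev_norm I k d u"
  shows "tame X e J k d' (\<lambda>x. F (T x))"
proof -
  obtain C where C: "C \<ge> 0" "\<And>x. x \<in> X \<Longrightarrow> sobolev I k d (T x)"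
    "\<And>x. x \<in> X \<Longrightarrow> sobolev_norm I k d (T x) \<le> C * e x" using T unfolding tame_def by blast
  obtain D where D: "D \<ge> 0" "\<And>u. sobolev I k d u \<Longrightarrow> sobolev J k d' (F u)"
    "\<And>u. sobolev I k d u \<Longrightarrow> sobolev_norm J k d' (F u) \<le> D * sobolev_norm I k d u" using F by blast
  show ?thesis
    unfolding tame_def
  proof (intro exI[of _ "D * C"] conjI ballI)
    show "0 \<le> D * C" using C D by simp
    fix x assume x: "x \<in> X"
    show "sobolev J k d' (F (T x))" by (rule D(2)[OF C(2)[OF x]])
    have "sobolev_norm J k d' (F (T x)) \<le> D * sobolev_norm I k d (T x)" by (rule D(3)[OF C(2)[OF x]])
    also have "\<dots> \<le> D * (C * e x)" by (rule mult_left_mono[OF C(3)[OF x] D(1)])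
    finally show "sobolev_norm J k d' (F (T x)) \<le> D * C * e x" by simp
  qed
qed

lemma tame_mult:
  assumes "tame X e I k d T" "multiplier G S" "strip_base I" "strip_base J"
    and "interior J \<inter> S \<subseteq> interior I" "J \<inter> S \<subseteq> I"
    and "\<And>s. s \<in> J \<inter> S \<Longrightarrow> exp (d' * \<bar>s\<bar>) \<le> W * exp (d * \<bar>s\<bar>)"
  shows "tame X e J k d' (\<lambda>x p. G p *\<^sub>R T x p)"
  by (rule tame_chain[OF assms(1) sobolev_mult[OF assms(2-7)]])

lemma tame_shift:
  assumes "tame X e I k d T" "strip_base I"
  shows "tame X e ((+) (-a) ` I) k d (\<lambda>x (s, t). T x (s + a, t + b))"
  by (rule tame_chain[OF assms(1) sobolev_shift[OF assms(2)]])

lemma tame_const: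
  assumes "tame_vec X e v" "a < b"
  shows "tame X e {a..b} k 0 (\<lambda>x p. v x)"
proof -
  obtain C where C: "C \<ge> 0" "\<And>x. x \<in> X \<Longrightarrow> norm (v x) \<le> C * e x"
    using assms(1) unfolding tame_vec_def by blast
  show ?thesis
    unfolding tame_def
  proof (intro exI[of _ "norm_const k * (sqrt (b - a) * C)"] conjI ballI)
    show "0 \<le> norm_const k * (sqrt (b - a) * C)" using C norm_const_nonneg assms(2) by simp
    fix x assume x: "x \<in> X"
    show "sobolev {a..b} k 0 (\<lambda>p. v x)" by (rule sobolev_const[OF assms(2)])
    have "sobolev_norm {a..b} k 0 (\<lambda>p. v x) \<le> norm_const k * (sqrt (b - a) * norm (v x))"
      by (rule sobolev_const[OF assms(2)])
    also have "\<dots> \<le> norm_const k * (sqrt (b - a) * (C * e x))"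
      by (intro mult_left_mono C(2) x norm_const_nonneg) (use assms(2) in simp)
    finally show "sobolev_norm {a..b} k 0 (\<lambda>p. v x) \<le> norm_const k * (sqrt (b - a) * C) * e x"
      by (simp add: mult_ac)
  qed
qed

lemma tame_trace:
  assumes T: "tame X e I k d T" and I: "strip_base I" "{s0 - 1..s0 + 1} \<subseteq> interior I" "0 \<le> d" "1 \<le> k"
  shows "tame_vec X e (\<lambda>x. LINT t:{0..1}|lborel. T x (s0, t))"
proof -
  obtain C where C: "C \<ge> 0" "\<And>x. x \<in> X \<Longrightarrow> sobolev I k d (T x)"
    "\<And>x. x \<in> X \<Longrightarrow> sobolev_norm I k d (T x) \<le> C * e x" using T unfolding tame_def by blast
  obtain D where D: "D \<ge> 0" "\<And>u :: 'b cyl_map. sobolev I k d u \<Longrightarrow>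
      norm (LINT t:{0..1}|lborel. u (s0, t)) \<le> D * sobolev_norm I k d u"
    using trace_bounded[OF I] by blast
  show ?thesis
    unfolding tame_vec_def
  proof (intro exI[of _ "D * C"] conjI ballI)
    show "0 \<le> D * C" using C D by simp
    fix x assume x: "x \<in> X"
    have "norm (LINT t:{0..1}|lborel. T x (s0, t)) \<le> D * sobolev_norm I k d (T x)"
      by (rule D(2)[OF C(2)[OF x]])
    also have "\<dots> \<le> D * (C * e x)" by (rule mult_left_mono[OF C(3)[OF x] D(1)])
    finally show "norm (LINT t:{0..1}|lborel. T x (s0, t)) \<le> D * C * e x" by simp
  qed
qed

text \<open>The weak derivatives of the smooth summand are continuous, hence locally square integrable.\<close>

lemma sobolev_loc_add_smooth:
  fixes r :: "('n::finite) cyl_map"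
  assumes r: "sobolev UNIV k d r" "0 \<le> d" and G: "smooth G" "t_invariant G"
  shows "sobolev_loc k (\<lambda>p. r p + G p *\<^sub>R q)"
  unfolding sobolev_loc_def
proof (intro conjI allI impI)
  have "G (s, t + 1) = G (s, t)" for s t
  proof -
    have "G (s, t + 1) = G (s, 0)" "G (s, t) = G (s, 0)" using G(2) unfolding t_invariant_def by blast+
    then show ?thesis by simp
  qed
  then show "periodic (\<lambda>p. r p + G p *\<^sub>R q)" using r(1) by (simp add: sobolev_def periodic_def)
  show "continuous_on UNIV (\<lambda>p. r p + G p *\<^sub>R q)"
    using r(1) smooth_cont[OF G(1)] by (intro continuous_intros) (simp_all add: sobolev_def)
  fix i j assume ij: "i + j \<le> k"
  note v = sobolev_wd[OF strip_base_simps(1) r(1) ij]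
  let ?v = "wd UNIV i j r"
  let ?x = "\<lambda>l. if l = 0 \<and> j = 0 then q else 0"
  let ?z = "\<lambda>p. \<Sum>l\<le>i. (real (i choose l) * (partial_s ^^ l) G p) *\<^sub>R ?x (i - l)"
  have "weak_deriv UNIV i j (\<lambda>p. G p *\<^sub>R q) ?z"
    by (rule weak_deriv_mult[where S = UNIV and I = UNIV and v = "\<lambda>l p. ?x l", OF weak_deriv_const])
      (use G in auto)
  from weak_deriv_add[OF v(1) this]
  have w: "weak_deriv UNIV i j (\<lambda>p. r p + G p *\<^sub>R q) (\<lambda>p. ?v p + ?z p)" .
  have cz: "continuous_on UNIV ?z"
    by (intro continuous_on_sum continuous_on_scaleR continuous_on_const smooth_cont smooth_cmult smooth_partials G(1))
  have int: "set_integrable lborel (K \<times> {0..1}) (\<lambda>p. (norm (?v p + ?z p))\<^sup>2)" if K: "compact K" for K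
  proof -
    let ?Q = "K \<times> {0..1::real}"
    have cQ: "compact ?Q" using K by (intro compact_Times) auto
    have bQ: "?Q \<in> sets borel" using cQ by (simp add: borel_compact)
    have iz: "integrable lborel (\<lambda>p. indicat_real ?Q p *\<^sub>R (norm (?z p))\<^sup>2)"
      by (rule borel_integrable_compact[OF cQ continuous_on_subset[OF _ subset_UNIV]])
        (intro continuous_on_power continuous_on_norm cz)
    let ?F = "\<lambda>p. 2 * (wabs UNIV d ?v p)\<^sup>2 + 2 * (indicat_real ?Q p *\<^sub>R (norm (?z p))\<^sup>2)"
    have F: "integrable lborel ?F"
      using v(2) iz by (intro Bochner_Integration.integrable_add integrable_mult_right)
        (auto simp: finite_energy_def)
    have m: "(\<lambda>p. indicat_real ?Q p *\<^sub>R (norm (?v p + ?z p))\<^sup>2) \<in> borel_measurable lborel"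
    proof -
      have "(\<lambda>p. ?v p + ?z p) \<in> borel_measurable borel"
        using w by (simp add: weak_deriv_def set_borel_measurable_def)
      then have "(\<lambda>p. (norm (?v p + ?z p))\<^sup>2) \<in> borel_measurable borel"
        by (intro borel_measurable_power measurable_compose[OF _ borel_measurable_norm])
      then show ?thesis using borel_measurable_scaleR[OF borel_measurable_indicator[OF bQ]]
        by (simp only: measurable_lborel2)
    qed
    show ?thesis
      unfolding set_integrable_def
    proof (rule Bochner_Integration.integrable_bound[OF F m AE_I2])
      fix p
      have F0: "0 \<le> ?F p" by (intro add_nonneg_nonneg mult_nonneg_nonneg scaleR_nonneg_nonneg) auto
      have "indicat_real ?Q p *\<^sub>R (norm (?v p + ?z p))\<^sup>2 \<le> ?F p"
      proof (cases "p \<in> ?Q")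
        case True
        let ?a = "norm (?v p)" and ?b = "norm (?z p)"
        have "1 * ?a \<le> exp (d * \<bar>fst p\<bar>) * ?a" using r(2) by (intro mult_right_mono) auto
        then have a: "?a\<^sup>2 \<le> (wabs UNIV d ?v p)\<^sup>2" using True by (auto simp: wabs_def intro!: power_mono)
        have "(norm (?v p + ?z p))\<^sup>2 \<le> (?a + ?b)\<^sup>2" by (intro power_mono norm_triangle_ineq) simp
        also have "\<dots> \<le> 2 * ?a\<^sup>2 + 2 * ?b\<^sup>2"
          using zero_le_power2[of "?a - ?b"] by (simp add: power2_eq_square algebra_simps)
        finally have "(norm (?v p + ?z p))\<^sup>2 \<le> 2 * (wabs UNIV d ?v p)\<^sup>2 + 2 * ?b\<^sup>2" using a by linarith
        then show ?thesis using True by (simp only: indicator_simps scaleR_one)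
      next
        case False
        then have "indicat_real ?Q p = 0" by simp
        then show ?thesis by simp
      qed
      then show "norm (indicat_real ?Q p *\<^sub>R (norm (?v p + ?z p))\<^sup>2) \<le> norm (?F p)"
        using F0 by (simp only: real_norm_def real_scaleR_def abs_mult abs_power2 abs_indicator abs_of_nonneg)
    qed
  qed
  show "\<exists>v. weak_deriv UNIV i j (\<lambda>p. r p + G p *\<^sub>R q) v \<and>
      (\<forall>K. compact K \<longrightarrow> set_integrable lborel (K \<times> {0..1}) (\<lambda>p. (norm (v p))\<^sup>2))"
    using w int by blast
qed

end

section \<open>The levels of the space of pairs\<close>

lemma slice_continuous:
  assumes "continuous_on (I \<times> UNIV) f" "s \<in> I"
  shows "continuous_on UNIV (\<lambda>t. f (s, t))"
  by (rule continuous_on_compose2[OF assms(1)]) (use assms(2) in \<open>auto intro: continuous_intros\<close>)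

lemma circle_integrable:
  fixes f :: "real \<Rightarrow> real ^ ('n::finite)"
  assumes "continuous_on UNIV f"
  shows "set_integrable lborel {0..1} f"
  using borel_integrable_compact[of "{0..1::real}" f] continuous_on_subset[OF assms]
  by (simp add: set_integrable_def)

lemma circle_integral_const: "(LINT t:{0..1::real}|lborel. c) = (c :: real ^ ('n::finite))"
proof -
  have "(LINT t|lborel. indicat_real {0..1::real} t *\<^sub>R c) = (LINT t|lborel. indicat_real {0..1::real} t) *\<^sub>R c"
    by (rule integral_scaleR_left) (use borel_integrable_compact[of "{0..1::real}" "\<lambda>_. 1 :: real"] in simp)
  then show ?thesis by (simp add: set_lebesgue_integral_def)
qed

lemma circle_integral_diff_const:
  fixes f :: "real \<Rightarrow> real ^ ('n::finite)"
  assumes "continuous_on UNIV f"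
  shows "(LINT t:{0..1}|lborel. f t - c) = (LINT t:{0..1}|lborel. f t) - c"
  using set_integral_diff(2)[OF circle_integrable[OF assms] circle_integrable[of "\<lambda>t. c"]]
  by (simp add: circle_integral_const)

lemma periodic_shift: "periodic f \<Longrightarrow> f (s, t + 1 + x) = f (s, t + x)"
proof -
  assume "periodic f"
  then have "f (s, (t + x) + 1) = f (s, t + x)" unfolding periodic_def by blast
  then show ?thesis by (simp add: add_ac)
qed

type_synonym 'n pair_with_limit = "('n cyl_map \<times> 'n cyl_map) \<times> (real ^ 'n)"

definition half_maps :: "('n::finite) cyl_map \<times> 'n cyl_map \<Rightarrow> bool" where
  "half_maps u \<longleftrightarrow> fst u \<in> cyl_maps {0..} \<and> snd u \<in> cyl_maps {..0}"

lemma asymptotic_continuous: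
  assumes "asymptotic k d u c"
  shows "continuous_on ({0..} \<times> UNIV) (fst u)" "continuous_on ({..0} \<times> UNIV) (snd u)"
proof -
  have "continuous_on ({0..} \<times> UNIV) (\<lambda>p. (fst u p - c) + c)"
    "continuous_on ({..0} \<times> UNIV) (\<lambda>p. (snd u p - c) + c)"
    using assms by (intro continuous_on_add continuous_on_const; simp add: asymptotic_def sobolev_def)+
  then show "continuous_on ({0..} \<times> UNIV) (fst u)" "continuous_on ({..0} \<times> UNIV) (snd u)"
    by simp_all
qed

locale weighted = smooth_cutoff +
  fixes \<delta> :: "nat \<Rightarrow> real"
  assumes \<delta>_mono: "strict_mono \<delta>" and \<delta>_0: "\<delta> 0 > 0"
begin

lemma \<delta>_ge: "\<delta> 0 \<le> \<delta> m"
  using \<delta>_mono by (simp add: strict_mono_less_eq)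

lemma \<delta>_pos: "0 < \<delta> m"
  using \<delta>_ge[of m] \<delta>_0 by linarith

text \<open>Levels and norms of \<open>E\<close> involve the asymptotic constant as a definite description.
  Carrying the constant along as part of the data replaces them by explicit formulas.\<close>

definition E_dom :: "nat \<Rightarrow> ((('n::finite) cyl_map \<times> 'n cyl_map) \<times> (real ^ 'n)) set" where
  "E_dom m = {(u, c). half_maps u \<and> asymptotic (3 + m) (\<delta> m) u c}"

definition E_nrm :: "nat \<Rightarrow> (('n::finite) cyl_map \<times> 'n cyl_map) \<times> (real ^ 'n) \<Rightarrow> real" where
  "E_nrm m = (\<lambda>(u, c). sqrt ((norm c)\<^sup>2
     + (sobolev_norm {0..} (3 + m) (\<delta> m) (\<lambda>p. fst u p - c))\<^sup>2
     + (sobolev_norm {..0} (3 + m) (\<delta> m) (\<lambda>p. snd u p - c))\<^sup>2))"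

lemma asymptotic_mono: "asymptotic (3 + m) (\<delta> m) u c \<Longrightarrow> asymptotic 3 (\<delta> 0) u c"
  unfolding asymptotic_def
  using sobolev_mono[OF strip_base_simps(2) _ le_add1 \<delta>_ge]
    sobolev_mono[OF strip_base_simps(3) _ le_add1 \<delta>_ge] by blast

text \<open>Two such constants differ by a constant map that lies in the weighted space over
  \<open>\<real>\<^sup>+\<close>.\<close>

lemma asymptotic_unique:
  assumes c: "asymptotic 3 (\<delta> 0) u c" and e: "asymptotic 3 (\<delta> 0) u e"
  shows "c = e"
proof -
  have "sobolev {0..} 3 (\<delta> 0) (\<lambda>p. (fst u p - c) + (-1) *\<^sub>R (fst u p - e))"
    using c e by (intro sobolev_add sobolev_scaleR strip_base_simps) (simp_all add: asymptotic_def)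
  then have "sobolev {0..} 3 (\<delta> 0) (\<lambda>p. e - c)" by simp
  from sobolev_eventually_const[OF strip_base_simps(2) this, of 0 "e - c"]
  show ?thesis using \<delta>_pos[of 0] by simp
qed

lemma asym_const_eq: "(u, c) \<in> E_dom m \<Longrightarrow> asym_const \<delta> u = c"
  unfolding asym_const_def E_dom_def
  by (rule the_equality) (auto dest: asymptotic_mono intro: asymptotic_unique)

lemma E_level: "u \<in> Level (E_space \<delta>) m \<longleftrightarrow> (\<exists>c. (u, c) \<in> E_dom m)"
proof
  assume "u \<in> Level (E_space \<delta>) m"
  then show "\<exists>c. (u, c) \<in> E_dom m"
    by (auto simp: E_space_def E_set_def E_dom_def half_maps_def)
next
  assume "\<exists>c. (u, c) \<in> E_dom m"
  then obtain c where c: "(u, c) \<in> E_dom m" by blast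
  then have "asymptotic 3 (\<delta> 0) u c" by (auto simp: E_dom_def dest: asymptotic_mono)
  with c asym_const_eq[OF c] show "u \<in> Level (E_space \<delta>) m"
    by (auto simp: E_space_def E_set_def E_dom_def half_maps_def)
qed

lemma E_lnorm: "(u, c) \<in> E_dom m \<Longrightarrow> LNorm (E_space \<delta>) m u = E_nrm m (u, c)"
  using asym_const_eq[of u c m] by (simp add: E_space_def E_nrm_def Let_def)

lemma E_level_0: "Level (E_space \<delta>) m \<subseteq> Level (E_space \<delta>) 0"
  using asymptotic_mono by (fastforce simp: E_level E_dom_def subset_iff)

lemma E_dom_linear:
  assumes "(u, c) \<in> E_dom m"
  shows "(w, e) \<in> E_dom m \<Longrightarrow> (u + w, c + e) \<in> E_dom m"
    and "(r *\<^sub>R u, r *\<^sub>R c) \<in> E_dom m"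
proof -
  note sb = strip_base_simps(2)[of 0] strip_base_simps(3)[of 0]
  show "(r *\<^sub>R u, r *\<^sub>R c) \<in> E_dom m"
    using assms sobolev_scaleR(1)[OF sb(1), of "3 + m" "\<delta> m" "\<lambda>p. fst u p - c" r]
      sobolev_scaleR(1)[OF sb(2), of "3 + m" "\<delta> m" "\<lambda>p. snd u p - c" r]
    by (auto simp: E_dom_def half_maps_def asymptotic_def cyl_maps_def periodic_def
        scaleR_fun_def scaleR_diff_right)
  assume "(w, e) \<in> E_dom m"
  with assms show "(u + w, c + e) \<in> E_dom m"
    using sobolev_add(1)[OF sb(1), of "3 + m" "\<delta> m" "\<lambda>p. fst u p - c" "\<lambda>p. fst w p - e"]
      sobolev_add(1)[OF sb(2), of "3 + m" "\<delta> m" "\<lambda>p. snd u p - c" "\<lambda>p. snd w p - e"]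
    by (auto simp: E_dom_def half_maps_def asymptotic_def cyl_maps_def periodic_def
        plus_fun_def add_diff_add)
qed

lemma E_dom_0: "(0, 0) \<in> E_dom m"
  using sobolev_zero(1)[OF strip_base_simps(2)[of 0], of "3 + m" "\<delta> m"]
    sobolev_zero(1)[OF strip_base_simps(3)[of 0], of "3 + m" "\<delta> m"]
  by (auto simp: E_dom_def half_maps_def asymptotic_def cyl_maps_def periodic_def zero_fun_def)

lemma E_subspace: "subspace (Level (E_space \<delta>) 0)"
  unfolding subspace_def
proof (intro conjI ballI allI)
  show "0 \<in> Level (E_space \<delta>) 0" unfolding E_level using E_dom_0 by (rule exI)
  fix x y :: "('a cyl_map \<times> 'a cyl_map)"
  assume "x \<in> Level (E_space \<delta>) 0"
  then obtain c where c: "(x, c) \<in> E_dom 0" unfolding E_level by (rule exE)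
  show "r *\<^sub>R x \<in> Level (E_space \<delta>) 0" for r
    unfolding E_level using E_dom_linear(2)[OF c] by (rule exI)
  assume "y \<in> Level (E_space \<delta>) 0"
  then obtain d where "(y, d) \<in> E_dom 0" unfolding E_level by (rule exE)
  from E_dom_linear(1)[OF c this] show "x + y \<in> Level (E_space \<delta>) 0"
    unfolding E_level by (rule exI)
qed

lemma E_lnorm_0: "LNorm (E_space \<delta> :: (('n::finite) cyl_map \<times> 'n cyl_map) sc_space) m 0 = 0"
proof -
  have "LNorm (E_space \<delta> :: ('n cyl_map \<times> 'n cyl_map) sc_space) m 0 = E_nrm m (0, 0 :: real ^ 'n)"
    by (rule E_lnorm[OF E_dom_0])
  also have "\<dots> = 0"
    by (simp add: E_nrm_def zero_fun_def sobolev_zero(2) strip_base_simps)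
  finally show ?thesis .
qed

text \<open>The second component vanishes identically, so the assertions are instances of the general
  splitting.\<close>

lemma gluing_0:
  defines "E \<equiv> E_space \<delta> :: (('n::finite) cyl_map \<times> 'n cyl_map) sc_space"
  shows "sc_isomorphism E (G0_space \<delta>) boxdot0"
    and "sc_direct_sum E (sc_kernel E oplus0) (sc_kernel E ominus0)"
proof -
  have nn: "0 \<le> LNorm E m x" for m x
    by (simp add: E_def E_space_def Let_def)
  have b: "bij_betw (\<lambda>x. (oplus0 x, ominus0 x)) (Level E m) (Level E m \<times> {0})" for m
    by (auto simp: bij_betw_def inj_on_def oplus0_def ominus0_def)
  have box: "boxdot0 = (\<lambda>x. (oplus0 x, ominus0 x))" by (simp add: boxdot0_def fun_eq_iff)
  have iso: "sc_isomorphism E (sc_prod E sc_zero) (\<lambda>x. (oplus0 x, ominus0 x))"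
    unfolding sc_isomorphism_def
    using b nn by (auto simp: sc_prod_def sc_zero_def linear_on_def oplus0_def ominus0_def intro!: exI[of _ 1])
  then show "sc_isomorphism E (G0_space \<delta>) boxdot0"
    by (simp add: G0_space_def E_def box)
  show "sc_direct_sum E (sc_kernel E oplus0) (sc_kernel E ominus0)"
  proof (rule sc_isomorphism_onto_product(1)[OF iso])
    show "0 \<in> Level E m" for m unfolding E_def E_level using E_dom_0 by blast
  qed (use E_subspace E_level_0 E_lnorm_0 nn in \<open>simp_all add: E_def sc_zero_def\<close>)
qed

end

section \<open>The matrix of the gluing map\<close>

locale gluing = weighted +
  fixes a :: complex
  assumes a0: "a \<noteq> 0" and a_less: "cmod a < 1 / 2"
begin

abbreviation "R \<equiv> gl_length a"
abbreviation "\<theta> \<equiv> gl_angle a"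

text \<open>The transition interval \<open>[R/2 - 1, R/2 + 1]\<close> of the cutoff lies inside \<open>(0,
  R)\<close>. Indeed \<open>R > e\<^sup>2 - e = e (e - 1) \<ge> 2\<close>.\<close>

lemma R_gt: "R > 2"
proof -
  have "2 < 1 / cmod a" using a0 a_less by (simp add: field_simps)
  then have "exp 2 < exp (1 / cmod a)" by simp
  moreover have "exp (2::real) = exp 1 * exp 1" by (simp add: exp_add[symmetric])
  moreover have e: "2 \<le> exp (1::real)" using exp_ge_add_one_self[of 1] by simp
  then have "2 * 1 \<le> exp 1 * (exp 1 - 1 :: real)" by (intro mult_mono) auto
  ultimately show ?thesis by (simp add: gl_length_def gluing_profile_def algebra_simps)
qed

text \<open>With \<open>b\<close> for the translated cutoff, the gluing map is given by the matrix with rows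
  \<open>(b, 1 - b)\<close> and \<open>(- (1 - b), b)\<close>. Its determinant is
  \<open>gl_det\<close>, and its inverse has the rows \<open>(kp, - km)\<close> and \<open>(km,
  kp)\<close>.\<close>

definition cut :: "real \<times> real \<Rightarrow> real" where
  "cut p = beta_gl \<beta> a (fst p)"

definition gl_det :: "real \<times> real \<Rightarrow> real" where
  "gl_det p = cut p * cut p + (1 - cut p) * (1 - cut p)"

definition kp :: "real \<times> real \<Rightarrow> real" where "kp p = cut p / gl_det p"

definition km :: "real \<times> real \<Rightarrow> real" where "km p = (1 - cut p) / gl_det p"

lemma cut_1: "s \<le> R / 2 - 1 \<Longrightarrow> cut (s, t) = 1"
  by (simp add: cut_def beta_gl_def eq_1)

lemma cut_0: "s \<ge> R / 2 + 1 \<Longrightarrow> cut (s, t) = 0"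
  by (simp add: cut_def beta_gl_def eq_0)

lemma cut_half: "cut (R / 2, t) = 1 / 2"
  using minus[of 0] by (simp add: cut_def beta_gl_def)

lemma gl_det_pos: "0 < gl_det p"
proof (cases "cut p = 0")
  case False
  then show ?thesis
    unfolding gl_det_def by (intro add_pos_nonneg) (auto simp: zero_less_mult_iff linorder_neq_iff)
qed (simp add: gl_det_def)

text \<open>The first two identities say that the matrices are inverse to each other. The last two say that
  the inverse matrix maps \<open>(1, - (1 - 2 b))\<close> to \<open>(1, 1)\<close>; they make
  the constants cancel in the remainders.\<close>

lemma coeffs:
  "kp p * cut p + km p * (1 - cut p) = 1" "kp p * (1 - cut p) = km p * cut p"
  "kp p + km p * (1 - 2 * cut p) = 1" "km p - kp p * (1 - 2 * cut p) = 1"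
proof -
  have d: "gl_det p \<noteq> 0" using gl_det_pos[of p] by simp
  have "kp p * cut p + km p * (1 - cut p) = (cut p * cut p + (1 - cut p) * (1 - cut p)) / gl_det p"
    by (simp add: kp_def km_def add_divide_distrib)
  then show "kp p * cut p + km p * (1 - cut p) = 1" using d by (simp add: gl_det_def)
  show "kp p * (1 - cut p) = km p * cut p" by (simp add: kp_def km_def)
  have "kp p + km p * (1 - 2 * cut p) = (cut p + (1 - cut p) * (1 - 2 * cut p)) / gl_det p"
    by (simp add: kp_def km_def add_divide_distrib)
  also have "cut p + (1 - cut p) * (1 - 2 * cut p) = gl_det p" by (simp add: gl_det_def algebra_simps)
  finally show "kp p + km p * (1 - 2 * cut p) = 1" using d by simp
  have "km p - kp p * (1 - 2 * cut p) = ((1 - cut p) - cut p * (1 - 2 * cut p)) / gl_det p"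
    by (simp add: kp_def km_def diff_divide_distrib)
  also have "(1 - cut p) - cut p * (1 - 2 * cut p) = gl_det p" by (simp add: gl_det_def algebra_simps)
  finally show "km p - kp p * (1 - 2 * cut p) = 1" using d by simp
qed

lemma smooth_cut: "smooth cut"
  unfolding cut_def beta_gl_def by (intro smooth_beta smooth_diffs smooth_fst smooth_const)

lemma smooth_gl_det: "smooth gl_det"
  unfolding gl_det_def by (intro smooth_add smooth_mult smooth_diffs smooth_const smooth_cut)

lemma t_inv: "t_invariant cut" "t_invariant gl_det" "t_invariant kp" "t_invariant km"
  by (simp_all add: t_invariant_def cut_def gl_det_def kp_def km_def)

lemma multipliers:
  "multiplier cut {..R / 2 + 1}" "multiplier (\<lambda>p. 1 - cut p) {R / 2 - 1..}"
  "multiplier kp {..R / 2 + 1}" "multiplier km {R / 2 - 1..}"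
proof -
  note l = multiplierI[where lo = "R / 2 - 1" and hi = "R / 2 + 1"]
  have d: "\<And>p. gl_det p \<noteq> 0" using gl_det_pos by (metis less_irrefl)
  show "multiplier cut {..R / 2 + 1}"
    by (rule l[where cl = 1 and ch = 0]) (auto simp: smooth_cut t_inv cut_1 cut_0)
  show "multiplier (\<lambda>p. 1 - cut p) {R / 2 - 1..}"
  proof (rule l[where cl = 0 and ch = 1])
    show "smooth (\<lambda>p. 1 - cut p)" by (intro smooth_diffs smooth_const smooth_cut)
    show "t_invariant (\<lambda>p. 1 - cut p)" using t_inv(1) unfolding t_invariant_def by metis
  qed (auto simp: cut_1 cut_0)
  show "multiplier kp {..R / 2 + 1}"
  proof (rule l[where cl = 1 and ch = 0])
    have "smooth (\<lambda>p. cut p / gl_det p)" by (rule smooth_divide[OF smooth_cut smooth_gl_det d])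
    then show "smooth kp" by (simp add: kp_def[abs_def])
  qed (auto simp: t_inv cut_1 cut_0 kp_def gl_det_def)
  show "multiplier km {R / 2 - 1..}"
  proof (rule l[where cl = 0 and ch = 1])
    have "smooth (\<lambda>p. (1 - cut p) / gl_det p)"
      by (rule smooth_divide[OF _ smooth_gl_det d]) (intro smooth_diffs smooth_const smooth_cut)
    then show "smooth km" by (simp add: km_def[abs_def])
  qed (auto simp: t_inv cut_1 cut_0 km_def gl_det_def)
qed

lemma weight_le:
  assumes "0 \<le> s" "s \<le> R"
  shows "exp (\<delta> m * \<bar>s\<bar>) \<le> exp (\<delta> m * R) * exp (0 * \<bar>s\<bar>)"
  using assms \<delta>_pos[of m] by (simp add: mult_left_mono)

lemma weight_ge: "exp (0 * \<bar>s\<bar>) \<le> 1 * exp (\<delta> m * \<bar>s\<bar>)"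
  using \<delta>_pos[of m] by simp

text \<open>As for \<open>E\<close>, the constant \<open>q\<close> of the second component is made part of
  the data.\<close>

definition G_dom :: "nat \<Rightarrow> (('n::finite) cyl_map \<times> 'n cyl_map \<times> (real ^ 'n)) set" where
  "G_dom m = {(v, w, q). v \<in> cyl_maps {0..R} \<and> sobolev {0..R} (3 + m) 0 v \<and>
     sobolev_loc (3 + m) w \<and> sobolev UNIV (3 + m) (\<delta> m) (C_remainder \<beta> a w q)}"

definition G_nrm :: "nat \<Rightarrow> ('n::finite) cyl_map \<times> 'n cyl_map \<times> (real ^ 'n) \<Rightarrow> real" where
  "G_nrm m = (\<lambda>(v, w, q). sqrt ((sobolev_norm {0..R} (3 + m) 0 v)\<^sup>2 + (sqrt ((norm q)\<^sup>2
     + (sobolev_norm UNIV (3 + m) (\<delta> m) (C_remainder \<beta> a w q))\<^sup>2))\<^sup>2))"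

lemma C_remainder_cut: "C_remainder \<beta> a w q p = w p - (1 - 2 * cut p) *\<^sub>R q"
  by (cases p) (simp add: C_remainder_def cut_def)

lemma remainder_unique:
  assumes "sobolev UNIV k (\<delta> m) (C_remainder \<beta> a w q)" "sobolev UNIV k (\<delta> m) (C_remainder \<beta> a w e)"
  shows "q = e"
proof -
  have s: "sobolev UNIV k (\<delta> m) (\<lambda>p. C_remainder \<beta> a w q p + (-1) *\<^sub>R C_remainder \<beta> a w e p)"
    using assms by (intro sobolev_add sobolev_scaleR strip_base_simps)
  have "e - q = 0"
    by (rule sobolev_eventually_const[OF strip_base_simps(1) s, of "R / 2 + 1"])
      (use \<delta>_pos[of m] in \<open>auto simp: C_remainder_cut cut_0\<close>)
  then show ?thesis by simp
qed

lemma G_level: "(v, w) \<in> Level (G_space \<delta> \<beta> a) m \<longleftrightarrow> (\<exists>q. (v, w, q) \<in> G_dom m)"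
  by (auto simp: G_space_def sc_prod_def Z_space_def C_space_def G_dom_def Let_def)

lemma C_lnorm:
  assumes "sobolev UNIV (3 + m) (\<delta> m) (C_remainder \<beta> a w q)"
  shows "LNorm (C_space \<delta> \<beta> a) m w
    = sqrt ((norm q)\<^sup>2 + (sobolev_norm UNIV (3 + m) (\<delta> m) (C_remainder \<beta> a w q))\<^sup>2)"
proof -
  have "(THE c. sobolev UNIV (3 + m) (\<delta> m) (C_remainder \<beta> a w c)) = q"
    using assms remainder_unique[OF _ assms] by (rule the_equality)
  then show ?thesis by (simp add: C_space_def Let_def)
qed

lemma G_lnorm: "(v, w, q) \<in> G_dom m \<Longrightarrow> LNorm (G_space \<delta> \<beta> a) m (v, w) = G_nrm m (v, w, q)"
  using C_lnorm[of m w q] by (simp add: G_dom_def G_space_def sc_prod_def Z_space_def G_nrm_def Let_def)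

section \<open>The inverse of the total gluing map\<close>

text \<open>The average of the glued map over the middle circle, from which \<open>av\<close> is recovered.\<close>

definition mid_mean :: "('n::finite) cyl_map \<Rightarrow> real ^ 'n" where
  "mid_mean v = (LINT t:{0..1}|lborel. v (R / 2, t))"

text \<open>The inverse matrix applied to \<open>(v - m, w)\<close>, where \<open>m\<close> is the average
  of \<open>v\<close> over the middle circle. The second component is written in the coordinates
  of \<open>\<real>\<^sup>- \<times> S\<^sup>1\<close>.\<close>

definition unglue :: "('n::finite) cyl_map \<times> 'n cyl_map \<Rightarrow> 'n cyl_map \<times> 'n cyl_map" where
  "unglue = (\<lambda>(v, w).
     (\<lambda>p. if 0 \<le> fst p then mid_mean v + (kp p *\<^sub>R (v p - mid_mean v) - km p *\<^sub>R w p) else 0,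
      \<lambda>(s, t). if s \<le> 0 then mid_mean v + (km (s + R, t + \<theta>) *\<^sub>R (v (s + R, t + \<theta>) - mid_mean v)
          + kp (s + R, t + \<theta>) *\<^sub>R w (s + R, t + \<theta>)) else 0))"

text \<open>The matrices with rows \<open>(s, r), (- r, s)\<close> and \<open>(k, - l), (l, k)\<close> are
  inverse to each other.\<close>

lemma solve_2x2:
  fixes x y :: "'v::real_vector"
  assumes "k * s + l * r = 1" "k * r = l * s"
  shows "k *\<^sub>R (s *\<^sub>R x + r *\<^sub>R y) - l *\<^sub>R (- (r *\<^sub>R x) + s *\<^sub>R y) = x"
    and "l *\<^sub>R (s *\<^sub>R x + r *\<^sub>R y) + k *\<^sub>R (- (r *\<^sub>R x) + s *\<^sub>R y) = y"
    and "s *\<^sub>R (k *\<^sub>R x - l *\<^sub>R y) + r *\<^sub>R (l *\<^sub>R x + k *\<^sub>R y) = x"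
    and "- (r *\<^sub>R (k *\<^sub>R x - l *\<^sub>R y)) + s *\<^sub>R (l *\<^sub>R x + k *\<^sub>R y) = y"
proof -
  have "k *\<^sub>R (s *\<^sub>R x + r *\<^sub>R y) - l *\<^sub>R (- (r *\<^sub>R x) + s *\<^sub>R y)
      = (k * s + l * r) *\<^sub>R x + (k * r - l * s) *\<^sub>R y"
    "l *\<^sub>R (s *\<^sub>R x + r *\<^sub>R y) + k *\<^sub>R (- (r *\<^sub>R x) + s *\<^sub>R y)
      = (l * s - k * r) *\<^sub>R x + (k * s + l * r) *\<^sub>R y"
    "s *\<^sub>R (k *\<^sub>R x - l *\<^sub>R y) + r *\<^sub>R (l *\<^sub>R x + k *\<^sub>R y)
      = (k * s + l * r) *\<^sub>R x + (k * r - l * s) *\<^sub>R y"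
    "- (r *\<^sub>R (k *\<^sub>R x - l *\<^sub>R y)) + s *\<^sub>R (l *\<^sub>R x + k *\<^sub>R y)
      = (l * s - k * r) *\<^sub>R x + (k * s + l * r) *\<^sub>R y"
    by (simp_all add: algebra_simps)
  then show "k *\<^sub>R (s *\<^sub>R x + r *\<^sub>R y) - l *\<^sub>R (- (r *\<^sub>R x) + s *\<^sub>R y) = x"
    and "l *\<^sub>R (s *\<^sub>R x + r *\<^sub>R y) + k *\<^sub>R (- (r *\<^sub>R x) + s *\<^sub>R y) = y"
    and "s *\<^sub>R (k *\<^sub>R x - l *\<^sub>R y) + r *\<^sub>R (l *\<^sub>R x + k *\<^sub>R y) = x"
    and "- (r *\<^sub>R (k *\<^sub>R x - l *\<^sub>R y)) + s *\<^sub>R (l *\<^sub>R x + k *\<^sub>R y) = y"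
    using assms by simp_all
qed

lemma oplus_cut:
  "oplus \<beta> a u (s, t) = (if s \<in> {0..R} then cut (s, t) *\<^sub>R fst u (s, t)
     + (1 - cut (s, t)) *\<^sub>R snd u (s - R, t - \<theta>) else 0)"
  by (simp add: oplus_def cut_def)

lemma ominus_cut:
  "ominus \<beta> a u (s, t) = - ((1 - cut (s, t)) *\<^sub>R (fst u (s, t) - av a u))
     + cut (s, t) *\<^sub>R (snd u (s - R, t - \<theta>) - av a u)"
  by (simp add: ominus_def cut_def)

text \<open>On the middle circle both coefficients are \<open>1/2\<close>, and the twist by the angle does
  not change the average of the second map.\<close>

lemma mid_mean_oplus:
  fixes u :: "('n::finite) cyl_map \<times> 'n cyl_map"
  assumes u: "(u, c) \<in> E_dom m"
  shows "mid_mean (oplus \<beta> a u) = av a u"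
    and "av a u = (1 / 2) *\<^sub>R ((LINT t:{0..1}|lborel. fst u (R / 2, t))
      + (LINT t:{0..1}|lborel. snd u (- (R / 2), t)))"
proof -
  have R2: "R / 2 \<in> {0..}" "- (R / 2) \<in> {..0}" using R_gt by auto
  have as: "asymptotic (3 + m) (\<delta> m) u c" and hm: "half_maps u" using u by (auto simp: E_dom_def)
  have c1: "continuous_on UNIV (\<lambda>t. fst u (R / 2, t))"
    and c2: "continuous_on UNIV (\<lambda>t. snd u (- (R / 2), t))"
    by (rule slice_continuous[OF asymptotic_continuous(1)[OF as] R2(1)],
        rule slice_continuous[OF asymptotic_continuous(2)[OF as] R2(2)])
  have c3: "continuous_on UNIV (\<lambda>t. snd u (- (R / 2), t + - \<theta>))"
    by (rule continuous_on_compose2[OF c2]) (auto intro: continuous_intros)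
  have per: "snd u (- (R / 2), t + 1) = snd u (- (R / 2), t)" for t
    using hm unfolding half_maps_def cyl_maps_def periodic_def by blast
  show av: "av a u = (1 / 2) *\<^sub>R ((LINT t:{0..1}|lborel. fst u (R / 2, t))
      + (LINT t:{0..1}|lborel. snd u (- (R / 2), t)))"
    unfolding av_def
    by (simp only: set_integral_add(2)[OF circle_integrable[OF c1] circle_integrable[OF c2]])
  have "oplus \<beta> a u (R / 2, t) = (1 / 2) *\<^sub>R (fst u (R / 2, t) + snd u (- (R / 2), t + - \<theta>))" for t
    using R_gt by (simp add: oplus_cut cut_half scaleR_add_right)
  then have "mid_mean (oplus \<beta> a u)
      = (1 / 2) *\<^sub>R (LINT t:{0..1}|lborel. fst u (R / 2, t) + snd u (- (R / 2), t + - \<theta>))"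
    unfolding mid_mean_def by (simp only: set_integral_scaleR_right)
  also have "\<dots> = av a u"
    unfolding av set_integral_add(2)[OF circle_integrable[OF c1] circle_integrable[OF c3]]
      circle_integral_shift[OF c2 per] ..
  finally show "mid_mean (oplus \<beta> a u) = av a u" .
qed

text \<open>On \<open>[0, R]\<close> this is the inverse matrix. Beyond either end the cutoff is constant,
  the system decouples, and \<open>\<ominus>u\<close> alone gives the map that is still defined
  there.\<close>

lemma unglue_boxdot:
  assumes u: "(u, c) \<in> E_dom m"
  shows "unglue (boxdot \<beta> a u) = u"
proof -
  let ?m = "av a u"
  note mn = mid_mean_oplus(1)[OF u]
  have hm: "half_maps u" using u by (auto simp: E_dom_def)
  have off: "s < 0 \<Longrightarrow> fst u (s, t) = 0" "s > 0 \<Longrightarrow> snd u (s, t) = 0" for s t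
    using hm by (auto simp: half_maps_def cyl_maps_def)
  have kR: "kp (s, t) = 0 \<and> km (s, t) = 1 \<and> cut (s, t) = 0" if "s > R" for s t
    using cut_0[of s t] that R_gt by (simp add: kp_def km_def gl_det_def)
  have k0: "kp (s, t) = 1 \<and> km (s, t) = 0 \<and> cut (s, t) = 1" if "s < 0" for s t
    using cut_1[of s t] that R_gt by (simp add: kp_def km_def gl_det_def)
  have split: "oplus \<beta> a u (s, t) - ?m
      = cut (s, t) *\<^sub>R (fst u (s, t) - ?m) + (1 - cut (s, t)) *\<^sub>R (snd u (s - R, t - \<theta>) - ?m)"
    if "0 \<le> s" "s \<le> R" for s t
    using that by (simp add: oplus_cut algebra_simps)
  have P: "?m + (kp p *\<^sub>R (oplus \<beta> a u p - ?m) - km p *\<^sub>R ominus \<beta> a u p) = fst u p" if p: "0 \<le> fst p" for p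
  proof -
    obtain s t where st: "p = (s, t)" by (cases p)
    show ?thesis
    proof (cases "s \<le> R")
      case True
      then show ?thesis
        using solve_2x2(1)[OF coeffs(1,2)[of p], of "fst u p - ?m" "snd u (s - R, t - \<theta>) - ?m"]
          split[of s t] p unfolding st ominus_cut by simp
    next
      case False
      then show ?thesis using kR[of s t] unfolding st ominus_cut by simp
    qed
  qed
  have M: "?m + (km p *\<^sub>R (oplus \<beta> a u p - ?m) + kp p *\<^sub>R ominus \<beta> a u p) = snd u (fst p - R, snd p - \<theta>)"
    if p: "fst p \<le> R" for p
  proof -
    obtain s t where st: "p = (s, t)" by (cases p)
    show ?thesis
    proof (cases "0 \<le> s")
      case True
      then show ?thesis
        using solve_2x2(2)[OF coeffs(1,2)[of p], of "fst u p - ?m" "snd u (s - R, t - \<theta>) - ?m"]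
          split[of s t] p unfolding st ominus_cut by simp
    next
      case False
      then show ?thesis using k0[of s t] unfolding st ominus_cut by simp
    qed
  qed
  have "fst (unglue (boxdot \<beta> a u)) p = fst u p" for p
  proof (cases "0 \<le> fst p")
    case True
    then show ?thesis using P[OF True] by (simp add: unglue_def boxdot_def mn)
  next
    case False
    then show ?thesis using off(1)[of "fst p" "snd p"] by (simp add: unglue_def boxdot_def)
  qed
  moreover have "snd (unglue (boxdot \<beta> a u)) (s, t) = snd u (s, t)" for s t
  proof (cases "s \<le> 0")
    case True
    then show ?thesis using M[of "(s + R, t + \<theta>)"] by (simp add: unglue_def boxdot_def mn)
  next
    case False
    then show ?thesis using off(2)[of s t] by (simp add: unglue_def boxdot_def)
  qed
  ultimately show ?thesis by (intro prod_eqI ext) auto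
qed

text \<open>On the middle circle the two reconstructed maps are \<open>v - w\<close> and \<open>v +
  w\<close>, the latter with a twist.\<close>

lemma av_unglue:
  fixes v w :: "('n::finite) cyl_map"
  assumes x: "(v, w, q) \<in> G_dom m"
  shows "av a (unglue (v, w)) = mid_mean v"
proof -
  have v: "v \<in> cyl_maps {0..R}" "sobolev {0..R} (3 + m) 0 v" and w: "sobolev_loc (3 + m) w"
    using x by (auto simp: G_dom_def)
  have R2: "R / 2 \<in> {0..R}" using R_gt by auto
  have cv: "continuous_on UNIV (\<lambda>t. v (R / 2, t))"
    by (rule slice_continuous[OF _ R2]) (use v in \<open>simp add: sobolev_def\<close>)
  have cw: "continuous_on UNIV (\<lambda>t. w (R / 2, t))"
    by (rule slice_continuous[of UNIV]) (use w in \<open>auto simp: sobolev_loc_def\<close>)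
  have c3: "continuous_on UNIV (\<lambda>t. v (R / 2, t) + w (R / 2, t))"
    by (intro continuous_on_add cv cw)
  have c4: "continuous_on UNIV (\<lambda>t. v (R / 2, t + \<theta>) + w (R / 2, t + \<theta>))"
    by (rule continuous_on_compose2[OF c3, of _ "\<lambda>t. t + \<theta>"]) (auto intro: continuous_intros)
  have c5: "continuous_on UNIV (\<lambda>t. v (R / 2, t) - w (R / 2, t))"
    by (intro continuous_on_diff cv cw)
  have per: "v (R / 2, t + 1) + w (R / 2, t + 1) = v (R / 2, t) + w (R / 2, t)" for t
  proof -
    have "v (R / 2, t + 1) = v (R / 2, t)" "w (R / 2, t + 1) = w (R / 2, t)"
      using v w unfolding cyl_maps_def sobolev_loc_def periodic_def by blast+
    then show ?thesis by simp
  qed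
  have k: "kp (R / 2, t) = 1" "km (R / 2, t) = 1" for t
    by (simp_all add: kp_def km_def gl_det_def cut_half)
  have "fst (unglue (v, w)) (R / 2, t) + snd (unglue (v, w)) (- (R / 2), t)
      = (v (R / 2, t) - w (R / 2, t)) + (v (R / 2, t + \<theta>) + w (R / 2, t + \<theta>))" for t
  proof -
    have "- (R / 2) + R = R / 2" by simp
    then show ?thesis using R_gt by (simp add: unglue_def k)
  qed
  then have "av a (unglue (v, w)) = (1 / 2) *\<^sub>R (LINT t:{0..1}|lborel.
      (v (R / 2, t) - w (R / 2, t)) + (v (R / 2, t + \<theta>) + w (R / 2, t + \<theta>)))"
    unfolding av_def by simp
  also have "\<dots> = (1 / 2) *\<^sub>R ((LINT t:{0..1}|lborel. v (R / 2, t) - w (R / 2, t))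
      + (LINT t:{0..1}|lborel. v (R / 2, t) + w (R / 2, t)))"
    unfolding set_integral_add(2)[OF circle_integrable[OF c5] circle_integrable[OF c4]]
      circle_integral_shift[OF c3 per, of \<theta>] ..
  also have "\<dots> = (1 / 2) *\<^sub>R ((mid_mean v - (LINT t:{0..1}|lborel. w (R / 2, t)))
      + (mid_mean v + (LINT t:{0..1}|lborel. w (R / 2, t))))"
    unfolding mid_mean_def
    by (simp only: set_integral_add(2)[OF circle_integrable[OF cv] circle_integrable[OF cw]]
        set_integral_diff(2)[OF circle_integrable[OF cv] circle_integrable[OF cw]])
  also have "\<dots> = mid_mean v" by (simp add: scaleR_2[symmetric])
  finally show ?thesis .
qed

lemma boxdot_unglue:
  assumes x: "(v, w, q) \<in> G_dom m"
  shows "boxdot \<beta> a (unglue (v, w)) = (v, w)"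
proof -
  let ?u = "unglue (v, w)" and ?m = "mid_mean v"
  note avm = av_unglue[OF x]
  have off: "s \<notin> {0..R} \<Longrightarrow> v (s, t) = 0" for s t
    using x by (auto simp: G_dom_def cyl_maps_def)
  have P: "fst ?u p = ?m + (kp p *\<^sub>R (v p - ?m) - km p *\<^sub>R w p)" if "0 \<le> fst p" for p
    using that by (simp add: unglue_def)
  have M: "snd ?u (s - R, t - \<theta>) = ?m + (km (s, t) *\<^sub>R (v (s, t) - ?m) + kp (s, t) *\<^sub>R w (s, t))"
    if "s \<le> R" for s t
    using that by (simp add: unglue_def)
  have "oplus \<beta> a ?u (s, t) = v (s, t)" for s t
  proof (cases "s \<in> {0..R}")
    case True
    let ?p = "(s, t)"
    have "cut ?p *\<^sub>R fst ?u ?p + (1 - cut ?p) *\<^sub>R snd ?u (s - R, t - \<theta>)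
      = ?m + (cut ?p *\<^sub>R (kp ?p *\<^sub>R (v ?p - ?m) - km ?p *\<^sub>R w ?p)
        + (1 - cut ?p) *\<^sub>R (km ?p *\<^sub>R (v ?p - ?m) + kp ?p *\<^sub>R w ?p))"
      using True P[of ?p] M[of s t] by (simp only: atLeastAtMost_iff fst_conv simp_thms)
        (simp add: scaleR_add_right scaleR_diff_left)
    also have "\<dots> = v ?p" using solve_2x2(3)[OF coeffs(1,2)[of ?p], of "v ?p - ?m" "w ?p"] by simp
    finally show ?thesis using True by (simp add: oplus_cut)
  next
    case False
    then show ?thesis using off[OF False, of t] by (auto simp: oplus_cut)
  qed
  moreover have "ominus \<beta> a ?u (s, t) = w (s, t)" for s t
  proof -
    let ?p = "(s, t)"
    let ?x = "kp ?p *\<^sub>R (v ?p - ?m) - km ?p *\<^sub>R w ?p" and ?y = "km ?p *\<^sub>R (v ?p - ?m) + kp ?p *\<^sub>R w ?p"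
    have 1: "(1 - cut ?p) *\<^sub>R (fst ?u ?p - ?m) = (1 - cut ?p) *\<^sub>R ?x"
    proof (cases "0 \<le> s")
      case True
      then show ?thesis using P[of ?p] by simp
    next
      case False
      then show ?thesis using cut_1[of s t] R_gt by simp
    qed
    have 2: "cut ?p *\<^sub>R (snd ?u (s - R, t - \<theta>) - ?m) = cut ?p *\<^sub>R ?y"
    proof (cases "s \<le> R")
      case True
      then show ?thesis using M[of s t] by simp
    next
      case False
      then show ?thesis using cut_0[of s t] R_gt by simp
    qed
    show ?thesis
      unfolding ominus_cut avm 1 2 by (rule solve_2x2(4)[OF coeffs(1,2)[of ?p]])
  qed
  ultimately show ?thesis unfolding boxdot_def by (intro prod_eqI ext) auto
qed

section \<open>Bounds for the total gluing map and its inverse\<close>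

lemma E_tame:
  "tame (E_dom m) (E_nrm m) {0..} (3 + m) (\<delta> m) (\<lambda>x p. fst (fst x) p - snd x)"
  "tame (E_dom m) (E_nrm m) {..0} (3 + m) (\<delta> m) (\<lambda>x p. snd (fst x) p - snd x)"
  "tame_vec (E_dom m) (E_nrm m) snd"
proof -
  have "x \<le> sqrt (x\<^sup>2 + y\<^sup>2 + z\<^sup>2)" "y \<le> sqrt (x\<^sup>2 + y\<^sup>2 + z\<^sup>2)" "z \<le> sqrt (x\<^sup>2 + y\<^sup>2 + z\<^sup>2)"
    for x y z :: real
    by (auto intro!: real_le_rsqrt simp: add.assoc)
  then show "tame (E_dom m) (E_nrm m) {0..} (3 + m) (\<delta> m) (\<lambda>x p. fst (fst x) p - snd x)"
    "tame (E_dom m) (E_nrm m) {..0} (3 + m) (\<delta> m) (\<lambda>x p. snd (fst x) p - snd x)"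
    "tame_vec (E_dom m) (E_nrm m) snd"
    unfolding tame_def tame_vec_def
    by (auto simp: E_dom_def E_nrm_def asymptotic_def intro!: exI[of _ 1])
qed

lemma interior_halves: "interior {0..R} = {0<..<R}" "interior {..R} = {..<R}" "interior {0..} = {0::real<..}"
  by simp_all

text \<open>In terms of \<open>r\<^sup>\<plusminus> = u\<^sup>\<plusminus> - c\<close> (with
  \<open>r\<^sup>-\<close> moved to \<open>s \<le> R\<close>) the glued map is \<open>c + b
  r\<^sup>+ + (1 - b) r\<^sup>-\<close>, the remainder of the anti-glued map with respect to
  \<open>q = av - c\<close> is \<open>- (1 - b) r\<^sup>+ + b r\<^sup>-\<close>, and
  \<open>q\<close> is an average of \<open>r\<^sup>\<plusminus>\<close> over circles.\<close>

lemma boxdot_tame: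
  defines "X \<equiv> \<lambda>m. E_dom m :: ('n::finite) pair_with_limit set"
  shows "tame (X m) (E_nrm m) {0..R} (3 + m) 0 (\<lambda>x. oplus \<beta> a (fst x))"
    and "tame (X m) (E_nrm m) UNIV (3 + m) (\<delta> m)
      (\<lambda>x. C_remainder \<beta> a (ominus \<beta> a (fst x)) (av a (fst x) - snd x))"
    and "tame_vec (X m) (E_nrm m) (\<lambda>x. av a (fst x) - snd x)"
  unfolding X_def
proof -
  let ?k = "3 + m" and ?d = "\<delta> m" and ?e = "E_nrm m"
  let ?X = "E_dom m :: 'n pair_with_limit set"
  note sb = strip_base_simps
  have R0: "0 < R" using R_gt by simp
  have d0: "0 \<le> ?d" using \<delta>_pos[of m] by simp
  define rp where "rp x p = fst (fst x) p - snd x" for x :: "'n pair_with_limit" and p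
  define rm where "rm x = (\<lambda>(s, t). snd (fst x) (s + - R, t + - \<theta>) - snd x)"
    for x :: "'n pair_with_limit"
  have Trp: "tame ?X ?e {0..} ?k ?d rp" unfolding rp_def using E_tame(1) .
  have Trm: "tame ?X ?e {..R} ?k ?d rm"
  proof -
    have "(+) (- (- R)) ` {..0} = {..R}" by simp
    then show ?thesis
      using tame_shift[OF E_tame(2)[of m] sb(3), of "- R" "- \<theta>"] unfolding rm_def by simp
  qed
  have per: "periodic (fst (fst x))" "periodic (snd (fst x))" if "x \<in> ?X" for x
    using that by (auto simp: E_dom_def half_maps_def cyl_maps_def)
  have "tame ?X ?e {0..R} ?k 0 (\<lambda>x p. cut p *\<^sub>R rp x p)"
    by (rule tame_mult[OF Trp multipliers(1) sb(2) sb(4)[OF R0] _ _ weight_ge])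
      (auto simp: interior_halves)
  moreover have "tame ?X ?e {0..R} ?k 0 (\<lambda>x p. (1 - cut p) *\<^sub>R rm x p)"
    by (rule tame_mult[OF Trm multipliers(2) sb(3) sb(4)[OF R0] _ _ weight_ge])
      (auto simp: interior_halves)
  ultimately have 1: "tame ?X ?e {0..R} ?k 0 (\<lambda>x p. snd x + (cut p *\<^sub>R rp x p + (1 - cut p) *\<^sub>R rm x p))"
    by (intro tame_add tame_const E_tame(3) sb R0)
  show "tame ?X ?e {0..R} ?k 0 (\<lambda>x. oplus \<beta> a (fst x))"
  proof (rule tame_cong[OF 1])
    fix x assume x: "x \<in> ?X"
    show "periodic (oplus \<beta> a (fst x))"
      using periodic_shift[OF per(2)[OF x], of _ _ "- \<theta>"] per(1)[OF x]
      by (auto simp: periodic_def oplus_cut cut_def)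
    fix s t assume "s \<in> {0..R}"
    then show "snd x + (cut (s, t) *\<^sub>R rp x (s, t) + (1 - cut (s, t)) *\<^sub>R rm x (s, t)) = oplus \<beta> a (fst x) (s, t)"
      by (simp add: oplus_cut rp_def rm_def algebra_simps)
  qed
  have "tame ?X ?e UNIV ?k ?d (\<lambda>x p. (1 - cut p) *\<^sub>R rp x p)"
    by (rule tame_mult[OF Trp multipliers(2) sb(2) sb(1), where W = 1]) (use R_gt in \<open>auto simp: interior_halves\<close>)
  moreover have "tame ?X ?e UNIV ?k ?d (\<lambda>x p. cut p *\<^sub>R rm x p)"
    by (rule tame_mult[OF Trm multipliers(1) sb(3) sb(1), where W = 1]) (use R_gt in \<open>auto simp: interior_halves\<close>)
  ultimately have 2: "tame ?X ?e UNIV ?k ?d (\<lambda>x p. (-1) *\<^sub>R ((1 - cut p) *\<^sub>R rp x p) + cut p *\<^sub>R rm x p)"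
    by (intro tame_add tame_scaleR sb)
  have eq: "(-1) *\<^sub>R ((1 - cut p) *\<^sub>R rp x p) + cut p *\<^sub>R rm x p
      = C_remainder \<beta> a (ominus \<beta> a (fst x)) (av a (fst x) - snd x) p" for x p
    by (cases p) (simp add: C_remainder_cut ominus_cut rp_def rm_def algebra_simps scaleR_2[symmetric])
  show "tame ?X ?e UNIV ?k ?d (\<lambda>x. C_remainder \<beta> a (ominus \<beta> a (fst x)) (av a (fst x) - snd x))"
    using 2 unfolding eq .
  have "tame_vec ?X ?e (\<lambda>x. LINT t:{0..1}|lborel. fst (fst x) (R / 2, t) - snd x)"
    by (rule tame_trace[OF E_tame(1) sb(2) _ d0]) (use R_gt in \<open>auto simp: interior_halves\<close>)
  moreover have "tame_vec ?X ?e (\<lambda>x. LINT t:{0..1}|lborel. snd (fst x) (- (R / 2), t) - snd x)"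
    by (rule tame_trace[OF E_tame(2) sb(3) _ d0]) (use R_gt in auto)
  ultimately have "tame_vec ?X ?e (\<lambda>x. (1 / 2) *\<^sub>R ((LINT t:{0..1}|lborel. fst (fst x) (R / 2, t) - snd x)
      + (LINT t:{0..1}|lborel. snd (fst x) (- (R / 2), t) - snd x)))"
    by (intro tame_vec_scaleR tame_vec_add)
  then show "tame_vec ?X ?e (\<lambda>x. av a (fst x) - snd x)"
  proof (rule tame_vec_cong)
    fix x :: "'n pair_with_limit" assume x: "x \<in> ?X"
    obtain u c where uc: "x = (u, c)" by (cases x)
    then have as: "asymptotic ?k ?d u c" using x by (auto simp: E_dom_def)
    have "R / 2 \<in> {0..}" "- (R / 2) \<in> {..0}" using R_gt by auto
    note c1 = slice_continuous[OF asymptotic_continuous(1)[OF as] this(1)]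
      and c2 = slice_continuous[OF asymptotic_continuous(2)[OF as] this(2)]
    show "(1 / 2) *\<^sub>R ((LINT t:{0..1}|lborel. fst (fst x) (R / 2, t) - snd x)
      + (LINT t:{0..1}|lborel. snd (fst x) (- (R / 2), t) - snd x)) = av a (fst x) - snd x"
      using mid_mean_oplus(2)[of u c m] x
      unfolding uc fst_conv snd_conv circle_integral_diff_const[OF c1] circle_integral_diff_const[OF c2]
      by (simp add: algebra_simps scaleR_2[symmetric])
  qed
qed

lemma boxdot_G_dom:
  assumes x: "(u, c) \<in> E_dom m"
  shows "(oplus \<beta> a u, ominus \<beta> a u, av a u - c) \<in> G_dom m"
proof -
  have per: "periodic (fst u)" "periodic (snd u)"
    using x by (auto simp: E_dom_def half_maps_def cyl_maps_def)
  have "periodic (oplus \<beta> a u)"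
    using periodic_shift[OF per(2), of _ _ "- \<theta>"] per(1) by (auto simp: periodic_def oplus_cut cut_def)
  then have 1: "oplus \<beta> a u \<in> cyl_maps {0..R}" by (auto simp: cyl_maps_def oplus_cut)
  let ?r = "C_remainder \<beta> a (ominus \<beta> a u) (av a u - c)"
  have 2: "sobolev UNIV (3 + m) (\<delta> m) ?r" using tame_sobolev[OF boxdot_tame(2) x] by simp
  have "sobolev_loc (3 + m) (\<lambda>p. ?r p + (1 - 2 * cut p) *\<^sub>R (av a u - c))"
  proof (rule sobolev_loc_add_smooth[OF 2])
    show "0 \<le> \<delta> m" using \<delta>_pos[of m] by simp
    show "smooth (\<lambda>p. 1 - 2 * cut p)" by (intro smooth_diffs smooth_const smooth_cmult smooth_cut)
    show "t_invariant (\<lambda>p. 1 - 2 * cut p)" by (simp add: t_invariant_def cut_def)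
  qed
  then have 3: "sobolev_loc (3 + m) (ominus \<beta> a u)" by (simp add: C_remainder_cut)
  show ?thesis
    using 1 2 3 tame_sobolev[OF boxdot_tame(1) x] by (simp add: G_dom_def)
qed

lemma G_tame:
  "tame (G_dom m) (G_nrm m) {0..R} (3 + m) 0 fst"
  "tame (G_dom m) (G_nrm m) UNIV (3 + m) (\<delta> m) (\<lambda>x. C_remainder \<beta> a (fst (snd x)) (snd (snd x)))"
  "tame_vec (G_dom m) (G_nrm m) (\<lambda>x. snd (snd x))"
proof -
  have "x \<le> sqrt (x\<^sup>2 + (sqrt (y\<^sup>2 + z\<^sup>2))\<^sup>2)" "y \<le> sqrt (x\<^sup>2 + (sqrt (y\<^sup>2 + z\<^sup>2))\<^sup>2)"
    "z \<le> sqrt (x\<^sup>2 + (sqrt (y\<^sup>2 + z\<^sup>2))\<^sup>2)" for x y z :: real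
    by (auto intro!: real_le_rsqrt)
  then show "tame (G_dom m) (G_nrm m) {0..R} (3 + m) 0 fst"
    "tame (G_dom m) (G_nrm m) UNIV (3 + m) (\<delta> m) (\<lambda>x. C_remainder \<beta> a (fst (snd x)) (snd (snd x)))"
    "tame_vec (G_dom m) (G_nrm m) (\<lambda>x. snd (snd x))"
    unfolding tame_def tame_vec_def
    by (auto simp: G_dom_def G_nrm_def intro!: exI[of _ 1])
qed

lemma unglue_periodic:
  assumes "(v, w, q) \<in> G_dom m"
  shows "periodic (fst (unglue (v, w)))" "periodic (snd (unglue (v, w)))"
proof -
  have p: "periodic v" "periodic w"
    using assms by (auto simp: G_dom_def cyl_maps_def sobolev_loc_def)
  show "periodic (fst (unglue (v, w)))"
    using p by (auto simp: periodic_def unglue_def kp_def km_def gl_det_def cut_def)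
  show "periodic (snd (unglue (v, w)))"
    using periodic_shift[OF p(1), of _ _ \<theta>] periodic_shift[OF p(2), of _ _ \<theta>]
    by (auto simp: periodic_def unglue_def kp_def km_def gl_det_def cut_def)
qed

text \<open>With \<open>c = m - q\<close> and the remainder \<open>\<rho>\<close>, the maps
  \<open>u\<^sup>\<plusminus> - c\<close> are the inverse matrix applied to \<open>(v - c,
  \<rho>)\<close>: the terms with \<open>q\<close> cancel by the last two identities in
  \<open>coeffs\<close>. The map \<open>v - c\<close> on the finite cylinder is extended by zero
  to a half-cylinder, which the supports of \<open>kp\<close> and \<open>km\<close> permit.\<close>

lemma unglue_tame:
  fixes m
  defines "X \<equiv> G_dom m :: (('n::finite) cyl_map \<times> 'n cyl_map \<times> (real ^ 'n)) set"
    and "c \<equiv> \<lambda>x :: 'n cyl_map \<times> 'n cyl_map \<times> (real ^ 'n). mid_mean (fst x) - snd (snd x)"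
  shows "tame_vec X (G_nrm m) c"
    and "tame X (G_nrm m) {0..} (3 + m) (\<delta> m) (\<lambda>x p. fst (unglue (fst x, fst (snd x))) p - c x)"
    and "tame X (G_nrm m) {..0} (3 + m) (\<delta> m) (\<lambda>x p. snd (unglue (fst x, fst (snd x))) p - c x)"
proof -
  let ?k = "3 + m" and ?d = "\<delta> m" and ?e = "G_nrm m"
  note sb = strip_base_simps
  have R0: "0 < R" using R_gt by simp
  define \<rho> where "\<rho> x = C_remainder \<beta> a (fst (snd x)) (snd (snd x))" for x :: "'n cyl_map \<times> 'n cyl_map \<times> (real ^ 'n)"
  define z where "z x p = fst x p + (-1) *\<^sub>R c x" for x :: "'n cyl_map \<times> 'n cyl_map \<times> (real ^ 'n)" and p
  have T\<rho>: "tame X ?e UNIV ?k ?d \<rho>" unfolding X_def \<rho>_def[abs_def] by (rule G_tame)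
  have "tame_vec X ?e (\<lambda>x. mid_mean (fst x) + (-1) *\<^sub>R snd (snd x))"
    unfolding mid_mean_def X_def
    by (intro tame_vec_add tame_vec_scaleR G_tame(3) tame_trace[OF G_tame(1) sb(4)[OF R0]])
      (use R_gt in auto)
  then show Tc: "tame_vec X ?e c" by (simp add: c_def)
  have Tz: "tame X ?e {0..R} ?k 0 z"
    unfolding z_def[abs_def]
    by (rule tame_add[OF sb(4)[OF R0] _ tame_const[OF tame_vec_scaleR[OF Tc] R0]])
      (use G_tame(1)[of m] in \<open>simp add: X_def\<close>)
  have per: "periodic (fst (unglue (fst x, fst (snd x))))" "periodic (snd (unglue (fst x, fst (snd x))))"
    if "x \<in> X" for x
    using unglue_periodic[of "fst x" "fst (snd x)" "snd (snd x)" m] that by (auto simp: X_def)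
  have "tame X ?e {0..} ?k ?d (\<lambda>x p. kp p *\<^sub>R z x p)"
    by (rule tame_mult[OF Tz multipliers(3) sb(4)[OF R0] sb(2) _ _ weight_le])
      (use R_gt in \<open>auto simp: interior_halves\<close>)
  moreover have "tame X ?e {0..} ?k ?d (\<lambda>x p. km p *\<^sub>R \<rho> x p)"
    by (rule tame_mult[OF T\<rho> multipliers(4) sb(1) sb(2), where W = 1]) auto
  ultimately have 1: "tame X ?e {0..} ?k ?d (\<lambda>x p. kp p *\<^sub>R z x p + (-1) *\<^sub>R (km p *\<^sub>R \<rho> x p))"
    by (intro tame_add tame_scaleR sb)
  have P: "kp p *\<^sub>R z x p + (-1) *\<^sub>R (km p *\<^sub>R \<rho> x p)
      = mid_mean (fst x) + (kp p *\<^sub>R (fst x p - mid_mean (fst x)) - km p *\<^sub>R fst (snd x) p) - c x" for x p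
  proof -
    have "kp p *\<^sub>R z x p + (-1) *\<^sub>R (km p *\<^sub>R \<rho> x p)
      = kp p *\<^sub>R (fst x p - mid_mean (fst x)) - km p *\<^sub>R fst (snd x) p
        + (kp p + km p * (1 - 2 * cut p)) *\<^sub>R snd (snd x)"
      by (simp add: z_def \<rho>_def c_def C_remainder_cut algebra_simps)
    then show ?thesis by (simp add: coeffs c_def)
  qed
  show "tame X ?e {0..} ?k ?d (\<lambda>x p. fst (unglue (fst x, fst (snd x))) p - c x)"
  proof (rule tame_cong[OF 1])
    fix x assume x: "x \<in> X"
    show "periodic (\<lambda>p. fst (unglue (fst x, fst (snd x))) p - c x)"
      using per(1)[OF x] by (simp add: periodic_def)
    fix s t :: real assume "s \<in> {0..}"
    then show "kp (s, t) *\<^sub>R z x (s, t) + (-1) *\<^sub>R (km (s, t) *\<^sub>R \<rho> x (s, t))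
        = fst (unglue (fst x, fst (snd x))) (s, t) - c x"
      unfolding P by (simp add: unglue_def)
  qed
  have "tame X ?e {..R} ?k ?d (\<lambda>x p. km p *\<^sub>R z x p)"
    by (rule tame_mult[OF Tz multipliers(4) sb(4)[OF R0] sb(3) _ _ weight_le])
      (use R_gt in \<open>auto simp: interior_halves\<close>)
  moreover have "tame X ?e {..R} ?k ?d (\<lambda>x p. kp p *\<^sub>R \<rho> x p)"
    by (rule tame_mult[OF T\<rho> multipliers(3) sb(1) sb(3), where W = 1]) auto
  ultimately have "tame X ?e {..R} ?k ?d (\<lambda>x p. km p *\<^sub>R z x p + kp p *\<^sub>R \<rho> x p)"
    by (intro tame_add sb)
  moreover have "(+) (- R) ` {..R} = {..0}"
    by (rule set_eqI) (simp only: mem_translate, auto)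
  ultimately
  have 2: "tame X ?e {..0} ?k ?d (\<lambda>x (s, t). km (s + R, t + \<theta>) *\<^sub>R z x (s + R, t + \<theta>)
      + kp (s + R, t + \<theta>) *\<^sub>R \<rho> x (s + R, t + \<theta>))"
    using tame_shift[of X ?e "{..R}" ?k ?d "\<lambda>x p. km p *\<^sub>R z x p + kp p *\<^sub>R \<rho> x p" R \<theta>]
    by (simp only: sb)
  have M: "km p *\<^sub>R z x p + kp p *\<^sub>R \<rho> x p
      = mid_mean (fst x) + (km p *\<^sub>R (fst x p - mid_mean (fst x)) + kp p *\<^sub>R fst (snd x) p) - c x" for x p
  proof -
    have "km p *\<^sub>R z x p + kp p *\<^sub>R \<rho> x p
      = km p *\<^sub>R (fst x p - mid_mean (fst x)) + kp p *\<^sub>R fst (snd x) p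
        + (km p - kp p * (1 - 2 * cut p)) *\<^sub>R snd (snd x)"
      by (simp add: z_def \<rho>_def c_def C_remainder_cut algebra_simps)
    then show ?thesis by (simp add: coeffs c_def)
  qed
  show "tame X ?e {..0} ?k ?d (\<lambda>x p. snd (unglue (fst x, fst (snd x))) p - c x)"
  proof (rule tame_cong[OF 2])
    fix x assume x: "x \<in> X"
    show "periodic (\<lambda>p. snd (unglue (fst x, fst (snd x))) p - c x)"
      using per(2)[OF x] by (simp add: periodic_def)
    fix s t :: real assume "s \<in> {..0}"
    then show "(case (s, t) of (s, t) \<Rightarrow> km (s + R, t + \<theta>) *\<^sub>R z x (s + R, t + \<theta>)
        + kp (s + R, t + \<theta>) *\<^sub>R \<rho> x (s + R, t + \<theta>))
        = snd (unglue (fst x, fst (snd x))) (s, t) - c x"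
      unfolding prod.case M by (simp add: unglue_def)
  qed
qed

lemma unglue_E_dom:
  assumes x: "(v, w, q) \<in> G_dom m"
  shows "(unglue (v, w), mid_mean v - q) \<in> E_dom m"
  using unglue_periodic[OF x] tame_sobolev[OF unglue_tame(2) x] tame_sobolev[OF unglue_tame(3) x]
  by (auto simp: E_dom_def half_maps_def cyl_maps_def asymptotic_def) (auto simp: unglue_def)

section \<open>The isomorphism and the splitting\<close>

lemma av_linear:
  assumes u: "(u, c) \<in> E_dom m"
  shows "(w, d) \<in> E_dom m \<Longrightarrow> av a (u + w) = av a u + av a w"
    and "av a (r *\<^sub>R u) = r *\<^sub>R av a u"
proof -
  have int: "set_integrable lborel {0..1} (\<lambda>t. fst u (R / 2, t) + snd u (- (R / 2), t))"
    if "(u, c) \<in> E_dom m" for u c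
  proof -
    have as: "asymptotic (3 + m) (\<delta> m) u c" using that by (auto simp: E_dom_def)
    have "R / 2 \<in> {0..}" "- (R / 2) \<in> {..0}" using R_gt by auto
    note c1 = slice_continuous[OF asymptotic_continuous(1)[OF as] this(1)]
      and c2 = slice_continuous[OF asymptotic_continuous(2)[OF as] this(2)]
    show ?thesis by (intro circle_integrable continuous_on_add c1 c2)
  qed
  show "av a (r *\<^sub>R u) = r *\<^sub>R av a u"
  proof -
    have "(\<lambda>t. fst (r *\<^sub>R u) (R / 2, t) + snd (r *\<^sub>R u) (- (R / 2), t))
        = (\<lambda>t. r *\<^sub>R (fst u (R / 2, t) + snd u (- (R / 2), t)))"
      by (simp add: scaleR_fun_def scaleR_add_right)
    then show ?thesis unfolding av_def by (simp only: set_integral_scaleR_right scaleR_left_commute)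
  qed
  assume w: "(w, d) \<in> E_dom m"
  have "(\<lambda>t. fst (u + w) (R / 2, t) + snd (u + w) (- (R / 2), t))
      = (\<lambda>t. (fst u (R / 2, t) + snd u (- (R / 2), t)) + (fst w (R / 2, t) + snd w (- (R / 2), t)))"
    by (simp add: plus_fun_def add_ac)
  then show "av a (u + w) = av a u + av a w"
    unfolding av_def
    by (simp only: set_integral_add(2)[OF int[OF u] int[OF w]] scaleR_add_right)
qed

lemma boxdot_linear: "linear_on (Level (E_space \<delta>) 0) (boxdot \<beta> a)"
  unfolding linear_on_def
proof (intro conjI ballI allI)
  fix x y :: "('a cyl_map \<times> 'a cyl_map)"
  assume "x \<in> Level (E_space \<delta>) 0"
  then obtain c where c: "(x, c) \<in> E_dom 0" unfolding E_level by (rule exE)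
  show "boxdot \<beta> a (r *\<^sub>R x) = r *\<^sub>R boxdot \<beta> a x" for r
    by (auto simp: boxdot_def fun_eq_iff oplus_cut ominus_cut av_linear(2)[OF c] scaleR_fun_def
        algebra_simps)
  assume "y \<in> Level (E_space \<delta>) 0"
  then obtain d where "(y, d) \<in> E_dom 0" unfolding E_level by (rule exE)
  from av_linear(1)[OF c this]
  show "boxdot \<beta> a (x + y) = boxdot \<beta> a x + boxdot \<beta> a y"
    by (auto simp: boxdot_def fun_eq_iff oplus_cut ominus_cut plus_fun_def algebra_simps)
qed

lemma boxdot_bij:
  "bij_betw (boxdot \<beta> a) (Level (E_space \<delta> :: (('n::finite) cyl_map \<times> 'n cyl_map) sc_space) m)
    (Level (G_space \<delta> \<beta> a) m)"
proof (rule bij_betw_byWitness[where f' = unglue])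
  let ?E = "E_space \<delta> :: ('n cyl_map \<times> 'n cyl_map) sc_space"
  show "\<forall>x\<in>Level ?E m. unglue (boxdot \<beta> a x) = x"
    using unglue_boxdot by (auto simp: E_level)
  show "\<forall>y\<in>Level (G_space \<delta> \<beta> a) m. boxdot \<beta> a (unglue y) = y"
    using boxdot_unglue by (auto simp: G_level)
  show "boxdot \<beta> a ` Level ?E m \<subseteq> Level (G_space \<delta> \<beta> a) m"
    using boxdot_G_dom by (fastforce simp: E_level G_level boxdot_def)
  show "unglue ` Level (G_space \<delta> \<beta> a) m \<subseteq> Level ?E m"
    using unglue_E_dom by (fastforce simp: E_level G_level)
qed

lemma boxdot_bounded:
  "\<exists>C. \<forall>u\<in>Level (E_space \<delta> :: (('n::finite) cyl_map \<times> 'n cyl_map) sc_space) m.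
    LNorm (G_space \<delta> \<beta> a) m (boxdot \<beta> a u) \<le> C * LNorm (E_space \<delta>) m u"
proof -
  let ?X = "E_dom m :: 'n pair_with_limit set"
  obtain C1 where C1: "\<And>x. x \<in> ?X \<Longrightarrow> sobolev_norm {0..R} (3 + m) 0 (oplus \<beta> a (fst x)) \<le> C1 * E_nrm m x"
    using boxdot_tame(1)[of m] unfolding tame_def by blast
  obtain C2 where C2: "\<And>x. x \<in> ?X \<Longrightarrow> sobolev_norm UNIV (3 + m) (\<delta> m)
      (C_remainder \<beta> a (ominus \<beta> a (fst x)) (av a (fst x) - snd x)) \<le> C2 * E_nrm m x"
    using boxdot_tame(2)[of m] unfolding tame_def by blast
  obtain C3 where C3: "\<And>x. x \<in> ?X \<Longrightarrow> norm (av a (fst x) - snd x) \<le> C3 * E_nrm m x"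
    using boxdot_tame(3)[of m] unfolding tame_vec_def by blast
  show ?thesis
  proof (intro exI[of _ "C1 + (C3 + C2)"] ballI)
    fix u :: "'n cyl_map \<times> 'n cyl_map" assume "u \<in> Level (E_space \<delta>) m"
    then obtain c where u: "(u, c) \<in> ?X" unfolding E_level by (rule exE)
    let ?q = "av a u - c"
    let ?N1 = "sobolev_norm {0..R} (3 + m) 0 (oplus \<beta> a u)"
    let ?N2 = "sobolev_norm UNIV (3 + m) (\<delta> m) (C_remainder \<beta> a (ominus \<beta> a u) ?q)"
    have "LNorm (G_space \<delta> \<beta> a) m (boxdot \<beta> a u) = sqrt (?N1\<^sup>2 + (sqrt ((norm ?q)\<^sup>2 + ?N2\<^sup>2))\<^sup>2)"
      using G_lnorm[OF boxdot_G_dom[OF u]] by (simp add: boxdot_def G_nrm_def)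
    also have "\<dots> \<le> ?N1 + sqrt ((norm ?q)\<^sup>2 + ?N2\<^sup>2)"
      by (rule sqrt_sum_squares_le_sum) (simp_all add: sobolev_norm_nonneg)
    also have "sqrt ((norm ?q)\<^sup>2 + ?N2\<^sup>2) \<le> norm ?q + ?N2"
      by (rule sqrt_sum_squares_le_sum) (simp_all add: sobolev_norm_nonneg)
    finally have "LNorm (G_space \<delta> \<beta> a) m (boxdot \<beta> a u) \<le> ?N1 + (norm ?q + ?N2)" by simp
    also have "\<dots> \<le> C1 * E_nrm m (u, c) + (C3 * E_nrm m (u, c) + C2 * E_nrm m (u, c))"
      using C1[OF u] C2[OF u] C3[OF u] by simp
    finally show "LNorm (G_space \<delta> \<beta> a) m (boxdot \<beta> a u) \<le> (C1 + (C3 + C2)) * LNorm (E_space \<delta>) m u"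
      by (simp add: E_lnorm[OF u] algebra_simps)
  qed
qed

lemma unglue_bounded:
  "\<exists>C. \<forall>u\<in>Level (E_space \<delta> :: (('n::finite) cyl_map \<times> 'n cyl_map) sc_space) m.
    LNorm (E_space \<delta>) m u \<le> C * LNorm (G_space \<delta> \<beta> a) m (boxdot \<beta> a u)"
proof -
  let ?X = "G_dom m :: ('n cyl_map \<times> 'n cyl_map \<times> (real ^ 'n)) set"
  let ?c = "\<lambda>x. mid_mean (fst x) - snd (snd x)" and ?u = "\<lambda>x. unglue (fst x, fst (snd x))"
  obtain C1 where C1: "\<And>x. x \<in> ?X \<Longrightarrow> norm (?c x) \<le> C1 * G_nrm m x"
    using unglue_tame(1)[of m] unfolding tame_vec_def by blast
  obtain C2 where C2: "\<And>x. x \<in> ?X \<Longrightarrow> sobolev_norm {0..} (3 + m) (\<delta> m) (\<lambda>p. fst (?u x) p - ?c x) \<le> C2 * G_nrm m x"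
    using unglue_tame(2)[of m] unfolding tame_def by blast
  obtain C3 where C3: "\<And>x. x \<in> ?X \<Longrightarrow> sobolev_norm {..0} (3 + m) (\<delta> m) (\<lambda>p. snd (?u x) p - ?c x) \<le> C3 * G_nrm m x"
    using unglue_tame(3)[of m] unfolding tame_def by blast
  show ?thesis
  proof (intro exI[of _ "C1 + C2 + C3"] ballI)
    fix u :: "'n cyl_map \<times> 'n cyl_map" assume "u \<in> Level (E_space \<delta>) m"
    then obtain e where u: "(u, e) \<in> E_dom m" unfolding E_level by (rule exE)
    define x where "x = (oplus \<beta> a u, ominus \<beta> a u, av a u - e)"
    have x: "x \<in> ?X" unfolding x_def by (rule boxdot_G_dom[OF u])
    have ux: "?u x = u" using unglue_boxdot[OF u] by (simp add: x_def boxdot_def)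
    have cx: "?c x = e" using mid_mean_oplus(1)[OF u] by (simp add: x_def)
    let ?N2 = "sobolev_norm {0..} (3 + m) (\<delta> m) (\<lambda>p. fst u p - e)"
    let ?N3 = "sobolev_norm {..0} (3 + m) (\<delta> m) (\<lambda>p. snd u p - e)"
    have "LNorm (E_space \<delta>) m u = sqrt ((norm e)\<^sup>2 + ?N2\<^sup>2 + ?N3\<^sup>2)"
      using E_lnorm[OF u] by (simp add: E_nrm_def)
    also have "\<dots> \<le> norm e + ?N2 + ?N3"
      by (rule real_le_lsqrt)
        (simp_all add: sobolev_norm_nonneg power2_eq_square algebra_simps add_nonneg_nonneg)
    also have "\<dots> \<le> C1 * G_nrm m x + C2 * G_nrm m x + C3 * G_nrm m x"
      using C1[OF x] C2[OF x] C3[OF x] unfolding ux cx by simp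
    finally show "LNorm (E_space \<delta>) m u \<le> (C1 + C2 + C3) * LNorm (G_space \<delta> \<beta> a) m (boxdot \<beta> a u)"
      using G_lnorm[OF boxdot_G_dom[OF u]] by (simp add: x_def boxdot_def algebra_simps)
  qed
qed

lemma boxdot_iso:
  "sc_isomorphism (E_space \<delta> :: (('n::finite) cyl_map \<times> 'n cyl_map) sc_space) (G_space \<delta> \<beta> a) (boxdot \<beta> a)"
  unfolding sc_isomorphism_def
  using boxdot_linear boxdot_bij boxdot_bounded unglue_bounded by blast

lemma gluing_splitting:
  defines "E \<equiv> E_space \<delta> :: (('n::finite) cyl_map \<times> 'n cyl_map) sc_space"
  shows "sc_direct_sum E (sc_kernel E (oplus \<beta> a)) (sc_kernel E (ominus \<beta> a))"
    and "sc_isomorphism (sc_subspace E (sc_kernel E (ominus \<beta> a))) (Z_space a) (oplus \<beta> a)"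
proof -
  have iso: "sc_isomorphism E (sc_prod (Z_space a) (C_space \<delta> \<beta> a)) (\<lambda>u. (oplus \<beta> a u, ominus \<beta> a u))"
    using boxdot_iso unfolding E_def G_space_def boxdot_def[abs_def] .
  have nn: "0 \<le> LNorm E m x" for m x
    by (simp add: E_def E_space_def Let_def)
  have sE: "subspace (Level E 0)" "Level E m \<subseteq> Level E 0" for m
    unfolding E_def by (rule E_subspace, rule E_level_0)
  have R0: "0 < R" using R_gt by simp
  have Z0: "0 \<in> Level (Z_space a :: 'n cyl_map sc_space) m" "LNorm (Z_space a :: 'n cyl_map sc_space) m 0 = 0" for m
    using sobolev_zero[OF strip_base_simps(4)[OF R0], of "3 + m" 0, where 'n = 'n]
    by (auto simp: Z_space_def Let_def cyl_maps_def periodic_def zero_fun_def)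
  have r0: "C_remainder \<beta> a 0 0 = (\<lambda>p. 0 :: real ^ 'n)"
    by (simp add: C_remainder_cut fun_eq_iff)
  have s0: "sobolev UNIV (3 + m) (\<delta> m) (C_remainder \<beta> a 0 (0 :: real ^ 'n))" for m
    unfolding r0 by (rule sobolev_zero[OF strip_base_simps(1)])
  have "sobolev_loc (3 + m) (\<lambda>p. 0 :: real ^ 'n)" for m
    using sobolev_loc_add_smooth[OF sobolev_zero(1)[OF strip_base_simps(1), of "3 + m" "\<delta> m"] _ smooth_cut t_inv(1),
        of "0 :: real ^ 'n"] \<delta>_pos[of m] by simp
  then have C0: "0 \<in> Level (C_space \<delta> \<beta> a :: 'n cyl_map sc_space) m" for m
    using s0[of m] by (auto simp: C_space_def zero_fun_def)
  have C0': "LNorm (C_space \<delta> \<beta> a :: 'n cyl_map sc_space) m 0 = 0" for m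
    using C_lnorm[OF s0, of m] sobolev_zero(2)[OF strip_base_simps(1), of "3 + m" "\<delta> m", where 'n = 'n]
    unfolding r0 by simp
  show "sc_direct_sum E (sc_kernel E (oplus \<beta> a)) (sc_kernel E (ominus \<beta> a))"
    by (rule sc_isomorphism_onto_product(1)[OF iso sE nn Z0 C0 C0'])
  show "sc_isomorphism (sc_subspace E (sc_kernel E (ominus \<beta> a))) (Z_space a) (oplus \<beta> a)"
    by (rule sc_isomorphism_onto_product(2)[OF iso sE nn Z0 C0 C0'])
      (simp add: Z_space_def Let_def sobolev_norm_nonneg)
qed

end

theorem theorem1p27:
  fixes \<delta> :: "nat \<Rightarrow> real" and \<beta> :: "real \<Rightarrow> real" and a :: complex
    and E :: "('n::finite cyl_map \<times> 'n cyl_map) sc_space"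
  assumes "strict_mono \<delta>" and "\<delta> 0 > 0"
    and "cutoff \<beta>"
    and "cmod a < 1 / 2"
    and "E = E_space \<delta>"
  shows "(a = 0 \<longrightarrow>
            sc_isomorphism E (G0_space \<delta>) boxdot0 \<and>
            sc_direct_sum E (sc_kernel E oplus0) (sc_kernel E ominus0) \<and>
            (\<forall>u\<in>Level E 0. oplus0 u = u))
       \<and> (a \<noteq> 0 \<longrightarrow>
            sc_isomorphism E (G_space \<delta> \<beta> a) (boxdot \<beta> a) \<and>
            sc_direct_sum E (sc_kernel E (oplus \<beta> a)) (sc_kernel E (ominus \<beta> a)) \<and>
            sc_isomorphism (sc_subspace E (sc_kernel E (ominus \<beta> a))) (Z_space a) (oplus \<beta> a))"
proof (intro conjI impI)
  interpret weighted \<beta> \<delta>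
    by unfold_locales (use assms in auto)
  show "sc_isomorphism E (G0_space \<delta>) boxdot0"
    "sc_direct_sum E (sc_kernel E oplus0) (sc_kernel E ominus0)"
    unfolding assms(5) by (rule gluing_0)+
  show "\<forall>u\<in>Level E 0. oplus0 u = u" by (simp add: oplus0_def)
  assume "a \<noteq> 0"
  then interpret gluing \<beta> \<delta> a
    by unfold_locales (use assms in auto)
  show "sc_isomorphism E (G_space \<delta> \<beta> a) (boxdot \<beta> a)"
    unfolding assms(5) by (rule boxdot_iso)
  show "sc_direct_sum E (sc_kernel E (oplus \<beta> a)) (sc_kernel E (ominus \<beta> a))"
    "sc_isomorphism (sc_subspace E (sc_kernel E (ominus \<beta> a))) (Z_space a) (oplus \<beta> a)"
    unfolding assms(5) by (rule gluing_splitting)+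
qed

end
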